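(* For each $n\ge1$ let $m=m_n\ge n$ and $b_n$ be positive integers such that $b_n\ge n^{\alpha}$ for some fixed $0<\alpha\le 1$, and such that $\ln m$ is much smaller than any power of $n$, i.e. $\ln m_n=o(n^{\delta})$ for every $\delta>0$. Let $Q=(q_{jk})_{1\le j\le m,\,1\le k\le n}$ be a non-random $m\times n$ matrix with entries in $\{0,1\}$ such that $\sum_{k=1}^n q_{jk}=b_n$ for every $j=1,\dots,m$. Let $a_{jk}$, $1\le j\le m$, $1\le k\le n$, be i.i.d. standard Cauchy random variables (density $\frac1{\pi(1+x^2)}$ on $\mathbb R$), and let $\Gamma$ be the $m\times n$ random matrix with entries $\Gamma_{jk}=q_{jk}a_{jk}$. Let $\lambda_1\ge\dots\ge\lambda_n\ge0$ be the eigenvalues of $\Gamma^t\Gamma$ and put $\tilde\lambda_i=\frac{\lambda_i}{m^2b_n^2}$, $i=1,\dots,n$. Let $D=\{z\in\mathbb C:\ \Re z>0\}$, and let $\sqrt z$ denote the branch of the square root on $D$ with $\sqrt1=1$. (i) For every $z\in D$, $$\lim_{n\to\infty}E\left(\det\Big(1+\frac{z}{m^2b_n^2}\Gamma^t\Gamma\Big)\right)^{-1/2}=\lim_{n\to\infty}E\prod_{i=1}^n(1+z\tilde\lambda_i)^{-1/2}=\exp\Big(-\frac2\pi\sqrt z\Big)=\mathbf E\prod_{i=1}^\infty(1+zx_i)^{-1/2},$$ where $\mathbf E$ is the expectation with respect to the inhomogeneous Poisson point process $\{x_i\}$ on $(0,+\infty)$ with intensity $\frac{1}{\pi x^{3/2}}$.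 The convergence is uniform on compact subsets of $D$. (ii) For real $t\ge0$ and $z=t^2$ one has the following rate of convergence: for every $\epsilon>0$, $$E\left(\det\Big(1+\frac{t^2}{m^2b_n^2}\Gamma^t\Gamma\Big)\right)^{-1/2}=E\prod_{i=1}^n(1+t^2\tilde\lambda_i)^{-1/2}=\exp\Big(-\frac2\pi t\,\big(1+o(b_n^{-1/2+\epsilon})\big)\Big)\qquad(n\to\infty),$$ uniformly for $t$ in compact subsets of $[0,+\infty)$.
   Context: $E$ denotes expectation with respect to the random matrix $\Gamma$, and $1$ inside a determinant is the identity matrix. The power $-1/2$ of the determinant is understood as the product $\prod_{i=1}^n(1+z\tilde\lambda_i)^{-1/2}$ with the principal branch in each factor. A Poisson point process on $(0,+\infty)$ with intensity $\rho(x)$ is a random point configuration such that the numbers of points in disjoint intervals $I_1,\dots,I_k$ are independent Poisson random variables with parameters $\int_{I_j}\rho(x)\,dx$; equivalently, its $k$-point correlation functions are $\prod_{j=1}^k\rho(x_j)$. The $x_i$ denote the points of the configuration. In (ii), "$o(b_n^{-1/2+\epsilon})$ uniformly" means that the error term $\delta_n(t)$ in place of $o(b_n^{-1/2+\epsilon})$ satisfies $\sup_{t\in K}|\delta_n(t)|=o(b_n^{-1/2+\epsilon})$ for every compact $K\subset[0,+\infty)$. *)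

theory Defs
  imports
    "HOL-Probability.Probability"
    "HOL-Library.Landau_Symbols"
    "Jordan_Normal_Form.Schur_Decomposition"
begin

section \<open>Spectra of matrices\<close>

text \<open>Eigenvalues are roots of the characteristic polynomial, listed in decreasing order and
  repeated according to their algebraic multiplicity.\<close>

definition eigenvalues_desc :: "real mat \<Rightarrow> real list" where
  "eigenvalues_desc A = rev (sorted_list_of_multiset (proots (char_poly A)))"

text \<open>The power \<open>-1/2\<close> of \<open>det X\<close> is not the principal power of the number \<open>det X\<close>: it is the
  product of the principal powers \<open>\<mu> powr (-1/2)\<close> over the eigenvalues \<open>\<mu>\<close> of \<open>X\<close> (with multiplicity).
  For \<open>X = 1 + z A\<close>, where \<open>A\<close> has the eigenvalues \<open>\<lambda>\<^sub>i\<close>, this is the product of the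
  \<open>(1 + z \<lambda>\<^sub>i) powr (-1/2)\<close>; see \<open>det_inv_sqrt_gram\<close> and \<open>det_inv_sqrt_power2\<close> below.\<close>

definition det_inv_sqrt :: "complex mat \<Rightarrow> complex" where
  "det_inv_sqrt X = (\<Prod>\<mu>\<in>#proots (char_poly X). \<mu> powr (-1/2))"

definition sparse_mat :: "real mat \<Rightarrow> (nat \<Rightarrow> nat \<Rightarrow> real) \<Rightarrow> real mat" where
  "sparse_mat Q a = Matrix.mat (dim_row Q) (dim_col Q) (\<lambda>(j, k). Q $$ (j, k) * a j k)"

definition gram_mat :: "real mat \<Rightarrow> real mat" where
  "gram_mat G = transpose_mat G * G"

section \<open>Poisson point processes on the positive half-line\<close>

text \<open>A configuration is a locally finite subset of \<open>(0, \<infinity>)\<close>; it may accumulate at \<open>0\<close> and at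
  \<open>\<infinity>\<close>. The condition on the counts is imposed on the intervals (of any kind) of finite mass. For
  \<open>\<rho>\<close> nonnegative and integrable on compact subsets of \<open>(0, \<infinity>)\<close>, it implies that intervals of infinite mass contain infinitely many points almost surely, and that
  unbounded intervals of finite mass contain only finitely many, so that \<open>card\<close> is almost surely
  the true number of points. Since \<open>0 ^ 0 = 1\<close>, intervals of mass \<open>0\<close> are covered.\<close>

definition poisson_point_process ::
  "'b measure \<Rightarrow> (real \<Rightarrow> real) \<Rightarrow> ('b \<Rightarrow> real set) \<Rightarrow> bool" where
  "poisson_point_process N \<rho> X \<longleftrightarrow>
     prob_space N \<and>
     (\<forall>\<omega>\<in>space N. X \<omega> \<subseteq> {0<..} \<and> (\<forall>u>0. \<forall>v. finite (X \<omega> \<inter> {u..v}))) \<and>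
     (\<forall>(J :: nat set) I. finite J \<longrightarrow> disjoint_family_on I J \<longrightarrow>
        (\<forall>j\<in>J. is_interval (I j) \<and> I j \<subseteq> {0<..} \<and> set_integrable lborel (I j) \<rho>) \<longrightarrow>
        prob_space.indep_vars N (\<lambda>_. count_space UNIV) (\<lambda>j \<omega>. card (X \<omega> \<inter> I j)) J \<and>
        (\<forall>j\<in>J. \<forall>k. measure N {\<omega>\<in>space N. card (X \<omega> \<inter> I j) = k} =
           (LINT x:I j|lborel. \<rho> x) ^ k / fact k * exp (- (LINT x:I j|lborel. \<rho> x))))"

text \<open>The (possibly infinite) product over a set, without choosing an enumeration: the limit of
  the net of its finite subproducts, in analogy with \<open>infsum\<close>.\<close>

definition unordered_prod :: "('a \<Rightarrow> complex) \<Rightarrow> 'a set \<Rightarrow> complex" where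
  "unordered_prod f A = Lim (finite_subsets_at_top A) (\<lambda>F. \<Prod>x\<in>F. f x)"

section \<open>Consistency of the conventions\<close>

lemma proots_linear_factors:
  "proots (\<Prod>a\<leftarrow>as. [:- a, 1:]) = mset (as :: 'a :: idom list)"
proof (induction as)
  case (Cons a as)
  have nz: "(\<Prod>a\<leftarrow>as. [:- a, 1:]) \<noteq> 0" by (auto simp: prod_list_zero_iff)
  have "proots ([:- a, 1:] * (\<Prod>a\<leftarrow>as. [:- a, 1:])) = {#a#} + mset as"
    by (subst proots_mult) (use nz Cons in auto)
  then show ?case by simp
qed simp

lemma det_inv_sqrt_factors:
  assumes "char_poly X = (\<Prod>a\<leftarrow>as. [:- a, 1:])"
  shows "det_inv_sqrt X = (\<Prod>a\<leftarrow>as. a powr (-1/2))"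
  unfolding det_inv_sqrt_def assms proots_linear_factors
  by (simp add: prod_mset_prod_list flip: mset_map)

lemma det_inv_sqrt_power2:
  fixes X :: "complex mat"
  assumes X: "X \<in> carrier_mat n n" and nz: "Determinant.det X \<noteq> 0"
  shows "(det_inv_sqrt X)\<^sup>2 = 1 / Determinant.det X"
proof -
  obtain as where cp: "char_poly X = (\<Prod>a\<leftarrow>as. [:- a, 1:])"
    using char_poly_factorized[OF X] by blast
  obtain B P Q where schur: "schur_decomposition X as = (B, P, Q)"
    using prod_cases3 by blast
  note sd = schur_decomposition[OF X cp schur]
  have B: "B \<in> carrier_mat n n"
    using similar_mat_witD2[OF X] sd by blast
  have "Determinant.det X = Determinant.det B"
    using sd det_similar similar_mat_def by blast
  also have "\<dots> = prod_list as"
    using det_upper_triangular[OF _ B] sd by simp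
  finally have det: "Determinant.det X = prod_list as" .
  have "(prod_list (map (\<lambda>a. a powr (-1/2)) as))\<^sup>2 = 1 / prod_list as"
    if "0 \<notin> set as" for as :: "complex list"
    using that
  proof (induction as)
    case (Cons a as)
    have "(a powr (-1/2))\<^sup>2 = a powr (-1)"
      by (simp add: power2_eq_square flip: powr_add)
    also have "\<dots> = 1 / a" using Cons by (simp add: powr_minus_divide)
    finally show ?case using Cons by (simp add: power_mult_distrib)
  qed simp
  moreover have "det_inv_sqrt X = prod_list (map (\<lambda>a. a powr (-1/2)) as)"
    by (rule det_inv_sqrt_factors[OF cp])
  ultimately show ?thesis using nz det by (simp add: prod_list_zero_iff)
qed

lemma char_poly_one_plus_smult:
  fixes X :: "complex mat"
  assumes X: "X \<in> carrier_mat n n" and cp: "char_poly X = (\<Prod>a\<leftarrow>as. [:- a, 1:])"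
  shows "char_poly (1\<^sub>m n + z \<cdot>\<^sub>m X) = (\<Prod>a\<leftarrow>as. [:- (1 + z * a), 1:])"
proof -
  obtain B P Q where schur: "schur_decomposition X as = (B, P, Q)"
    using prod_cases3 by blast
  note sd = schur_decomposition[OF X cp schur]
  have wit: "similar_mat_wit X B P Q" using sd by simp
  from similar_mat_witD2[OF X wit] have
    B: "B \<in> carrier_mat n n" and P: "P \<in> carrier_mat n n" and Q: "Q \<in> carrier_mat n n"
    and PQ: "P * Q = 1\<^sub>m n" "Q * P = 1\<^sub>m n" and XB: "X = P * B * Q"
    by simp_all
  define C where "C = 1\<^sub>m n + z \<cdot>\<^sub>m B"
  have C: "C \<in> carrier_mat n n" using B by (simp add: C_def)
  have "P * C * Q = (P * 1\<^sub>m n + P * (z \<cdot>\<^sub>m B)) * Q"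
    unfolding C_def using P B by (subst mult_add_distrib_mat[of _ n n]) auto
  also have "\<dots> = P * 1\<^sub>m n * Q + P * (z \<cdot>\<^sub>m B) * Q"
    using P B Q by (subst add_mult_distrib_mat[of _ n n]) auto
  also have "P * 1\<^sub>m n * Q = 1\<^sub>m n" using P PQ by simp
  also have "P * (z \<cdot>\<^sub>m B) * Q = z \<cdot>\<^sub>m X"
    unfolding XB using P B Q
    by (simp add: mult_smult_distrib[of _ n n] mult_smult_assoc_mat[of _ n n])
  finally have eq: "1\<^sub>m n + z \<cdot>\<^sub>m X = P * C * Q" by simp
  have "similar_mat (1\<^sub>m n + z \<cdot>\<^sub>m X) C"
    by (rule similar_matI[of _ _ P Q n]) (use X C P Q PQ eq in auto)
  then have "char_poly (1\<^sub>m n + z \<cdot>\<^sub>m X) = char_poly C"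
    by (rule char_poly_similar)
  also have "\<dots> = (\<Prod>a\<leftarrow>diag_mat C. [:- a, 1:])"
    by (rule char_poly_upper_triangular[OF C]) (use sd B in \<open>auto simp: upper_triangular_def C_def\<close>)
  also have "diag_mat C = map (\<lambda>a. 1 + z * a) (diag_mat B)"
    using B by (auto simp: diag_mat_def C_def)
  also have "diag_mat B = as" using sd by blast
  finally show ?thesis by (simp add: comp_def)
qed

lemma gram_eigenvalue_real:
  fixes G :: "real mat"
  assumes G: "G \<in> carrier_mat m n"
    and ev: "eigenvalue (map_mat complex_of_real (gram_mat G)) c"
  shows "Im c = 0" "Re c \<ge> 0"
proof -
  define H where "H = map_mat complex_of_real G"
  have H: "H \<in> carrier_mat m n" using G by (simp add: H_def)
  have gram: "map_mat complex_of_real (gram_mat G) = transpose_mat H * H"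
    unfolding gram_mat_def H_def using G
    by (simp add: of_real_hom.mat_hom_mult[of _ n m _ n] map_mat_transpose)
  have dimA: "dim_row (map_mat complex_of_real (gram_mat G)) = n"
    using G by (simp add: gram_mat_def)
  from ev obtain v where v: "v \<in> carrier_vec n" "v \<noteq> 0\<^sub>v n"
    and eq: "(transpose_mat H * H) *\<^sub>v v = c \<cdot>\<^sub>v v"
    unfolding eigenvalue_def eigenvector_def dimA unfolding gram by blast
  define w where "w = H *\<^sub>v v"
  have w: "w \<in> carrier_vec m" using H v by (simp add: w_def)
  have cw: "conjugate w = H *\<^sub>v conjugate v"
  proof (rule eq_vecI)
    fix i assume "i < dim_vec (H *\<^sub>v conjugate v)"
    then have i: "i < m" using H by simp
    show "conjugate w $ i = (H *\<^sub>v conjugate v) $ i"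
      using i H v G by (auto simp: w_def scalar_prod_def H_def)
  qed (use H in \<open>auto simp: w_def\<close>)
  have norm_nonneg: "Im (u \<bullet> conjugate u) = 0 \<and> Re (u \<bullet> conjugate u) \<ge> 0" for u :: "complex vec"
  proof -
    have "u \<bullet> conjugate u = (\<Sum>i<dim_vec u. complex_of_real ((cmod (u $ i))\<^sup>2))"
      by (auto simp: scalar_prod_def complex_norm_square[symmetric] atLeast0LessThan intro!: sum.cong)
    then show ?thesis by (simp add: sum_nonneg)
  qed
  have "c * (v \<bullet> conjugate v) = ((transpose_mat H * H) *\<^sub>v v) \<bullet> conjugate v"
    using v unfolding eq by simp
  also have "\<dots> = (transpose_mat H *\<^sub>v w) \<bullet> conjugate v"
    unfolding w_def using H v by (subst assoc_mult_mat_vec[of _ n m _ n]) auto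
  also have "\<dots> = conjugate v \<bullet> (transpose_mat H *\<^sub>v w)"
    by (rule comm_scalar_prod[of _ n]) (use v H w in auto)
  also have "\<dots> = (transpose_mat H *\<^sub>v w) \<bullet> conjugate v"
    by (rule comm_scalar_prod[of _ n]) (use v H w in auto)
  also have "\<dots> = w \<bullet> (H *\<^sub>v conjugate v)"
    using transpose_vec_mult_scalar[OF H, of "conjugate v" w] v w by simp
  finally have key: "c * (v \<bullet> conjugate v) = w \<bullet> conjugate w" unfolding cw .
  have "v \<bullet> conjugate v \<noteq> 0"
    using v conjugate_square_eq_0_vec by blast
  then have pos: "Re (v \<bullet> conjugate v) > 0" "Im (v \<bullet> conjugate v) = 0"
    using norm_nonneg[of v] by (auto simp: complex_eq_iff)
  have "Re c * Re (v \<bullet> conjugate v) \<ge> 0" "Im c * Re (v \<bullet> conjugate v) = 0"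
    using arg_cong[OF key, of Re] arg_cong[OF key, of Im] norm_nonneg[of w] pos by auto
  with pos show "Im c = 0" "Re c \<ge> 0"
    by (auto simp: zero_le_mult_iff)
qed

lemma map_poly_complex_of_real_inject:
  "map_poly complex_of_real p = map_poly complex_of_real q \<Longrightarrow> p = q"
  by (auto simp: poly_eq_iff coeff_map_poly)

lemma map_poly_complex_of_real_linear_factors:
  "map_poly complex_of_real (\<Prod>x\<leftarrow>xs. [:- x, 1:]) = (\<Prod>x\<leftarrow>xs. [:- complex_of_real x, 1:])"
proof -
  interpret map_poly_comm_ring_hom complex_of_real ..
  show ?thesis
  proof (induction xs)
    case (Cons x xs)
    have "map_poly complex_of_real [:- x, 1:] = [:- complex_of_real x, 1:]"
      by (simp add: map_poly_pCons)
    with Cons show ?case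
      by (simp only: list.map prod_list.Cons hom_mult)
  qed simp
qed

lemma eigenvalues_desc_gram:
  assumes G: "G \<in> carrier_mat m n"
  shows "length (eigenvalues_desc (gram_mat G)) = n"
    and "sorted_wrt (\<ge>) (eigenvalues_desc (gram_mat G))"
    and "\<forall>x\<in>set (eigenvalues_desc (gram_mat G)). x \<ge> 0"
    and "char_poly (gram_mat G) = (\<Prod>x\<leftarrow>eigenvalues_desc (gram_mat G). [:- x, 1:])"
proof -
  define A where "A = gram_mat G"
  have A: "A \<in> carrier_mat n n" using G by (simp add: A_def gram_mat_def)
  then have Ac: "map_mat complex_of_real A \<in> carrier_mat n n" by simp
  obtain as where cp: "char_poly (map_mat complex_of_real A) = (\<Prod>a\<leftarrow>as. [:- a, 1:])"
    and len: "length as = n"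
    using char_poly_factorized[OF Ac] by blast
  have ev: "eigenvalue (map_mat complex_of_real A) a" if "a \<in> set as" for a
    unfolding eigenvalue_root_char_poly[OF Ac] cp using that
    by (auto simp: poly_prod_list prod_list_zero_iff)
  have re: "complex_of_real (Re a) = a" "Re a \<ge> 0" if "a \<in> set as" for a
    using gram_eigenvalue_real[OF G ev[OF that, unfolded A_def]] by (auto simp: complex_eq_iff)
  define rs where "rs = map Re as"
  have as: "as = map complex_of_real rs"
    using re by (auto simp: rs_def intro!: map_idI[symmetric])
  have "map_poly complex_of_real (char_poly A) = map_poly complex_of_real (\<Prod>x\<leftarrow>rs. [:- x, 1:])"
    using cp unfolding of_real_hom.char_poly_hom[OF A] map_poly_complex_of_real_linear_factors by (simp add: as comp_def)
  then have cpA: "char_poly A = (\<Prod>x\<leftarrow>rs. [:- x, 1:])"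
    by (metis (no_types, lifting) map_poly_complex_of_real_inject)
  then have pr: "proots (char_poly A) = mset rs"
    by (simp add: proots_linear_factors)
  have ms: "mset (eigenvalues_desc A) = mset rs"
    by (simp add: eigenvalues_desc_def pr)
  show "length (eigenvalues_desc (gram_mat G)) = n"
    using mset_eq_length[OF ms] len by (simp add: A_def rs_def)
  show "sorted_wrt (\<ge>) (eigenvalues_desc (gram_mat G))"
    by (simp add: eigenvalues_desc_def sorted_wrt_rev)
  show "\<forall>x\<in>set (eigenvalues_desc (gram_mat G)). x \<ge> 0"
    using mset_eq_setD[OF ms] re by (auto simp: A_def rs_def)
  have "(\<Prod>x\<leftarrow>eigenvalues_desc A. [:- x, 1:]) = prod_mset (image_mset (\<lambda>x. [:- x, 1:]) (mset (eigenvalues_desc A)))"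
    by (simp add: prod_mset_prod_list flip: mset_map)
  also have "\<dots> = (\<Prod>x\<leftarrow>rs. [:- x, 1:])"
    unfolding ms by (simp add: prod_mset_prod_list flip: mset_map)
  finally show "char_poly (gram_mat G) = (\<Prod>x\<leftarrow>eigenvalues_desc (gram_mat G). [:- x, 1:])"
    using cpA by (simp add: A_def)
qed

lemma det_inv_sqrt_gram:
  assumes G: "G \<in> carrier_mat m n"
  shows "det_inv_sqrt (1\<^sub>m n + z \<cdot>\<^sub>m map_mat complex_of_real (gram_mat G)) =
    (\<Prod>i<n. (1 + z * complex_of_real (eigenvalues_desc (gram_mat G) ! i)) powr (-1/2))"
proof -
  define xs where "xs = eigenvalues_desc (gram_mat G)"
  have A: "gram_mat G \<in> carrier_mat n n" using G by (simp add: gram_mat_def)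
  have "char_poly (map_mat complex_of_real (gram_mat G)) = (\<Prod>a\<leftarrow>map complex_of_real xs. [:- a, 1:])"
    unfolding of_real_hom.char_poly_hom[OF A] eigenvalues_desc_gram(4)[OF G] map_poly_complex_of_real_linear_factors xs_def
    by (simp add: comp_def)
  from char_poly_one_plus_smult[OF _ this, of n z] A
  have "char_poly (1\<^sub>m n + z \<cdot>\<^sub>m map_mat complex_of_real (gram_mat G)) =
      (\<Prod>a\<leftarrow>map (\<lambda>x. 1 + z * complex_of_real x) xs. [:- a, 1:])"
    by (simp add: comp_def)
  from det_inv_sqrt_factors[OF this]
  have "det_inv_sqrt (1\<^sub>m n + z \<cdot>\<^sub>m map_mat complex_of_real (gram_mat G)) =
      (\<Prod>x\<leftarrow>xs. (1 + z * complex_of_real x) powr (-1/2))"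
    by (simp add: comp_def)
  also have "\<dots> = (\<Prod>i<n. (1 + z * complex_of_real (xs ! i)) powr (-1/2))"
    using eigenvalues_desc_gram(1)[OF G]
    by (simp add: prod.list_conv_set_nth xs_def atLeast0LessThan)
  finally show ?thesis by (simp add: xs_def)
qed

end

theory Submission
  imports Defs "HOL-Complex_Analysis.Complex_Analysis" "HOL-Real_Asymp.Real_Asymp"
begin

text \<open>
  For real \<open>t\<close> write \<open>det (1 + t\<^sup>2 \<Gamma>\<^sup>t\<Gamma>) powr (-1/2)\<close> as the expectation of \<open>exp (i t y\<^sup>t\<Gamma>x)\<close> over independent
  standard Gaussian vectors \<open>x\<close> and \<open>y\<close>. The characteristic function of the Cauchy distribution is
  \<open>exp (- \<bar>s\<bar>)\<close>, so after the rescaling the expectation over \<open>\<Gamma>\<close> is exactly \<open>E exp (- t S)\<close> with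
  \<open>S = (\<Sum>j k. q\<^sub>j\<^sub>k \<bar>y\<^sub>j\<bar> \<bar>x\<^sub>k\<bar>) / (m b)\<close>. Here \<open>S\<close> has mean \<open>2/\<pi>\<close> and variance at most \<open>1/b\<close>; Jensen's
  inequality from below and a second order Taylor bound from above (\<open>S\<close> is nonnegative) place
  \<open>ln (E exp (- t S))\<close> between \<open>- 2t/\<pi>\<close> and \<open>- 2t/\<pi> + O(t\<^sup>2/b)\<close>, which is part (ii), even with the
  better rate \<open>O(1/b)\<close>.

  For complex \<open>z\<close> the product over the eigenvalues is a mixture of functions \<open>exp (- z w)\<close> with \<open>w \<ge> 0\<close>.
  Hence the expectations are holomorphic and bounded by \<open>1\<close> on the right half-plane, and convergence
  on the positive reals extends to locally uniform convergence by Vitali's theorem.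

  The Poisson expectation is approximated by products over a finite mesh, which are expectations of
  products of independent Poisson powers. It equals \<open>exp (\<integral> ((1 + z x) powr (-1/2) - 1) / (\<pi> x powr (3/2)) dx)\<close>,
  and the integrand has the primitive \<open>- 2 (csqrt (1 + z x) - 1) / (\<pi> sqrt x)\<close>.
\<close>

text \<open>Cauchy entries have no first moment, so nothing can be expanded in powers of them. The
  argument lets them enter only through integrands of modulus at most 1, for which Fubini and
  dominated convergence ask for no moments. One Gaussian vector turns the determinant into a
  quadratic form; the second makes that form linear in the entries, so that their characteristic
  function can act entry by entry. The constant 2/pi is the square of sqrt (2/pi), the mean modulus
  of a standard normal variable, and m b is the number of ones in Q.

  The complex statement concerns a product of principal branches, not a principal power of the
  determinant. This is why it is reached by continuation in z from the positive reals.

  On the Poisson side the infinite product is a limit along the net of finite subsets, and this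
  limit must be shown to exist. That is done for each locally finite configuration, according to
  whether its points have finite sum; the infinite product thereby becomes a pointwise limit of
  measurable mesh products.\<close>

section \<open>Gaussian integrals and determinants\<close>

text \<open>The matrix factors as a block upper triangular matrix with diagonal blocks
  \<open>C\<close> and \<open>d\<close> times a unipotent lower triangular one. Peeling off the last
  row and column is the determinant's counterpart of integrating out the last Gaussian
  coordinate.\<close>

lemma det_schur_complement_last:
  fixes B :: "nat \<Rightarrow> nat \<Rightarrow> 'a :: field"
  assumes nz: "B n n \<noteq> 0"
  shows "Determinant.det (Matrix.mat (Suc n) (Suc n) (\<lambda>(i, j). B i j)) =
    B n n * Determinant.det (Matrix.mat n n (\<lambda>(i, j). B i j - B i n * B n j / B n n))"
proof -
  define C where "C = Matrix.mat n n (\<lambda>(i, j). B i j - B i n * B n j / B n n)"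
  define v where "v = Matrix.mat n 1 (\<lambda>(i, j). B i n)"
  define d where "d = Matrix.mat 1 1 (\<lambda>(i, j). B n n)"
  define w where "w = Matrix.mat 1 n (\<lambda>(i, j). B n j / B n n)"
  have car: "C \<in> carrier_mat n n" "v \<in> carrier_mat n 1" "d \<in> carrier_mat 1 1" "w \<in> carrier_mat 1 n"
    by (simp_all add: C_def v_def d_def w_def)
  define U where "U = four_block_mat C v (0\<^sub>m 1 n) d"
  define L where "L = four_block_mat (1\<^sub>m n) (0\<^sub>m n 1) w (1\<^sub>m 1)"
  have carUL: "U \<in> carrier_mat (Suc n) (Suc n)" "L \<in> carrier_mat (Suc n) (Suc n)"
    using four_block_carrier_mat[OF car(1,3)] four_block_carrier_mat[of "1\<^sub>m n" n n "1\<^sub>m 1" 1 1]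
    by (auto simp: U_def L_def)
  have "U * L = four_block_mat (C * 1\<^sub>m n + v * w) (C * 0\<^sub>m n 1 + v * 1\<^sub>m 1)
      (0\<^sub>m 1 n * 1\<^sub>m n + d * w) (0\<^sub>m 1 n * 0\<^sub>m n 1 + d * 1\<^sub>m 1)"
    unfolding U_def L_def using car by (intro mult_four_block_mat) auto
  also have "\<dots> = Matrix.mat (Suc n) (Suc n) (\<lambda>(i, j). B i j)"
    using car nz
    by (intro eq_matI) (auto simp: C_def v_def w_def d_def scalar_prod_def less_Suc_eq)
  finally have "Determinant.det (Matrix.mat (Suc n) (Suc n) (\<lambda>(i, j). B i j)) = Determinant.det (U * L)"
    by simp
  also have "\<dots> = Determinant.det U * Determinant.det L"
    using carUL by (rule det_mult)
  also have "Determinant.det U = Determinant.det C * Determinant.det d"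
    unfolding U_def using car by (intro det_four_block_mat_lower_left_zero) auto
  also have "Determinant.det L = 1"
    unfolding L_def using car by (subst det_four_block_mat_upper_right_zero[of _ n _ 1]) auto
  also have "Determinant.det d = B n n"
    by (simp add: d_def det_single)
  finally show ?thesis by (simp add: C_def)
qed

text \<open>Completing the square: the integrand times the standard density is a constant multiple
  of the normal density with mean - c / (1 + \<alpha>) and variance 1 / (1 + \<alpha>).\<close>

lemma nn_integral_std_normal_exp_quadratic:
  fixes \<alpha> c :: real
  assumes \<alpha>: "\<alpha> > -1"
  shows "(\<integral>\<^sup>+y. ennreal (exp (- (1/2) * (\<alpha> * y\<^sup>2 + 2 * c * y))) \<partial>std_normal_distribution) =
    ennreal ((1 + \<alpha>) powr (-1/2) * exp (c\<^sup>2 / (2 * (1 + \<alpha>))))"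
proof -
  define \<sigma> where "\<sigma> = 1 / sqrt (1 + \<alpha>)"
  define \<mu> where "\<mu> = - c / (1 + \<alpha>)"
  define K where "K = (1 + \<alpha>) powr (-1/2) * exp (c\<^sup>2 / (2 * (1 + \<alpha>)))"
  have \<sigma>: "\<sigma> > 0" "\<sigma>\<^sup>2 = 1 / (1 + \<alpha>)" using \<alpha> by (auto simp: \<sigma>_def power_divide)
  have eq: "std_normal_density y * exp (- (1/2) * (\<alpha> * y\<^sup>2 + 2 * c * y)) = K * normal_density \<mu> \<sigma> y" for y
  proof -
    have "- (y - \<mu>)\<^sup>2 / (2 * \<sigma>\<^sup>2) = - (1 + \<alpha>) / 2 * (y + c / (1 + \<alpha>))\<^sup>2"
      using \<alpha> by (simp add: \<sigma> \<mu>_def field_simps)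
    also have "\<dots> = - (1 + \<alpha>) / 2 * y\<^sup>2 - c * y - c\<^sup>2 / (2 * (1 + \<alpha>))"
      using \<alpha> by (simp add: power2_eq_square divide_simps) (simp add: algebra_simps)
    finally have e: "- (y - \<mu>)\<^sup>2 / (2 * \<sigma>\<^sup>2) = - (1 + \<alpha>) / 2 * y\<^sup>2 - c * y - c\<^sup>2 / (2 * (1 + \<alpha>))" .
    have "(1 + \<alpha>) powr (-1/2) = 1 / sqrt (1 + \<alpha>)"
      using \<alpha> by (simp add: powr_minus_divide powr_half_sqrt)
    moreover have "sqrt (2 * pi * \<sigma>\<^sup>2) = sqrt (2 * pi) / sqrt (1 + \<alpha>)"
      using \<alpha> unfolding \<sigma>(2) by (simp add: real_sqrt_divide)
    ultimately have k: "(1 + \<alpha>) powr (-1/2) / sqrt (2 * pi * \<sigma>\<^sup>2) = 1 / sqrt (2 * pi)"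
      using \<alpha> by simp
    have "K * normal_density \<mu> \<sigma> y = (1 + \<alpha>) powr (-1/2) / sqrt (2 * pi * \<sigma>\<^sup>2) *
        (exp (c\<^sup>2 / (2 * (1 + \<alpha>))) * exp (- (y - \<mu>)\<^sup>2 / (2 * \<sigma>\<^sup>2)))"
      by (simp add: K_def normal_density_def)
    also have "\<dots> = 1 / sqrt (2 * pi) * exp (- (1 + \<alpha>) / 2 * y\<^sup>2 - c * y)"
      unfolding k e exp_add[symmetric] by simp
    also have "\<dots> = std_normal_density y * exp (- (1/2) * (\<alpha> * y\<^sup>2 + 2 * c * y))"
      by (simp add: std_normal_density_def exp_add[symmetric] algebra_simps)
        (simp add: field_simps)
    finally show ?thesis by simp
  qed
  have K0: "K \<ge> 0" by (simp add: K_def)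
  have "(\<integral>\<^sup>+y. ennreal (exp (- (1/2) * (\<alpha> * y\<^sup>2 + 2 * c * y))) \<partial>std_normal_distribution) =
      (\<integral>\<^sup>+y. ennreal (K * normal_density \<mu> \<sigma> y) \<partial>lborel)"
    by (subst nn_integral_density) (auto simp: eq[symmetric] ennreal_mult[symmetric] intro!: nn_integral_cong)
  also have "\<dots> = ennreal (\<integral>y. K * normal_density \<mu> \<sigma> y \<partial>lborel)"
    using \<sigma> K0 by (intro nn_integral_eq_integral) auto
  also have "\<dots> = ennreal K"
    using \<sigma> by simp
  finally show ?thesis by (simp add: K_def)
qed

text \<open>Induction on the dimension. Integrating out the last coordinate replaces the form by its
  Schur complement \<open>a'\<close> and contributes the factor 1 + \<alpha>, which is also the
  factor by which the determinants differ. Working with nonnegative integrals makes Fubini free of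
  integrability conditions.\<close>

lemma gaussian_integral_det:
  fixes a :: "nat \<Rightarrow> nat \<Rightarrow> real"
  assumes sym: "\<And>i j. i < n \<Longrightarrow> j < n \<Longrightarrow> a i j = a j i"
    and psd: "\<And>x. 0 \<le> (\<Sum>i<n. \<Sum>j<n. a i j * x i * x j)"
  defines "D \<equiv> Determinant.det (Matrix.mat n n (\<lambda>(i, j). of_bool (i = j) + a i j))"
  shows "D > 0"
    and "(\<integral>\<^sup>+x. ennreal (exp (- (1/2) * (\<Sum>i<n. \<Sum>j<n. a i j * x i * x j)))
      \<partial>(\<Pi>\<^sub>M i\<in>{..<n}. std_normal_distribution)) = ennreal (D powr (-1/2))"
proof -
  have "0 < Determinant.det (Matrix.mat n n (\<lambda>(i, j). of_bool (i = j) + a i j)) \<and>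
    (\<integral>\<^sup>+x. ennreal (exp (- (1/2) * (\<Sum>i<n. \<Sum>j<n. a i j * x i * x j)))
      \<partial>(\<Pi>\<^sub>M i\<in>{..<n}. std_normal_distribution)) =
      ennreal (Determinant.det (Matrix.mat n n (\<lambda>(i, j). of_bool (i = j) + a i j)) powr (-1/2))"
    using sym psd
  proof (induction n arbitrary: a)
    case 0
    interpret product_prob_space "\<lambda>_ :: nat. std_normal_distribution" "{}"
      by (intro product_prob_spaceI prob_space_normal_density) simp
    show ?case by (auto simp: det_dim_zero P.emeasure_space_1)
  next
    case (Suc n)
    interpret product_prob_space "\<lambda>_ :: nat. std_normal_distribution" UNIV
      by (intro product_prob_spaceI prob_space_normal_density) simp
    define \<alpha> where "\<alpha> = a n n"
    define c where "c x = (\<Sum>i<n. a i n * x i)" for x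
    define a' where "a' i j = a i j - a i n * a n j / (1 + \<alpha>)" for i j
    have split: "(\<Sum>i<Suc n. \<Sum>j<Suc n. a i j * (x(n := y)) i * (x(n := y)) j) =
        (\<Sum>i<n. \<Sum>j<n. a i j * x i * x j) + 2 * c x * y + \<alpha> * y\<^sup>2" for x y
    proof -
      have r: "(\<Sum>j<n. a n j * y * x j) = c x * y"
        unfolding c_def sum_distrib_right by (intro sum.cong refl) (simp add: Suc.prems(1))
      have c: "(\<Sum>i<n. a i n * x i * y) = c x * y"
        unfolding c_def sum_distrib_right ..
      have "(\<Sum>i<Suc n. \<Sum>j<Suc n. a i j * (x(n := y)) i * (x(n := y)) j) =
          (\<Sum>i<n. (\<Sum>j<n. a i j * x i * x j) + a i n * x i * y) + ((\<Sum>j<n. a n j * y * x j) + \<alpha> * y * y)"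
        by (simp add: \<alpha>_def)
      then show ?thesis
        by (simp only: sum.distrib r c) (simp add: power2_eq_square)
    qed
    have split': "(\<Sum>i<n. \<Sum>j<n. a' i j * x i * x j) =
        (\<Sum>i<n. \<Sum>j<n. a i j * x i * x j) - (c x)\<^sup>2 / (1 + \<alpha>)" for x
    proof -
      have "(c x)\<^sup>2 = (\<Sum>i<n. a i n * x i) * (\<Sum>j<n. a n j * x j)"
        unfolding c_def power2_eq_square
        by (intro arg_cong2[of _ _ _ _ "(*)"] refl sum.cong) (simp add: Suc.prems(1))
      also have "\<dots> = (\<Sum>i<n. \<Sum>j<n. a i n * a n j * x i * x j)"
        by (simp add: sum_product ac_simps)
      finally show ?thesis
        by (simp only: a'_def left_diff_distrib sum_subtractf times_divide_eq_left sum_divide_distrib)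
    qed
    have \<alpha>: "\<alpha> \<ge> 0"
      using Suc.prems(2)[of "(\<lambda>_. 0)(n := 1)"] unfolding split by (simp add: c_def)
    have psd': "0 \<le> (\<Sum>i<n. \<Sum>j<n. a' i j * x i * x j)" for x
    proof -
      define q where "q = (\<Sum>i<n. \<Sum>j<n. a i j * x i * x j)"
      \<comment> \<open>The last coordinate is set to the minimiser of the form with 1 + \<alpha> in
        place of \<alpha>. The value differs from the wanted Schur complement only by a further
        nonnegative square that is subtracted.\<close>
      have "0 \<le> q + 2 * c x * (- c x / (1 + \<alpha>)) + \<alpha> * (- c x / (1 + \<alpha>))\<^sup>2"
        using Suc.prems(2)[of "x(n := - c x / (1 + \<alpha>))"] unfolding split q_def .
      also have "\<dots> = q - (c x)\<^sup>2 / (1 + \<alpha>) - (c x)\<^sup>2 / (1 + \<alpha>)\<^sup>2"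
        using \<alpha> by (simp add: divide_simps power2_eq_square) (simp add: algebra_simps)
      finally have "0 \<le> q - (c x)\<^sup>2 / (1 + \<alpha>)"
        by (smt (verit) zero_le_divide_iff zero_le_power2)
      then show ?thesis unfolding split' q_def .
    qed
    define D' where "D' = Determinant.det (Matrix.mat n n (\<lambda>(i, j). of_bool (i = j) + a' i j))"
    have IH: "0 < D'" "(\<integral>\<^sup>+x. ennreal (exp (- (1/2) * (\<Sum>i<n. \<Sum>j<n. a' i j * x i * x j)))
      \<partial>(\<Pi>\<^sub>M i\<in>{..<n}. std_normal_distribution)) = ennreal (D' powr (-1/2))"
      using Suc.IH[of a'] psd' Suc.prems(1) unfolding D'_def by (auto simp: a'_def)
    have "Determinant.det (Matrix.mat (Suc n) (Suc n) (\<lambda>(i, j). of_bool (i = j) + a i j)) =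
      (1 + \<alpha>) * Determinant.det (Matrix.mat n n
        (\<lambda>(i, j). of_bool (i = j) + a i j - (of_bool (i = n) + a i n) * (of_bool (n = j) + a n j) / (1 + \<alpha>)))"
      using det_schur_complement_last[of "\<lambda>i j. of_bool (i = j) + a i j" n] \<alpha> by (simp add: \<alpha>_def)
    also have "\<dots> = (1 + \<alpha>) * D'"
      unfolding D'_def by (intro arg_cong2[of _ _ _ _ "(*)"] arg_cong[of _ _ Determinant.det] eq_matI) (auto simp: a'_def)
    finally have det: "Determinant.det (Matrix.mat (Suc n) (Suc n) (\<lambda>(i, j). of_bool (i = j) + a i j)) = (1 + \<alpha>) * D'" .
    let ?P = "\<Pi>\<^sub>M i\<in>{..<n}. std_normal_distribution"
    have "(\<integral>\<^sup>+x. ennreal (exp (- (1/2) * (\<Sum>i<Suc n. \<Sum>j<Suc n. a i j * x i * x j)))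
        \<partial>(\<Pi>\<^sub>M i\<in>insert n {..<n}. std_normal_distribution)) =
      (\<integral>\<^sup>+x. \<integral>\<^sup>+y. ennreal (exp (- (1/2) * (\<Sum>i<Suc n. \<Sum>j<Suc n. a i j * (x(n := y)) i * (x(n := y)) j)))
        \<partial>std_normal_distribution \<partial>?P)"
      by (rule product_nn_integral_insert) (auto intro!: measurable_component_singleton)
    also have "\<dots> = (\<integral>\<^sup>+x. ennreal (exp (- (1/2) * (\<Sum>i<n. \<Sum>j<n. a i j * x i * x j))) *
       ennreal ((1 + \<alpha>) powr (-1/2) * exp ((c x)\<^sup>2 / (2 * (1 + \<alpha>)))) \<partial>?P)"
      unfolding split
    proof (intro nn_integral_cong)
      fix x
      have "(\<integral>\<^sup>+y. ennreal (exp (- (1/2) * ((\<Sum>i<n. \<Sum>j<n. a i j * x i * x j) + 2 * c x * y + \<alpha> * y\<^sup>2))) \<partial>std_normal_distribution)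
        = (\<integral>\<^sup>+y. ennreal (exp (- (1/2) * (\<Sum>i<n. \<Sum>j<n. a i j * x i * x j))) * ennreal (exp (- (1/2) * (\<alpha> * y\<^sup>2 + 2 * c x * y))) \<partial>std_normal_distribution)"
        by (intro nn_integral_cong) (simp add: ennreal_mult[symmetric] exp_add[symmetric] add_divide_distrib add_ac)
      also have "\<dots> = ennreal (exp (- (1/2) * (\<Sum>i<n. \<Sum>j<n. a i j * x i * x j))) *
       ennreal ((1 + \<alpha>) powr (-1/2) * exp ((c x)\<^sup>2 / (2 * (1 + \<alpha>))))"
        using \<alpha> by (subst nn_integral_cmult, simp, subst nn_integral_std_normal_exp_quadratic) simp_all
      finally show "(\<integral>\<^sup>+y. ennreal (exp (- (1/2) * ((\<Sum>i<n. \<Sum>j<n. a i j * x i * x j) + 2 * c x * y + \<alpha> * y\<^sup>2))) \<partial>std_normal_distribution)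
        = ennreal (exp (- (1/2) * (\<Sum>i<n. \<Sum>j<n. a i j * x i * x j))) *
       ennreal ((1 + \<alpha>) powr (-1/2) * exp ((c x)\<^sup>2 / (2 * (1 + \<alpha>))))" .
    qed
    also have "\<dots> = (\<integral>\<^sup>+x. ennreal ((1 + \<alpha>) powr (-1/2)) *
       ennreal (exp (- (1/2) * (\<Sum>i<n. \<Sum>j<n. a' i j * x i * x j))) \<partial>?P)"
      unfolding split' using \<alpha>
    proof (intro nn_integral_cong)
      fix x
      define q where "q = (\<Sum>i<n. \<Sum>j<n. a i j * x i * x j)"
      have "- (1/2) * (q - (c x)\<^sup>2 / (1 + \<alpha>)) = - (1/2) * q + (c x)\<^sup>2 / (2 * (1 + \<alpha>))"
        using \<alpha> by (simp add: field_simps)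
      then have "exp (- (1/2) * (q - (c x)\<^sup>2 / (1 + \<alpha>))) = exp (- (1/2) * q) * exp ((c x)\<^sup>2 / (2 * (1 + \<alpha>)))"
        by (simp only: exp_add)
      then show "ennreal (exp (- (1/2) * q)) * ennreal ((1 + \<alpha>) powr (-1/2) * exp ((c x)\<^sup>2 / (2 * (1 + \<alpha>)))) =
        ennreal ((1 + \<alpha>) powr (-1/2)) * ennreal (exp (- (1/2) * (q - (c x)\<^sup>2 / (1 + \<alpha>))))"
        by (simp only:) (simp only: ennreal_mult[symmetric] powr_ge_zero exp_ge_zero mult_nonneg_nonneg mult_ac)
    qed
    also have "\<dots> = ennreal ((1 + \<alpha>) powr (-1/2)) * ennreal (D' powr (-1/2))"
      by (subst nn_integral_cmult, (auto intro!: measurable_component_singleton)[1], simp only: IH(2))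
    also have "\<dots> = ennreal (((1 + \<alpha>) * D') powr (-1/2))"
      using \<alpha> IH(1) by (simp add: ennreal_mult[symmetric] powr_mult)
    finally show ?case
      using \<alpha> IH(1) by (simp only: det lessThan_Suc) simp
  qed
  then show "D > 0"
    and "(\<integral>\<^sup>+x. ennreal (exp (- (1/2) * (\<Sum>i<n. \<Sum>j<n. a i j * x i * x j)))
      \<partial>(\<Pi>\<^sub>M i\<in>{..<n}. std_normal_distribution)) = ennreal (D powr (-1/2))"
    by (auto simp: D_def)
qed

section \<open>The characteristic function of the Cauchy distribution\<close>

text \<open>The integrand has modulus exp (Re c x), so the real case supplies integrability, and the
  complex primitive then supplies the value.\<close>

lemma integral_exp_halfline:
  fixes c :: complex
  assumes c: "Re c < 0"
  shows "set_integrable lborel {0<..} (\<lambda>x. exp (c * of_real x))"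
    and "(LINT x:{0<..}|lborel. exp (c * of_real x)) = - 1 / c"
proof -
  have lim_exp: "((\<lambda>x. exp (Re c * x)) \<longlongrightarrow> 0) at_top"
    using c by real_asymp
  have "set_integrable lborel (einterval 0 \<infinity>) (\<lambda>x. exp (Re c * x))"
  proof (rule interval_integral_FTC_nonneg(1))
    show "DERIV (\<lambda>x. exp (Re c * x) / Re c) x :> exp (Re c * x)" for x
      using c by (auto intro!: derivative_eq_intros)
    show "(((\<lambda>x. exp (Re c * x) / Re c) \<circ> real_of_ereal) \<longlongrightarrow> 1 / Re c) (at_right 0)"
      using c by (auto simp: zero_ereal_def ereal_tendsto_simps intro!: tendsto_eq_intros)
    show "(((\<lambda>x. exp (Re c * x) / Re c) \<circ> real_of_ereal) \<longlongrightarrow> 0) (at_left \<infinity>)"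
      using tendsto_divide[OF lim_exp tendsto_const, of "Re c"] c unfolding ereal_tendsto_simps by simp
  qed auto
  then have re: "set_integrable lborel {0<..} (\<lambda>x. exp (Re c * x))"
    by (simp add: zero_ereal_def einterval_eq)
  show int: "set_integrable lborel {0<..} (\<lambda>x. exp (c * of_real x))"
    by (rule set_integrable_bound[OF re]) (auto simp: set_borel_measurable_def)
  have "(LBINT x=0..\<infinity>. exp (c * of_real x)) = 0 - 1 / c"
  proof (rule interval_integral_FTC_integrable)
    show "((\<lambda>x. exp (c * of_real x) / c) has_vector_derivative exp (c * of_real x)) (at x)" for x :: real
    proof -
      have "((\<lambda>z. exp (c * z) / c) has_field_derivative exp (c * of_real x)) (at (of_real x))"
        using c by (auto intro!: derivative_eq_intros)
      from has_field_derivative_at_within[OF this] show ?thesis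
        using has_vector_derivative_real_field[of "\<lambda>z. exp (c * z) / c" "exp (c * of_real x)" x] by simp
    qed
    show "set_integrable lborel (einterval 0 \<infinity>) (\<lambda>x. exp (c * of_real x))"
      using int by (simp add: zero_ereal_def einterval_eq)
    show "(((\<lambda>x. exp (c * of_real x) / c) \<circ> real_of_ereal) \<longlongrightarrow> 1 / c) (at_right 0)"
      using c by (auto simp: zero_ereal_def ereal_tendsto_simps intro!: tendsto_eq_intros)
    have "((\<lambda>x. norm (exp (c * of_real x))) \<longlongrightarrow> 0) at_top"
      using lim_exp by simp
    then have "((\<lambda>x::real. exp (c * of_real x)) \<longlongrightarrow> 0) at_top"
      by (rule tendsto_norm_zero_cancel)
    from tendsto_divide[OF this tendsto_const, of c]
    show "(((\<lambda>x. exp (c * of_real x) / c) \<circ> real_of_ereal) \<longlongrightarrow> 0) (at_left \<infinity>)"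
      using c unfolding ereal_tendsto_simps by (cases "c = 0") auto
  qed auto
  then show "(LINT x:{0<..}|lborel. exp (c * of_real x)) = - 1 / c"
    by (simp add: zero_ereal_def interval_lebesgue_integral_def einterval_eq)
qed

text \<open>Splitting at 0 leaves two half-line exponentials with rates \<open>p\<close> and
  \<open>q\<close>, and the value is - 1 / p - 1 / q. Up to a constant it is the Cauchy density,
  whose own transform is then obtained by inversion.\<close>

lemma laplace_distribution_char:
  fixes t :: real
  shows "integrable lborel (\<lambda>x. exp (- \<bar>x\<bar>) *\<^sub>R iexp (t * x))"
    and "(LINT x|lborel. exp (- \<bar>x\<bar>) *\<^sub>R iexp (t * x)) = of_real (2 / (1 + t\<^sup>2))"
proof -
  define g where "g c x = indicator {0<..} x *\<^sub>R exp (c * complex_of_real x)" for c x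
  have g: "has_bochner_integral lborel (g c) (- 1 / c)" if "Re c < 0" for c
    using integral_exp_halfline[OF that]
    by (simp add: has_bochner_integral_iff g_def[abs_def] set_integrable_def set_lebesgue_integral_def)
  have g': "has_bochner_integral lborel (\<lambda>x. g c (- x)) (- 1 / c)" if "Re c < 0" for c
    using lborel_has_bochner_integral_real_affine_iff[of "-1" "g c" "- 1 / c" 0] g[OF that] by simp
  define p q where "p = -1 + \<i> * complex_of_real t" and "q = -1 - \<i> * complex_of_real t"
  have pq: "Re p < 0" "Re q < 0" by (auto simp: p_def q_def)
  have sum: "has_bochner_integral lborel (\<lambda>x. g p x + g q (- x)) (- 1 / p + - 1 / q)"
    by (intro has_bochner_integral_add g g' pq)
  \<comment> \<open>Equality fails at x = 0, where both half-line indicators vanish.\<close>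
  have ae: "AE x in lborel. g p x + g q (- x) = exp (- \<bar>x\<bar>) *\<^sub>R iexp (t * x)"
  proof -
    have "g p x + g q (- x) = exp (- \<bar>x\<bar>) *\<^sub>R iexp (t * x)" if "x \<noteq> 0" for x
      using that
      by (cases "x > 0")
        (auto simp: g_def p_def q_def algebra_simps scaleR_conv_of_real exp_of_real[symmetric] exp_add[symmetric])
    then show ?thesis using AE_lborel_singleton[of "0::real"] by (auto elim!: eventually_mono)
  qed
  have "- 1 / p + - 1 / q = of_real (2 / (1 + t\<^sup>2))"
  proof -
    have "p * q = of_real (1 + t\<^sup>2)"
      by (simp add: p_def q_def algebra_simps power2_eq_square)
    moreover have "p \<noteq> 0" "q \<noteq> 0" using pq by auto
    moreover have "- 1 / p + - 1 / q = - (p + q) / (p * q)"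
      using \<open>p \<noteq> 0\<close> \<open>q \<noteq> 0\<close> by (simp add: field_simps)
    ultimately show ?thesis by (simp add: p_def q_def)
  qed
  with sum have sum': "has_bochner_integral lborel (\<lambda>x. g p x + g q (- x)) (of_real (2 / (1 + t\<^sup>2)))" by simp
  have "has_bochner_integral lborel (\<lambda>x. exp (- \<bar>x\<bar>) *\<^sub>R iexp (t * x)) (of_real (2 / (1 + t\<^sup>2)))"
    using has_bochner_integral_cong_AE[THEN iffD1, OF _ _ ae sum'] sum'
    by (auto simp: has_bochner_integral_iff)
  then show "integrable lborel (\<lambda>x. exp (- \<bar>x\<bar>) *\<^sub>R iexp (t * x))"
    and "(LINT x|lborel. exp (- \<bar>x\<bar>) *\<^sub>R iexp (t * x)) = of_real (2 / (1 + t\<^sup>2))"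
    by (auto simp: has_bochner_integral_iff)
qed

text \<open>This is the characteristic function of the standard normal law, rescaled and read as a
  transform pair. As \<sigma> tends to 0 the right side concentrates at 0 with total mass 2 pi,
  which is what makes the cutoff invert the Fourier transform.\<close>

lemma fourier_gaussian:
  fixes \<sigma> v :: real
  assumes "\<sigma> > 0"
  shows "integrable lborel (\<lambda>t. exp (- (\<sigma> * t)\<^sup>2 / 2) *\<^sub>R iexp (v * t))"
    and "(LINT t|lborel. exp (- (\<sigma> * t)\<^sup>2 / 2) *\<^sub>R iexp (v * t)) = of_real (2 * pi * normal_density 0 \<sigma> v)"
proof -
  have i: "integrable std_normal_distribution (\<lambda>t. iexp (v / \<sigma> * t))"
    by (intro prob_space.integrable_iexp prob_space_normal_density) auto
  have "(LINT t|std_normal_distribution. iexp (v / \<sigma> * t)) = of_real (exp (- (v / \<sigma>)\<^sup>2 / 2))"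
    using fun_cong[OF char_std_normal_distribution, of "v / \<sigma>"] by (simp add: char_def)
  with i have "has_bochner_integral lborel (\<lambda>t. std_normal_density t *\<^sub>R iexp (v / \<sigma> * t)) (of_real (exp (- (v / \<sigma>)\<^sup>2 / 2)))"
    by (simp add: has_bochner_integral_iff integrable_density integral_density)
  then have "has_bochner_integral lborel (\<lambda>t. std_normal_density (0 + \<sigma> * t) *\<^sub>R iexp (v / \<sigma> * (0 + \<sigma> * t)))
      (of_real (exp (- (v / \<sigma>)\<^sup>2 / 2)) /\<^sub>R \<bar>\<sigma>\<bar>)"
    using assms by (subst (asm) lborel_has_bochner_integral_real_affine_iff[of \<sigma> _ _ 0]) auto
  then have "has_bochner_integral lborel (\<lambda>t. sqrt (2 * pi) *\<^sub>R (std_normal_density (0 + \<sigma> * t) *\<^sub>R iexp (v / \<sigma> * (0 + \<sigma> * t))))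
      (sqrt (2 * pi) *\<^sub>R (of_real (exp (- (v / \<sigma>)\<^sup>2 / 2)) /\<^sub>R \<bar>\<sigma>\<bar>))"
    by (rule has_bochner_integral_scaleR_right)
  moreover have "sqrt (2 * pi) *\<^sub>R (std_normal_density (0 + \<sigma> * t) *\<^sub>R iexp (v / \<sigma> * (0 + \<sigma> * t))) =
      exp (- (\<sigma> * t)\<^sup>2 / 2) *\<^sub>R iexp (v * t)" for t
    using assms by (simp add: std_normal_density_def)
  moreover have "sqrt (2 * pi) *\<^sub>R (complex_of_real (exp (- (v / \<sigma>)\<^sup>2 / 2)) /\<^sub>R \<bar>\<sigma>\<bar>) =
      of_real (2 * pi * normal_density 0 \<sigma> v)"
  proof -
    have "sqrt (2 * pi) / \<sigma> = 2 * pi / sqrt (2 * pi * \<sigma>\<^sup>2)"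
      using assms by (simp add: real_sqrt_mult field_simps flip: power2_eq_square)
    then show ?thesis
      using assms by (simp add: normal_density_def scaleR_conv_of_real power_divide field_simps flip: of_real_mult of_real_divide)
  qed
  ultimately have "has_bochner_integral lborel (\<lambda>t. exp (- (\<sigma> * t)\<^sup>2 / 2) *\<^sub>R iexp (v * t)) (of_real (2 * pi * normal_density 0 \<sigma> v))"
    by simp
  then show "integrable lborel (\<lambda>t. exp (- (\<sigma> * t)\<^sup>2 / 2) *\<^sub>R iexp (v * t))"
    and "(LINT t|lborel. exp (- (\<sigma> * t)\<^sup>2 / 2) *\<^sub>R iexp (v * t)) = of_real (2 * pi * normal_density 0 \<sigma> v)"
    by (auto simp: has_bochner_integral_iff)
qed

lemma integrable_cauchy_density: "integrable lborel (\<lambda>x::real. 1 / (1 + x\<^sup>2))"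
proof -
  have "set_integrable lborel (einterval (-\<infinity>) \<infinity>) (\<lambda>x::real. 1 / (1 + x\<^sup>2))"
  proof (rule interval_integral_FTC_nonneg(1))
    show "DERIV arctan x :> 1 / (1 + x\<^sup>2)" for x
      by (auto intro!: derivative_eq_intros simp: inverse_eq_divide)
    show "((arctan \<circ> real_of_ereal) \<longlongrightarrow> - (pi / 2)) (at_right (-\<infinity>))"
      by (simp add: ereal_tendsto_simps tendsto_arctan_at_bot)
    show "((arctan \<circ> real_of_ereal) \<longlongrightarrow> pi / 2) (at_left \<infinity>)"
      by (simp add: ereal_tendsto_simps tendsto_arctan_at_top)
  qed (auto intro!: continuous_intros simp: add_nonneg_eq_0_iff)
  moreover have "einterval (-\<infinity>) \<infinity> = UNIV" by (auto simp: einterval_def)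
  ultimately show ?thesis by (simp add: set_integrable_def)
qed

text \<open>The Cauchy density is the Fourier transform of the Laplace density; the inversion is done by
  inserting a Gaussian cutoff of width \<open>1 / \<sigma>\<close> and letting \<open>\<sigma>\<close> tend to \<open>0\<close>.\<close>

lemma cauchy_char_gaussian_cutoff:
  fixes s \<sigma> :: real
  assumes \<sigma>: "\<sigma> > 0"
  shows "(LINT t|lborel. (exp (- (\<sigma> * t)\<^sup>2 / 2) / (1 + t\<^sup>2)) *\<^sub>R iexp (s * t)) =
    of_real (LINT u|lborel. pi * exp (- \<bar>\<sigma> * u - s\<bar>) * std_normal_density u)"
proof -
  \<comment> \<open>The factor 1 / (1 + t^2) is expanded as half the Laplace transform integral in
    x. The Gaussian factor in t makes the double integral absolutely convergent.\<close>
  define f where "f t x = exp (- (\<sigma> * t)\<^sup>2 / 2) *\<^sub>R (exp (- \<bar>x\<bar>) / 2) *\<^sub>R iexp ((s + x) * t)" for t x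
  have abs_int: "integrable lborel (\<lambda>x::real. exp (- \<bar>x\<bar>))"
    using integrable_norm[OF laplace_distribution_char(1)[of 0]] by simp
  have gauss_int: "integrable lborel (\<lambda>t. exp (- (\<sigma> * t)\<^sup>2 / 2))"
    using integrable_norm[OF fourier_gaussian(1)[OF \<sigma>, of 0]] by simp
  have meas: "case_prod f \<in> borel_measurable (lborel \<Otimes>\<^sub>M lborel)"
    unfolding f_def by measurable
  have int: "integrable (lborel \<Otimes>\<^sub>M lborel) (case_prod f)"
  proof (rule lborel_pair.Fubini_integrable[OF meas])
    show "integrable lborel (\<lambda>x. LINT y|lborel. norm (case (x, y) of (t, x) \<Rightarrow> f t x))"
      using gauss_int by (simp add: f_def)
    have "integrable lborel (\<lambda>y. f x y)" for x
    proof (rule Bochner_Integration.integrable_bound)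
      show "integrable lborel (\<lambda>x::real. exp (- \<bar>x\<bar>))" by (rule abs_int)
      have "exp (- ((\<sigma> * x)\<^sup>2 / 2)) \<le> (2 :: real)"
        by (rule order.trans[of _ 1]) auto
      then show "AE y in lborel. norm (f x y) \<le> norm (exp (- \<bar>y\<bar>))"
        by (intro AE_I2) (simp add: f_def)
    qed (simp add: f_def)
    then show "AE x in lborel. integrable lborel (\<lambda>y. case (x, y) of (t, x) \<Rightarrow> f t x)" by simp
  qed
  have "(LINT t|lborel. (exp (- (\<sigma> * t)\<^sup>2 / 2) / (1 + t\<^sup>2)) *\<^sub>R iexp (s * t)) = (LINT t|lborel. LINT x|lborel. f t x)"
  proof (intro Bochner_Integration.integral_cong refl)
    fix t :: real
    have "f t x = (exp (- (\<sigma> * t)\<^sup>2 / 2) / 2) *\<^sub>R iexp (s * t) * (exp (- \<bar>x\<bar>) *\<^sub>R iexp (t * x))" for x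
      by (simp add: f_def scaleR_conv_of_real ring_distribs exp_add mult_ac)
    then have "(LINT x|lborel. f t x) = (exp (- (\<sigma> * t)\<^sup>2 / 2) / 2) *\<^sub>R iexp (s * t) * of_real (2 / (1 + t\<^sup>2))"
      by (simp only: integral_mult_right_zero laplace_distribution_char(2))
    then show "(exp (- (\<sigma> * t)\<^sup>2 / 2) / (1 + t\<^sup>2)) *\<^sub>R iexp (s * t) = (LINT x|lborel. f t x)"
      by (simp add: scaleR_conv_of_real)
  qed
  also have "\<dots> = (LINT x|lborel. LINT t|lborel. f t x)"
    by (rule lborel_pair.Fubini_integral[OF int, symmetric])
  also have "\<dots> = (LINT x|lborel. of_real (exp (- \<bar>x\<bar>) * pi * normal_density 0 \<sigma> (s + x)))"
  proof (intro Bochner_Integration.integral_cong refl)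
    fix x :: real
    have "f t x = (exp (- \<bar>x\<bar>) / 2) *\<^sub>R (exp (- (\<sigma> * t)\<^sup>2 / 2) *\<^sub>R iexp ((s + x) * t))" for t
      by (simp add: f_def)
    then have "(LINT t|lborel. f t x) = (exp (- \<bar>x\<bar>) / 2) *\<^sub>R of_real (2 * pi * normal_density 0 \<sigma> (s + x))"
      by (simp only: integral_scaleR_right fourier_gaussian(2)[OF \<sigma>])
    then show "(LINT t|lborel. f t x) = of_real (exp (- \<bar>x\<bar>) * pi * normal_density 0 \<sigma> (s + x))"
      by (simp add: scaleR_conv_of_real)
  qed
  also have "\<dots> = of_real (LINT x|lborel. exp (- \<bar>x\<bar>) * pi * normal_density 0 \<sigma> (s + x))"
    by (rule integral_complex_of_real)
  \<comment> \<open>The substitution x = \<sigma> u - s turns the Gaussian of width \<sigma> centred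
    at - s into the fixed standard one and moves \<sigma> into the continuous factor.\<close>
  also have "(LINT x|lborel. exp (- \<bar>x\<bar>) * pi * normal_density 0 \<sigma> (s + x)) =
      \<bar>\<sigma>\<bar> *\<^sub>R (LINT u|lborel. exp (- \<bar>- s + \<sigma> * u\<bar>) * pi * normal_density 0 \<sigma> (s + (- s + \<sigma> * u)))"
    using \<sigma> by (intro lborel_integral_real_affine) simp
  also have "\<dots> = (LINT u|lborel. \<bar>\<sigma>\<bar> *\<^sub>R (exp (- \<bar>- s + \<sigma> * u\<bar>) * pi * normal_density 0 \<sigma> (s + (- s + \<sigma> * u))))"
    by (rule integral_scaleR_right[symmetric])
  also have "\<dots> = (LINT u|lborel. pi * exp (- \<bar>\<sigma> * u - s\<bar>) * std_normal_density u)"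
  proof (intro Bochner_Integration.integral_cong refl)
    fix u :: real
    have "\<sigma> * normal_density 0 \<sigma> (\<sigma> * u) = std_normal_density u"
      using \<sigma> by (simp add: normal_density_def real_sqrt_mult power_mult_distrib)
    then show "\<bar>\<sigma>\<bar> *\<^sub>R (exp (- \<bar>- s + \<sigma> * u\<bar>) * pi * normal_density 0 \<sigma> (s + (- s + \<sigma> * u))) =
        pi * exp (- \<bar>\<sigma> * u - s\<bar>) * std_normal_density u"
      using \<sigma> by (simp add: add.commute mult_ac)
  qed
  finally show ?thesis .
qed

lemma cauchy_char:
  fixes s :: real
  shows "(LINT t|lborel. (1 / (pi * (1 + t\<^sup>2))) *\<^sub>R iexp (s * t)) = of_real (exp (- \<bar>s\<bar>))"
proof -
  define \<sigma> where "\<sigma> k = 1 / real (Suc k)" for k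
  have \<sigma>: "\<sigma> k > 0" for k by (simp add: \<sigma>_def)
  have \<sigma>0: "\<sigma> \<longlonglongrightarrow> 0" unfolding \<sigma>_def by real_asymp
  have "(\<lambda>k. LINT t|lborel. (exp (- (\<sigma> k * t)\<^sup>2 / 2) / (1 + t\<^sup>2)) *\<^sub>R iexp (s * t))
      \<longlonglongrightarrow> (LINT t|lborel. (1 / (1 + t\<^sup>2)) *\<^sub>R iexp (s * t))"
  proof (rule integral_dominated_convergence[OF _ _ integrable_cauchy_density])
    show "AE t in lborel. (\<lambda>k. (exp (- (\<sigma> k * t)\<^sup>2 / 2) / (1 + t\<^sup>2)) *\<^sub>R iexp (s * t))
        \<longlonglongrightarrow> (1 / (1 + t\<^sup>2)) *\<^sub>R iexp (s * t)"
    proof (intro AE_I2 tendsto_scaleR tendsto_divide tendsto_const)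
      fix t :: real
      have "(\<lambda>k. exp (- (\<sigma> k * t)\<^sup>2 / 2)) \<longlonglongrightarrow> exp (- (0 * t)\<^sup>2 / 2)"
        by (intro tendsto_intros \<sigma>0) auto
      then show "(\<lambda>k. exp (- (\<sigma> k * t)\<^sup>2 / 2)) \<longlonglongrightarrow> 1" by simp
      show "1 + t\<^sup>2 \<noteq> 0" by (simp add: add_nonneg_eq_0_iff)
    qed
    show "AE t in lborel. norm ((exp (- (\<sigma> k * t)\<^sup>2 / 2) / (1 + t\<^sup>2)) *\<^sub>R iexp (s * t)) \<le> 1 / (1 + t\<^sup>2)" for k
      by (intro AE_I2) (simp add: divide_right_mono)
  qed auto
  \<comment> \<open>The Gaussian weight no longer depends on \<open>k\<close>, so a constant
    multiple of it dominates.\<close>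
  moreover have "(\<lambda>k. LINT u|lborel. pi * exp (- \<bar>\<sigma> k * u - s\<bar>) * std_normal_density u)
      \<longlonglongrightarrow> (LINT u|lborel. pi * exp (- \<bar>s\<bar>) * std_normal_density u)"
  proof (rule integral_dominated_convergence[where w = "\<lambda>u. pi * std_normal_density u"])
    show "AE u in lborel. (\<lambda>k. pi * exp (- \<bar>\<sigma> k * u - s\<bar>) * std_normal_density u)
        \<longlonglongrightarrow> pi * exp (- \<bar>s\<bar>) * std_normal_density u"
    proof (intro AE_I2)
      fix u :: real
      have "(\<lambda>k. pi * exp (- \<bar>\<sigma> k * u - s\<bar>) * std_normal_density u)
        \<longlonglongrightarrow> pi * exp (- \<bar>0 * u - s\<bar>) * std_normal_density u"
        by (intro tendsto_intros \<sigma>0)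
      then show "(\<lambda>k. pi * exp (- \<bar>\<sigma> k * u - s\<bar>) * std_normal_density u)
        \<longlonglongrightarrow> pi * exp (- \<bar>s\<bar>) * std_normal_density u" by simp
    qed
    show "AE u in lborel. norm (pi * exp (- \<bar>\<sigma> k * u - s\<bar>) * std_normal_density u) \<le> pi * std_normal_density u" for k
      by (intro AE_I2) (auto simp: abs_mult intro!: mult_left_le_one_le)
  qed auto
  ultimately have "(LINT t|lborel. (1 / (1 + t\<^sup>2)) *\<^sub>R iexp (s * t)) =
      of_real (LINT u|lborel. pi * exp (- \<bar>s\<bar>) * std_normal_density u)"
    unfolding cauchy_char_gaussian_cutoff[OF \<sigma>] by (rule LIMSEQ_unique[OF _ tendsto_of_real])
  also have "(LINT u|lborel. pi * exp (- \<bar>s\<bar>) * std_normal_density u) = pi * exp (- \<bar>s\<bar>)"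
    by simp
  finally have *: "(LINT t|lborel. (1 / (1 + t\<^sup>2)) *\<^sub>R iexp (s * t)) = of_real (pi * exp (- \<bar>s\<bar>))" .
  have "(LINT t|lborel. (1 / (pi * (1 + t\<^sup>2))) *\<^sub>R iexp (s * t)) =
      (LINT t|lborel. (1 / pi) *\<^sub>R ((1 / (1 + t\<^sup>2)) *\<^sub>R iexp (s * t)))"
    by simp
  also have "\<dots> = (1 / pi) *\<^sub>R of_real (pi * exp (- \<bar>s\<bar>))"
    by (simp only: integral_scaleR_right *)
  finally show ?thesis by (simp add: scaleR_conv_of_real)
qed

section \<open>Bounded holomorphic functions on the right half-plane\<close>

text \<open>If uniform convergence on K fails, some subsequence stays at distance at least
  \<open>e\<close> from f somewhere on K. Montel gives a further subsequence with a holomorphic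
  limit \<open>g\<close>; it agrees with f on U, hence on all of S by the identity theorem, a
  contradiction.\<close>

lemma vitali_bounded_convergence:
  fixes F :: "nat \<Rightarrow> complex \<Rightarrow> complex"
  assumes S: "open S" "connected S"
    and F: "\<And>n. F n holomorphic_on S" and bound: "\<And>n z. z \<in> S \<Longrightarrow> norm (F n z) \<le> B"
    and f: "f holomorphic_on S"
    and U: "U \<subseteq> S" "\<xi> \<in> S" "\<xi> islimpt U"
    and lim: "\<And>z. z \<in> U \<Longrightarrow> (\<lambda>n. F n z) \<longlonglongrightarrow> f z"
    and K: "compact K" "K \<subseteq> S"
  shows "uniform_limit K F f sequentially"
proof (rule ccontr)
  assume "\<not> uniform_limit K F f sequentially"
  then obtain e where e: "e > 0" and "\<exists>\<^sub>F n in sequentially. \<not> (\<forall>x\<in>K. dist (F n x) (f x) < e)"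
    by (auto simp: uniform_limit_iff not_eventually)
  then have "infinite {n. \<not> (\<forall>x\<in>K. dist (F n x) (f x) < e)}"
    by (simp only: frequently_cofinite cofinite_eq_sequentially[symmetric] not_False_eq_True)
  then obtain \<sigma> :: "nat \<Rightarrow> nat" where \<sigma>: "strict_mono \<sigma>"
    and "\<forall>i. \<sigma> i \<in> {n. \<not> (\<forall>x\<in>K. dist (F n x) (f x) < e)}"
    using infinite_enumerate by blast
  then have bad: "\<not> (\<forall>x\<in>K. dist (F (\<sigma> i) x) (f x) < e)" for i by blast
  have bdd: "\<exists>B. \<forall>h\<in>range F. \<forall>z\<in>K. norm (h z) \<le> B" if "K \<subseteq> S" for K
    using that bound by (intro exI[of _ B]) blast
  obtain g r where g: "g holomorphic_on S" and r: "strict_mono (r :: nat \<Rightarrow> nat)"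
    and pt: "\<And>x. x \<in> S \<Longrightarrow> (\<lambda>n. F (\<sigma> (r n)) x) \<longlonglongrightarrow> g x"
    and unif: "\<And>K. compact K \<Longrightarrow> K \<subseteq> S \<Longrightarrow> uniform_limit K ((\<lambda>n. F (\<sigma> n)) \<circ> r) g sequentially"
    by (rule Montel[of S "range F" "\<lambda>n. F (\<sigma> n)"]) (use S F bdd in blast)+
  have "g z = f z" if "z \<in> U" for z
  proof (rule LIMSEQ_unique)
    show "(\<lambda>n. F (\<sigma> (r n)) z) \<longlonglongrightarrow> g z"
      using pt that U by auto
    show "(\<lambda>n. F (\<sigma> (r n)) z) \<longlonglongrightarrow> f z"
      using LIMSEQ_subseq_LIMSEQ[OF LIMSEQ_subseq_LIMSEQ[OF lim[OF that] \<sigma>] r]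
      by (simp add: o_def)
  qed
  then have "g z - f z = 0" if "z \<in> S" for z
    using analytic_continuation[of "\<lambda>z. g z - f z" S U \<xi> z] that S U f g
    by (auto intro: holomorphic_on_diff)
  then have "uniform_limit K ((\<lambda>n. F (\<sigma> n)) \<circ> r) f sequentially"
    using unif[OF K] K(2) by (subst uniform_limit_cong'[where g = "(\<lambda>n. F (\<sigma> n)) \<circ> r" and i = g]) auto
  then have "\<forall>\<^sub>F n in sequentially. \<forall>x\<in>K. dist (F (\<sigma> (r n)) x) (f x) < e"
    using e by (simp add: uniform_limit_iff o_def)
  from eventually_happens[OF this] show False
    using bad by auto
qed

lemma islimpt_positive_reals: "1 islimpt (complex_of_real ` {0<..})"
proof (rule islimpt_sequential[THEN iffD2], intro exI conjI allI)
  show "complex_of_real (1 + 1 / real (Suc n)) \<in> complex_of_real ` {0<..} - {1}" for n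
    by (auto simp: of_real_eq_1_iff simp del: of_real_add of_real_divide intro!: imageI add_pos_nonneg)
  have "(\<lambda>n. 1 + 1 / real (Suc n)) \<longlonglongrightarrow> 1" by real_asymp
  then have "(\<lambda>n. complex_of_real (1 + 1 / real (Suc n))) \<longlonglongrightarrow> complex_of_real 1"
    by (rule tendsto_of_real)
  then show "(\<lambda>n. complex_of_real (1 + 1 / real (Suc n))) \<longlonglongrightarrow> 1"
    by (simp only: of_real_1)
qed

lemma
  shows open_right_halfplane: "open {z::complex. Re z > 0}"
    and connected_right_halfplane: "connected {z::complex. Re z > 0}"
  by (auto intro: open_halfspace_Re_gt convex_connected convex_halfspace_Re_gt)

text \<open>Differentiation under the integral. On the half-plane Re z > r the difference quotients
  are bounded by 1 / r, because w exp (- r w) is at most 1 / r for w \<ge> 0. The constant bound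
  replaces any moment of \<open>W\<close>, which matters since \<open>W\<close> will be a quadratic
  form in Cauchy variables.\<close>

lemma holomorphic_on_laplace_transform:
  fixes W :: "'a \<Rightarrow> real"
  assumes "finite_measure M" and W[measurable]: "W \<in> borel_measurable M"
    and nonneg: "\<And>\<omega>. \<omega> \<in> space M \<Longrightarrow> W \<omega> \<ge> 0"
  shows "(\<lambda>z. LINT \<omega>|M. exp (- (z * complex_of_real (W \<omega>)))) holomorphic_on {z. Re z > 0}"
proof -
  interpret finite_measure M by fact
  have int: "integrable M (\<lambda>\<omega>. exp (- (z * complex_of_real (W \<omega>))))" if "Re z > 0" for z
    by (rule integrable_const_bound[where B = 1]) (use that nonneg in \<open>auto simp: zero_le_mult_iff\<close>)
  have "((\<lambda>z. LINT \<omega>|M. exp (- (z * complex_of_real (W \<omega>)))) has_field_derivative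
      (LINT \<omega>|M. - complex_of_real (W \<omega>) * exp (- (z0 * complex_of_real (W \<omega>))))) (at z0)" if z0: "Re z0 > 0" for z0
  proof -
    define r where "r = Re z0 / 2"
    have r: "r > 0" "Re z0 > r" using z0 by (auto simp: r_def)
    \<comment> \<open>Convexity of \<open>T\<close> lets a bound on the derivative control the
      difference quotient along the segment from \<open>z\<close> to \<open>z0\<close>.\<close>
    define T where "T = {z. Re z > r}"
    have T: "open T" "convex T" "z0 \<in> T" using r by (auto simp: T_def open_halfspace_Re_gt convex_halfspace_Re_gt)
    have deriv: "((\<lambda>z. exp (- (z * complex_of_real w))) has_field_derivative - complex_of_real w * exp (- (z * complex_of_real w))) (at z within A)" for z w A
      by (auto intro!: derivative_eq_intros)
    have bd: "norm ((exp (- (z * complex_of_real (W \<omega>))) - exp (- (z0 * complex_of_real (W \<omega>)))) / (z - z0)) \<le> 1 / r"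
      if z: "z \<in> T - {z0}" and \<omega>: "\<omega> \<in> space M" for z \<omega>
    proof -
      have "norm (- complex_of_real (W \<omega>) * exp (- (x * complex_of_real (W \<omega>)))) \<le> 1 / r" if "x \<in> T" for x
      proof -
        have "r * W \<omega> \<le> exp (r * W \<omega>)"
          using exp_ge_add_one_self[of "r * W \<omega>"] by linarith
        also have "\<dots> \<le> exp (Re x * W \<omega>)"
          using that nonneg[OF \<omega>] by (auto simp: T_def intro!: mult_right_mono)
        finally have "W \<omega> \<le> exp (Re x * W \<omega>) / r"
          using r by (simp add: field_simps)
        then have "W \<omega> * exp (- (Re x * W \<omega>)) \<le> exp (Re x * W \<omega>) / r * exp (- (Re x * W \<omega>))"
          by (intro mult_right_mono) auto
        also have "\<dots> = 1 / r" by (simp add: exp_minus)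
        finally show ?thesis
          using nonneg[OF \<omega>] by (simp add: norm_mult)
      qed
      from field_differentiable_bound[OF T(2) deriv this, of z z0] z T(3)
      have "norm (exp (- (z * complex_of_real (W \<omega>))) - exp (- (z0 * complex_of_real (W \<omega>)))) \<le> 1 / r * norm (z - z0)"
        by auto
      then show ?thesis using z by (simp add: norm_divide divide_le_eq)
    qed
    have "((\<lambda>z. ((LINT \<omega>|M. exp (- (z * complex_of_real (W \<omega>)))) - (LINT \<omega>|M. exp (- (z0 * complex_of_real (W \<omega>))))) / (z - z0))
       \<longlongrightarrow> (LINT \<omega>|M. - complex_of_real (W \<omega>) * exp (- (z0 * complex_of_real (W \<omega>))))) (at z0 within T)"
      unfolding tendsto_at_iff_sequentially
    proof (intro allI impI)
      fix X assume X: "\<forall>i. X i \<in> T - {z0}" "X \<longlonglongrightarrow> z0"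
      have Xpos: "Re (X i) > 0" for i using X(1) r by (auto simp: T_def intro: less_trans)
      have "(\<lambda>i. LINT \<omega>|M. (exp (- (X i * complex_of_real (W \<omega>))) - exp (- (z0 * complex_of_real (W \<omega>)))) / (X i - z0))
        \<longlonglongrightarrow> (LINT \<omega>|M. - complex_of_real (W \<omega>) * exp (- (z0 * complex_of_real (W \<omega>))))"
      proof (rule integral_dominated_convergence[where w = "\<lambda>_. 1 / r"])
        show "AE \<omega> in M. (\<lambda>i. (exp (- (X i * complex_of_real (W \<omega>))) - exp (- (z0 * complex_of_real (W \<omega>)))) / (X i - z0))
            \<longlonglongrightarrow> - complex_of_real (W \<omega>) * exp (- (z0 * complex_of_real (W \<omega>)))"
        proof (intro AE_I2)
          fix \<omega>
          have "((\<lambda>z. (exp (- (z * complex_of_real (W \<omega>))) - exp (- (z0 * complex_of_real (W \<omega>)))) / (z - z0))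
              \<longlongrightarrow> - complex_of_real (W \<omega>) * exp (- (z0 * complex_of_real (W \<omega>)))) (at z0)"
            using deriv[of "W \<omega>" z0 UNIV] by (simp add: has_field_derivative_iff)
          then show "(\<lambda>i. (exp (- (X i * complex_of_real (W \<omega>))) - exp (- (z0 * complex_of_real (W \<omega>)))) / (X i - z0))
            \<longlonglongrightarrow> - complex_of_real (W \<omega>) * exp (- (z0 * complex_of_real (W \<omega>)))"
            unfolding tendsto_at_iff_sequentially using X by (auto simp: o_def)
        qed
        show "AE \<omega> in M. norm ((exp (- (X i * complex_of_real (W \<omega>))) - exp (- (z0 * complex_of_real (W \<omega>)))) / (X i - z0)) \<le> 1 / r" for i
          using X(1) bd by (intro AE_I2) blast
      qed auto
      moreover have "(LINT \<omega>|M. (exp (- (X i * complex_of_real (W \<omega>))) - exp (- (z0 * complex_of_real (W \<omega>)))) / (X i - z0)) =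
         ((LINT \<omega>|M. exp (- (X i * complex_of_real (W \<omega>)))) - (LINT \<omega>|M. exp (- (z0 * complex_of_real (W \<omega>))))) / (X i - z0)" for i
        using int[OF Xpos[of i]] int[OF z0] by simp
      ultimately show "((\<lambda>z. ((LINT \<omega>|M. exp (- (z * complex_of_real (W \<omega>)))) - (LINT \<omega>|M. exp (- (z0 * complex_of_real (W \<omega>))))) / (z - z0)) \<circ> X)
        \<longlonglongrightarrow> (LINT \<omega>|M. - complex_of_real (W \<omega>) * exp (- (z0 * complex_of_real (W \<omega>))))"
        by (simp only: o_def)
    qed
    then show ?thesis
      by (simp only: has_field_derivative_iff at_within_open[OF T(3,1)])
  qed
  then show ?thesis
    unfolding holomorphic_on_open[OF open_right_halfplane] by blast
qed

section \<open>Averaging over the random matrix\<close>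

abbreviation (input) gaussian_vec :: "nat \<Rightarrow> (nat \<Rightarrow> real) measure" where
  "gaussian_vec n \<equiv> (\<Pi>\<^sub>M i\<in>{..<n}. std_normal_distribution)"

lemma prob_space_gaussian_vec: "prob_space (gaussian_vec n)"
  by (intro prob_space_PiM prob_space_normal_density) simp

lemma product_prob_space_std_normal: "product_prob_space (\<lambda>_. std_normal_distribution)"
  by (intro product_prob_spaceI prob_space_normal_density) simp

lemma gaussian_vec_component:
  "k < n \<Longrightarrow> (\<lambda>x. x k) \<in> borel_measurable (gaussian_vec n)"
  using measurable_component_singleton[of k "{..<n}" "\<lambda>_. std_normal_distribution"] by simp

text \<open>The factor 1/2 is that of the Gaussian weight exp (- |x|^2 / 2), so that integrating exp
  (- s \<open>gram_form\<close>) adds s \<open>gram_mat G\<close> to the identity in the Gaussian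
  exponent.\<close>

definition gram_form :: "real mat \<Rightarrow> (nat \<Rightarrow> real) \<Rightarrow> real" where
  "gram_form G x = (\<Sum>j<dim_row G. (\<Sum>k<dim_col G. G $$ (j, k) * x k)\<^sup>2) / 2"

lemma gram_form_nonneg [simp]: "gram_form G x \<ge> 0"
  by (simp add: gram_form_def sum_nonneg)

lemma gram_form_measurable:
  assumes "G \<in> carrier_mat m n"
  shows "gram_form G \<in> borel_measurable (gaussian_vec n)"
  unfolding gram_form_def[abs_def] using assms
  by (auto intro!: borel_measurable_divide borel_measurable_sum borel_measurable_power
      borel_measurable_times gaussian_vec_component)

lemma gaussian_integral_gram_form:
  assumes G: "G \<in> carrier_mat m n" and s: "s \<ge> 0"
  shows "(LINT x|gaussian_vec n. exp (- (s * gram_form G x))) =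
    Determinant.det (1\<^sub>m n + s \<cdot>\<^sub>m gram_mat G) powr (-1/2)"
proof -
  define a where "a i j = s * (\<Sum>l<m. G $$ (l, i) * G $$ (l, j))" for i j
  have form: "(\<Sum>i<n. \<Sum>j<n. a i j * x i * x j) = 2 * (s * gram_form G x)" for x
  proof -
    have "(\<Sum>i<n. \<Sum>j<n. a i j * x i * x j) = (\<Sum>i<n. \<Sum>j<n. \<Sum>l<m. s * ((G $$ (l, i) * x i) * (G $$ (l, j) * x j)))"
      by (simp add: a_def sum_distrib_left sum_distrib_right mult_ac)
    also have "\<dots> = (\<Sum>i<n. \<Sum>l<m. \<Sum>j<n. s * ((G $$ (l, i) * x i) * (G $$ (l, j) * x j)))"
      by (intro sum.cong refl sum.swap)
    also have "\<dots> = (\<Sum>l<m. \<Sum>i<n. \<Sum>j<n. s * ((G $$ (l, i) * x i) * (G $$ (l, j) * x j)))"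
      by (rule sum.swap)
    also have "\<dots> = (\<Sum>l<m. s * (\<Sum>i<n. G $$ (l, i) * x i)\<^sup>2)"
      by (simp only: power2_eq_square sum_product) (simp add: sum_distrib_left)
    also have "\<dots> = 2 * (s * gram_form G x)"
      using G by (simp add: gram_form_def sum_distrib_left sum_distrib_right mult_ac)
    finally show ?thesis .
  qed
  have mat: "Matrix.mat n n (\<lambda>(i, j). of_bool (i = j) + a i j) = 1\<^sub>m n + s \<cdot>\<^sub>m gram_mat G"
    using G by (intro eq_matI) (auto simp: a_def gram_mat_def scalar_prod_def atLeast0LessThan)
  have psd: "0 \<le> (\<Sum>i<n. \<Sum>j<n. a i j * x i * x j)" for x
    unfolding form using s by simp
  have sym: "a i j = a j i" for i j
    by (simp add: a_def mult.commute)
  have "(\<integral>\<^sup>+x. ennreal (exp (- (s * gram_form G x))) \<partial>gaussian_vec n) =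
      ennreal (Determinant.det (1\<^sub>m n + s \<cdot>\<^sub>m gram_mat G) powr (-1/2))"
    using gaussian_integral_det(2)[of n a, OF sym psd] unfolding form mat by simp
  then show ?thesis
    by (subst integral_eq_nn_integral)
      (use gram_form_measurable[OF G] in \<open>auto intro!: borel_measurable_exp borel_measurable_uminus borel_measurable_times\<close>)
qed

text \<open>For s \<noteq> 0 the determinant is (- s)^n times the characteristic polynomial at - 1 /
  s, which factors over the eigenvalue list. The division by s is why s = 0 is treated
  separately.\<close>

lemma det_one_plus_smult_gram:
  assumes G: "G \<in> carrier_mat m n"
  shows "Determinant.det (1\<^sub>m n + s \<cdot>\<^sub>m gram_mat G) = (\<Prod>i<n. 1 + s * eigenvalues_desc (gram_mat G) ! i)"
proof (cases "s = 0")
  case True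
  have "1\<^sub>m n + s \<cdot>\<^sub>m gram_mat G = 1\<^sub>m n"
    using True G by (intro eq_matI) (auto simp: gram_mat_def)
  then show ?thesis using True by simp
next
  case False
  define A where "A = gram_mat G"
  have A: "A \<in> carrier_mat n n" using G by (simp add: A_def gram_mat_def)
  define xs where "xs = eigenvalues_desc A"
  have len: "length xs = n" and cp: "char_poly A = (\<Prod>x\<leftarrow>xs. [:- x, 1:])"
    using eigenvalues_desc_gram[OF G] by (simp_all add: xs_def A_def)
  have "1\<^sub>m n + s \<cdot>\<^sub>m A = (- s) \<cdot>\<^sub>m (- char_matrix A (- 1 / s))"
    using A False by (intro eq_matI) (auto simp: char_matrix_def field_simps)
  then have "Determinant.det (1\<^sub>m n + s \<cdot>\<^sub>m A) = (- s) ^ n * Determinant.det (- char_matrix A (- 1 / s))"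
    using A by (simp add: char_matrix_def det_smult)
  also have "Determinant.det (- char_matrix A (- 1 / s)) = poly (char_poly A) (- 1 / s)"
    using char_poly_matrix[OF A] by simp
  also have "\<dots> = (\<Prod>x\<leftarrow>xs. - x - 1 / s)"
    unfolding cp by (simp add: poly_prod_list comp_def)
  also have "\<dots> = (\<Prod>i<n. - (xs ! i) - 1 / s)"
    using len by (simp add: prod.list_conv_set_nth atLeast0LessThan)
  also have "(- s) ^ n * \<dots> = (\<Prod>i<n. (- s) * (- (xs ! i) - 1 / s))"
    unfolding prod.distrib by simp
  also have "\<dots> = (\<Prod>i<n. 1 + s * xs ! i)"
    using False by (intro prod.cong refl) (simp add: field_simps)
  finally show ?thesis by (simp add: A_def xs_def)
qed

lemma eigenvalues_gram_nonneg:
  assumes "G \<in> carrier_mat m n" "i < n"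
  shows "eigenvalues_desc (gram_mat G) ! i \<ge> 0"
  using eigenvalues_desc_gram(1,3)[OF assms(1)] assms(2) nth_mem by metis

text \<open>Both sides are holomorphic in \<open>z\<close>, and on the positive reals this is the Gaussian integral above.\<close>

lemma prod_eigenvalues_eq_laplace:
  assumes G: "G \<in> carrier_mat m n" and z: "Re z > 0"
  shows "(\<Prod>i<n. (1 + z * complex_of_real (eigenvalues_desc (gram_mat G) ! i)) powr (-1/2)) =
    (LINT x|gaussian_vec n. exp (- (z * complex_of_real (gram_form G x))))"
proof -
  let ?ev = "\<lambda>i. eigenvalues_desc (gram_mat G) ! i"
  let ?f = "\<lambda>z. \<Prod>i<n. (1 + z * complex_of_real (?ev i)) powr (-1/2)"
  let ?g = "\<lambda>z. LINT x|gaussian_vec n. exp (- (z * complex_of_real (gram_form G x)))"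
  interpret prob_space "gaussian_vec n" by (rule prob_space_gaussian_vec)
  \<comment> \<open>Nonnegative eigenvalues keep each factor in the right half-plane, away from the
    branch cut. The principal branch is therefore holomorphic factor by factor, although the product
    of the factors may cross the cut.\<close>
  have nn: "1 + w * complex_of_real (?ev i) \<notin> \<real>\<^sub>\<le>\<^sub>0" if "Re w > 0" "i < n" for w i
  proof -
    have "Re (1 + w * complex_of_real (?ev i)) > 0"
      using that eigenvalues_gram_nonneg[OF G that(2)] by (simp add: add_pos_nonneg)
    then show ?thesis by (auto simp: complex_nonpos_Reals_iff)
  qed
  have hf: "?f holomorphic_on {z. Re z > 0}"
    by (intro holomorphic_intros holomorphic_on_prod) (use nn in auto)
  have hg: "?g holomorphic_on {z. Re z > 0}"
    by (intro holomorphic_on_laplace_transform gram_form_measurable[OF G]) (auto intro: finite_measure_axioms)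
  have eq: "?f (complex_of_real s) = ?g (complex_of_real s)" if "s > 0" for s
  proof -
    have "?f (complex_of_real s) = (\<Prod>i<n. complex_of_real ((1 + s * ?ev i) powr (-1/2)))"
      using that eigenvalues_gram_nonneg[OF G]
      by (intro prod.cong refl) (simp add: powr_of_real[symmetric] add_nonneg_nonneg)
    also have "\<dots> = complex_of_real ((\<Prod>i<n. 1 + s * ?ev i) powr (-1/2))"
      using that eigenvalues_gram_nonneg[OF G]
      by (subst prod_powr_distrib) (auto simp: add_nonneg_nonneg)
    also have "\<dots> = complex_of_real (LINT x|gaussian_vec n. exp (- (s * gram_form G x)))"
      using that by (subst gaussian_integral_gram_form[OF G]) (auto simp: det_one_plus_smult_gram[OF G])
    also have "\<dots> = (LINT x|gaussian_vec n. complex_of_real (exp (- (s * gram_form G x))))"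
      by (rule integral_complex_of_real[symmetric])
    also have "\<dots> = ?g (complex_of_real s)"
      by (simp add: exp_of_real[symmetric])
    finally show ?thesis .
  qed
  have "?f z - ?g z = 0"
  proof (rule analytic_continuation[where f = "\<lambda>z. ?f z - ?g z"])
    show "(\<lambda>z. ?f z - ?g z) holomorphic_on {z. Re z > 0}"
      by (intro holomorphic_on_diff hf hg)
    show "open {z::complex. Re z > 0}" "connected {z::complex. Re z > 0}"
      by (rule open_right_halfplane connected_right_halfplane)+
    show "complex_of_real ` {0<..} \<subseteq> {z. Re z > 0}" by auto
    show "1 \<in> {z::complex. Re z > 0}" by simp
    show "?f w - ?g w = 0" if "w \<in> complex_of_real ` {0<..}" for w
      using that eq by auto
  qed (use z islimpt_positive_reals in auto)
  then show ?thesis by simp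
qed

section \<open>From Cauchy entries to a bilinear form in Gaussian moduli\<close>

lemma (in prob_space) expectation_iexp_cauchy_sum:
  fixes a :: "nat \<Rightarrow> nat \<Rightarrow> 'a \<Rightarrow> real" and c :: "nat \<Rightarrow> nat \<Rightarrow> real"
  assumes indep: "indep_vars (\<lambda>_. borel) (\<lambda>(j, k). a j k) ({..<m} \<times> {..<n})"
    and cauchy: "\<And>j k. j < m \<Longrightarrow> k < n \<Longrightarrow>
      distributed M lborel (a j k) (\<lambda>x. ennreal (1 / (pi * (1 + x\<^sup>2))))"
  shows "(LINT \<omega>|M. iexp (\<Sum>j<m. \<Sum>k<n. c j k * a j k \<omega>)) =
    of_real (exp (- (\<Sum>j<m. \<Sum>k<n. \<bar>c j k\<bar>)))"
proof -
  let ?I = "{..<m} \<times> {..<n}"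
  \<comment> \<open>One factor per matrix entry: independence turns the expectation of their product
    into a product of Cauchy characteristic functions. In the application the weights
    \<open>c j k\<close> come from two frozen Gaussian vectors.\<close>
  define Y where "Y p \<omega> = iexp (c (fst p) (snd p) * a (fst p) (snd p) \<omega>)" for p \<omega>
  have rv: "random_variable borel (a j k)" if "j < m" "k < n" for j k
    using distributed_measurable[OF cauchy[OF that]] by simp
  have "indep_vars (\<lambda>_. borel) (\<lambda>p \<omega>. (\<lambda>x. iexp (c (fst p) (snd p) * x)) ((\<lambda>(j, k). a j k) p \<omega>)) ?I"
    by (rule indep_vars_compose2[OF indep]) simp
  then have indY: "indep_vars (\<lambda>_. borel) Y ?I"
    by (simp add: Y_def[abs_def] case_prod_beta)
  have Yexp: "expectation (Y p) = of_real (exp (- \<bar>c (fst p) (snd p)\<bar>))" if "p \<in> ?I" for p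
  proof -
    obtain j k where pjk: "p = (j, k)" by (cases p)
    with that have p: "p = (j, k)" "j < m" "k < n" by auto
    note d = cauchy[OF p(2,3)]
    have [measurable]: "a j k \<in> borel_measurable M" using rv p by simp
    have "expectation (Y p) = (LINT x|distr M lborel (a j k). iexp (c j k * x))"
      by (subst integral_distr) (auto simp: Y_def[abs_def] p)
    also have "\<dots> = (LINT x|lborel. (1 / (pi * (1 + x\<^sup>2))) *\<^sub>R iexp (c j k * x))"
      unfolding distributed_distr_eq_density[OF d] by (subst integral_density) auto
    finally show ?thesis by (simp only: cauchy_char p fst_conv snd_conv)
  qed
  have "(LINT \<omega>|M. iexp (\<Sum>j<m. \<Sum>k<n. c j k * a j k \<omega>)) = expectation (\<lambda>\<omega>. \<Prod>p\<in>?I. Y p \<omega>)"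
    by (intro Bochner_Integration.integral_cong refl)
      (simp add: Y_def exp_sum[symmetric] sum.cartesian_product case_prod_beta sum_distrib_left)
  also have "\<dots> = (\<Prod>p\<in>?I. expectation (Y p))"
  proof (rule indep_vars_lebesgue_integral[OF _ indY])
    fix p assume p: "p \<in> ?I"
    have [measurable]: "Y p \<in> borel_measurable M"
      using indY p by (auto simp: indep_vars_def)
    show "integrable M (Y p)"
      by (rule integrable_const_bound[where B = 1]) (auto simp: Y_def)
  qed auto
  also have "\<dots> = (\<Prod>p\<in>?I. of_real (exp (- \<bar>c (fst p) (snd p)\<bar>)))"
    by (intro prod.cong refl Yexp)
  also have "\<dots> = of_real (exp (- (\<Sum>j<m. \<Sum>k<n. \<bar>c j k\<bar>)))"
    by (simp add: of_real_prod[symmetric] exp_sum[symmetric] sum_negf sum.cartesian_product case_prod_beta)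
  finally show ?thesis .
qed

text \<open>Read from right to left, this replaces the exponential of a square by an average of
  exponentials that are linear in \<open>w\<close>.\<close>

lemma gaussian_vec_char:
  "(LINT y|gaussian_vec m. iexp (\<Sum>j<m. w j * y j)) = of_real (exp (- (\<Sum>j<m. (w j)\<^sup>2) / 2))"
proof -
  interpret product_prob_space "\<lambda>_ :: nat. std_normal_distribution" UNIV
    using product_prob_space_std_normal .
  have "(LINT y|gaussian_vec m. iexp (\<Sum>j<m. w j * y j)) =
      (LINT y|gaussian_vec m. (\<Prod>j<m. iexp (w j * y j)))"
    by (simp add: exp_sum sum_distrib_left)
  also have "\<dots> = (\<Prod>j<m. (LINT y|std_normal_distribution. iexp (w j * y)))"
    by (rule product_integral_prod) (auto intro!: prob_space.integrable_iexp prob_space_normal_density)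
  also have "\<dots> = (\<Prod>j<m. of_real (exp (- (w j)\<^sup>2 / 2)))"
    by (intro prod.cong refl) (use fun_cong[OF char_std_normal_distribution] in \<open>simp add: char_def\<close>)
  also have "\<dots> = of_real (exp (- (\<Sum>j<m. (w j)\<^sup>2) / 2))"
    by (simp add: of_real_prod[symmetric] exp_sum[symmetric] sum_negf sum_divide_distrib)
  finally show ?thesis .
qed

text \<open>The vector x produces the determinant. For fixed x, the vector y linearises the
  remaining quadratic form, and the matrix can then be averaged first. All integrands live on
  probability spaces and have modulus at most 1, so both exchanges of integrals are
  legitimate.\<close>

lemma (in prob_space) expectation_det_eq_gaussian:
  fixes a :: "nat \<Rightarrow> nat \<Rightarrow> 'a \<Rightarrow> real"
  assumes indep: "indep_vars (\<lambda>_. borel) (\<lambda>(j, k). a j k) ({..<m} \<times> {..<n})"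
    and cauchy: "\<And>j k. j < m \<Longrightarrow> k < n \<Longrightarrow>
      distributed M lborel (a j k) (\<lambda>x. ennreal (1 / (pi * (1 + x\<^sup>2))))"
    and Q: "Q \<in> carrier_mat m n" "\<And>j k. j < m \<Longrightarrow> k < n \<Longrightarrow> Q $$ (j, k) \<ge> 0" and s: "s \<ge> 0"
  shows "(LINT \<omega>|M. Determinant.det (1\<^sub>m n + s\<^sup>2 \<cdot>\<^sub>m gram_mat (sparse_mat Q (\<lambda>j k. a j k \<omega>))) powr (-1/2)) =
    (LINT (x, y)|(gaussian_vec n \<Otimes>\<^sub>M gaussian_vec m). exp (- (s * (\<Sum>j<m. \<Sum>k<n. Q $$ (j, k) * \<bar>y j\<bar> * \<bar>x k\<bar>))))"
proof -
  let ?G = "\<lambda>\<omega>. sparse_mat Q (\<lambda>j k. a j k \<omega>)"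
  have G: "?G \<omega> \<in> carrier_mat m n" for \<omega> using Q by (simp add: sparse_mat_def)
  have form: "gram_form (?G \<omega>) x = (\<Sum>j<m. (\<Sum>k<n. Q $$ (j, k) * a j k \<omega> * x k)\<^sup>2) / 2" for \<omega> x
    using Q by (simp add: gram_form_def sparse_mat_def)
  have a_meas: "random_variable borel (a j k)" if "j < m" "k < n" for j k
    using distributed_measurable[OF cauchy[OF that]] by simp
  interpret X: prob_space "gaussian_vec n" by (rule prob_space_gaussian_vec)
  interpret Y: prob_space "gaussian_vec m" by (rule prob_space_gaussian_vec)
  interpret MX: pair_prob_space M "gaussian_vec n" ..
  interpret MY: pair_prob_space M "gaussian_vec m" ..
  interpret XY: pair_prob_space "gaussian_vec n" "gaussian_vec m" ..
  \<comment> \<open>This integrand is evaluated in two ways: over y it gives back the quadratic form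
    in the matrix, over the matrix it gives the exponential of the moduli.\<close>
  define f where "f \<omega> x y = iexp (\<Sum>j<m. \<Sum>k<n. (s * Q $$ (j, k) * y j * x k) * a j k \<omega>)" for \<omega> x y
  have fy: "(LINT y|gaussian_vec m. f \<omega> x y) = of_real (exp (- (s\<^sup>2 * gram_form (?G \<omega>) x)))" for \<omega> x
  proof -
    define w where "w j = s * (\<Sum>k<n. Q $$ (j, k) * a j k \<omega> * x k)" for j
    have "f \<omega> x y = iexp (\<Sum>j<m. w j * y j)" for y
      by (simp add: f_def w_def sum_distrib_left sum_distrib_right mult_ac)
    then have "(LINT y|gaussian_vec m. f \<omega> x y) = of_real (exp (- (\<Sum>j<m. (w j)\<^sup>2) / 2))"
      by (simp only: gaussian_vec_char)
    also have "- (\<Sum>j<m. (w j)\<^sup>2) / 2 = - (s\<^sup>2 * gram_form (?G \<omega>) x)"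
      by (simp only: w_def form power_mult_distrib) (simp add: sum_distrib_left[symmetric])
    finally show ?thesis .
  qed
  have f\<omega>: "(LINT \<omega>|M. f \<omega> x y) = of_real (exp (- (s * (\<Sum>j<m. \<Sum>k<n. Q $$ (j, k) * \<bar>y j\<bar> * \<bar>x k\<bar>))))" for x y
  proof -
    have "(LINT \<omega>|M. f \<omega> x y) = of_real (exp (- (\<Sum>j<m. \<Sum>k<n. \<bar>s * Q $$ (j, k) * y j * x k\<bar>)))"
      unfolding f_def by (rule expectation_iexp_cauchy_sum[OF indep cauchy])
    also have "(\<Sum>j<m. \<Sum>k<n. \<bar>s * Q $$ (j, k) * y j * x k\<bar>) = s * (\<Sum>j<m. \<Sum>k<n. Q $$ (j, k) * \<bar>y j\<bar> * \<bar>x k\<bar>)"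
      unfolding sum_distrib_left using s Q(2) by (intro sum.cong refl) (simp add: abs_mult)
    finally show ?thesis .
  qed
  have intMX: "integrable (M \<Otimes>\<^sub>M gaussian_vec n) (\<lambda>(\<omega>, x). exp (- (s\<^sup>2 * gram_form (?G \<omega>) x)))"
  proof (rule MX.P.integrable_const_bound[where B = 1])
    show "(\<lambda>(\<omega>, x). exp (- (s\<^sup>2 * gram_form (?G \<omega>) x))) \<in> borel_measurable (M \<Otimes>\<^sub>M gaussian_vec n)"
      unfolding form case_prod_beta
      by (intro measurable_compose[OF _ borel_measurable_exp] borel_measurable_uminus borel_measurable_divide borel_measurable_sum
            borel_measurable_power borel_measurable_times borel_measurable_const
            measurable_compose[OF measurable_fst a_meas] measurable_compose[OF measurable_snd gaussian_vec_component]) auto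
  qed (auto simp: case_prod_beta)
  have intMY: "integrable (M \<Otimes>\<^sub>M gaussian_vec m) (\<lambda>(\<omega>, y). f \<omega> x y)" for x
  proof (rule MY.P.integrable_const_bound[where B = 1])
    have "(\<lambda>p. \<Sum>j<m. \<Sum>k<n. (s * Q $$ (j, k) * snd p j * x k) * a j k (fst p)) \<in> borel_measurable (M \<Otimes>\<^sub>M gaussian_vec m)"
      by (intro borel_measurable_sum borel_measurable_times borel_measurable_const
            measurable_compose[OF measurable_fst a_meas] measurable_compose[OF measurable_snd gaussian_vec_component]) auto
    then show "(\<lambda>(\<omega>, y). f \<omega> x y) \<in> borel_measurable (M \<Otimes>\<^sub>M gaussian_vec m)"
      unfolding f_def case_prod_beta by measurable
  qed (auto simp: f_def)
  have intXY: "integrable (gaussian_vec n \<Otimes>\<^sub>M gaussian_vec m)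
      (\<lambda>(x, y). exp (- (s * (\<Sum>j<m. \<Sum>k<n. Q $$ (j, k) * \<bar>y j\<bar> * \<bar>x k\<bar>))))"
  proof (rule XY.P.integrable_const_bound[where B = 1])
    show "(\<lambda>(x, y). exp (- (s * (\<Sum>j<m. \<Sum>k<n. Q $$ (j, k) * \<bar>y j\<bar> * \<bar>x k\<bar>))))
      \<in> borel_measurable (gaussian_vec n \<Otimes>\<^sub>M gaussian_vec m)"
      unfolding case_prod_beta
      by (intro measurable_compose[OF _ borel_measurable_exp] borel_measurable_uminus borel_measurable_sum
            borel_measurable_times borel_measurable_const borel_measurable_abs
            measurable_compose[OF measurable_fst gaussian_vec_component] measurable_compose[OF measurable_snd gaussian_vec_component]) auto
  qed (use s Q(2) in \<open>auto simp: case_prod_beta intro!: AE_I2 mult_nonneg_nonneg sum_nonneg\<close>)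
  have "(LINT \<omega>|M. Determinant.det (1\<^sub>m n + s\<^sup>2 \<cdot>\<^sub>m gram_mat (?G \<omega>)) powr (-1/2)) =
      (LINT \<omega>|M. LINT x|gaussian_vec n. exp (- (s\<^sup>2 * gram_form (?G \<omega>) x)))"
    by (simp add: gaussian_integral_gram_form[OF G])
  also have "\<dots> = (LINT x|gaussian_vec n. LINT \<omega>|M. exp (- (s\<^sup>2 * gram_form (?G \<omega>) x)))"
    by (rule MX.Fubini_integral[OF intMX, symmetric])
  also have "\<dots> = (LINT x|gaussian_vec n. LINT y|gaussian_vec m. exp (- (s * (\<Sum>j<m. \<Sum>k<n. Q $$ (j, k) * \<bar>y j\<bar> * \<bar>x k\<bar>))))"
  proof (intro Bochner_Integration.integral_cong refl)
    fix x
    have "complex_of_real (LINT \<omega>|M. exp (- (s\<^sup>2 * gram_form (?G \<omega>) x))) =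
        (LINT \<omega>|M. LINT y|gaussian_vec m. f \<omega> x y)"
      unfolding fy by (rule integral_complex_of_real[symmetric])
    also have "\<dots> = (LINT y|gaussian_vec m. LINT \<omega>|M. f \<omega> x y)"
      by (rule MY.Fubini_integral[OF intMY, symmetric])
    also have "\<dots> = complex_of_real (LINT y|gaussian_vec m. exp (- (s * (\<Sum>j<m. \<Sum>k<n. Q $$ (j, k) * \<bar>y j\<bar> * \<bar>x k\<bar>))))"
      unfolding f\<omega> by (rule integral_complex_of_real)
    finally show "(LINT \<omega>|M. exp (- (s\<^sup>2 * gram_form (?G \<omega>) x))) =
        (LINT y|gaussian_vec m. exp (- (s * (\<Sum>j<m. \<Sum>k<n. Q $$ (j, k) * \<bar>y j\<bar> * \<bar>x k\<bar>))))"
      by simp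
  qed
  also have "\<dots> = (LINT (x, y)|(gaussian_vec n \<Otimes>\<^sub>M gaussian_vec m). exp (- (s * (\<Sum>j<m. \<Sum>k<n. Q $$ (j, k) * \<bar>y j\<bar> * \<bar>x k\<bar>))))"
    by (rule XY.integral_fst[OF intXY])
  finally show ?thesis .
qed

section \<open>Two-sided bounds on Laplace transforms, and the two moments they require\<close>

lemma (in prob_space) laplace_transform_bounds:
  fixes S :: "'a \<Rightarrow> real"
  assumes int: "integrable M S" "integrable M (\<lambda>\<omega>. (S \<omega>)\<^sup>2)"
    and nonneg: "\<And>\<omega>. \<omega> \<in> space M \<Longrightarrow> S \<omega> \<ge> 0" and t: "t \<ge> 0"
  defines "\<mu> \<equiv> expectation S"
  shows "exp (- (t * \<mu>)) \<le> expectation (\<lambda>\<omega>. exp (- (t * S \<omega>)))"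
    and "expectation (\<lambda>\<omega>. exp (- (t * S \<omega>))) \<le> exp (- (t * \<mu>) + t\<^sup>2 / 2 * exp (t * \<mu>) * variance S)"
proof -
  have [measurable]: "S \<in> borel_measurable M" using int by simp
  have int_exp: "integrable M (\<lambda>\<omega>. exp (- (t * (S \<omega> - \<mu>))))"
    by (rule integrable_const_bound[where B = "exp (t * \<mu>)"])
      (use t nonneg in \<open>auto simp: right_diff_distrib\<close>)
  have eq: "expectation (\<lambda>\<omega>. exp (- (t * S \<omega>))) = exp (- (t * \<mu>)) * expectation (\<lambda>\<omega>. exp (- (t * (S \<omega> - \<mu>))))"
    by (subst integral_mult_right_zero[symmetric])
      (simp add: exp_add[symmetric] right_diff_distrib)
  have int_sq: "integrable M (\<lambda>\<omega>. (S \<omega> - \<mu>)\<^sup>2)"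
    using int by (simp add: power2_diff)
  have lin: "expectation (\<lambda>\<omega>. 1 - t * (S \<omega> - \<mu>)) = 1"
    using int by (simp add: prob_space \<mu>_def)
  \<comment> \<open>Jensen's inequality in the form of the tangent line at the mean, whose
    expectation is 1.\<close>
  have "expectation (\<lambda>\<omega>. 1 - t * (S \<omega> - \<mu>)) \<le> expectation (\<lambda>\<omega>. exp (- (t * (S \<omega> - \<mu>))))"
  proof (intro integral_mono int_exp)
    show "1 - t * (S \<omega> - \<mu>) \<le> exp (- (t * (S \<omega> - \<mu>)))" for \<omega>
      using exp_ge_add_one_self[of "- (t * (S \<omega> - \<mu>))"] by simp
  qed (use int in simp)
  then show "exp (- (t * \<mu>)) \<le> expectation (\<lambda>\<omega>. exp (- (t * S \<omega>)))"
    unfolding eq lin by simp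
  \<comment> \<open>One constant covers both signs: for x \<ge> 0 the exponential in the remainder
    is at most 1, and for - t \<mu> \<le> x < 0 it is at most exp (t \<mu>). The range of x is what
    nonnegativity of S guarantees for x = t (S - \<mu>).\<close>
  have taylor: "exp (- x) \<le> 1 - x + x\<^sup>2 / 2 * exp (t * \<mu>)" if "x \<ge> - (t * \<mu>)" for x
  proof -
    obtain \<xi> where \<xi>: "\<bar>\<xi>\<bar> \<le> \<bar>- x\<bar>" "exp (- x) = (\<Sum>k<2. (- x) ^ k / fact k) + exp \<xi> / fact 2 * (- x) ^ 2"
      using Maclaurin_exp_le[of "- x" 2] by auto
    have "\<mu> \<ge> 0"
      unfolding \<mu>_def using nonneg by (intro integral_nonneg_AE) auto
    then have t\<mu>: "t * \<mu> \<ge> 0" using t by simp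
    show ?thesis
    proof (cases "x \<ge> 0")
      case True
      have "exp (- x) \<le> 1 - x + x\<^sup>2 / 2"
      proof (cases "x = 0")
        case False
        obtain \<eta> where \<eta>: "\<eta> < 0" "exp (- x) = (\<Sum>k<2. (- x) ^ k / fact k) + exp \<eta> / fact 2 * (- x) ^ 2"
          using Maclaurin_minus[of "- x" 2 "\<lambda>_. exp" exp] True False
          by (auto simp: intro!: derivative_eq_intros)
        have "exp \<eta> / 2 * x\<^sup>2 \<le> 1 / 2 * x\<^sup>2" using \<eta> by (intro mult_right_mono) auto
        then show ?thesis using \<eta>(2) by (simp add: numeral_2_eq_2)
      qed simp
      also have "\<dots> \<le> 1 - x + x\<^sup>2 / 2 * exp (t * \<mu>)"
        using mult_left_mono[of 1 "exp (t * \<mu>)" "x\<^sup>2 / 2"] t\<mu> by simp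
      finally show ?thesis .
    next
      case False
      then have "\<xi> \<le> t * \<mu>" using \<xi>(1) that by linarith
      then have "exp \<xi> / 2 * x\<^sup>2 \<le> exp (t * \<mu>) / 2 * x\<^sup>2" by (intro mult_right_mono) auto
      then show ?thesis using \<xi>(2) by (simp add: numeral_2_eq_2 mult.commute)
    qed
  qed
  have "expectation (\<lambda>\<omega>. exp (- (t * (S \<omega> - \<mu>)))) \<le>
      expectation (\<lambda>\<omega>. (1 - t * (S \<omega> - \<mu>)) + t\<^sup>2 / 2 * exp (t * \<mu>) * (S \<omega> - \<mu>)\<^sup>2)"
  proof (intro integral_mono int_exp)
    show "integrable M (\<lambda>\<omega>. (1 - t * (S \<omega> - \<mu>)) + t\<^sup>2 / 2 * exp (t * \<mu>) * (S \<omega> - \<mu>)\<^sup>2)"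
      using int int_sq by simp
    show "exp (- (t * (S \<omega> - \<mu>))) \<le> (1 - t * (S \<omega> - \<mu>)) + t\<^sup>2 / 2 * exp (t * \<mu>) * (S \<omega> - \<mu>)\<^sup>2"
      if "\<omega> \<in> space M" for \<omega>
    proof -
      have "- (t * \<mu>) \<le> t * (S \<omega> - \<mu>)"
        using nonneg[OF that] t by (simp add: right_diff_distrib)
      from taylor[OF this] show ?thesis by (simp add: power_mult_distrib mult_ac)
    qed
  qed
  also have "\<dots> = expectation (\<lambda>\<omega>. 1 - t * (S \<omega> - \<mu>)) + expectation (\<lambda>\<omega>. t\<^sup>2 / 2 * exp (t * \<mu>) * (S \<omega> - \<mu>)\<^sup>2)"
    using int int_sq by (intro Bochner_Integration.integral_add) auto
  also have "\<dots> = 1 + t\<^sup>2 / 2 * exp (t * \<mu>) * variance S"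
    unfolding lin integral_mult_right_zero by (simp only: \<mu>_def)
  \<comment> \<open>Weakening 1 + u to exp u puts the upper bound in exponential form, so that it
    can be compared with the lower one after taking logarithms.\<close>
  also have "\<dots> \<le> exp (t\<^sup>2 / 2 * exp (t * \<mu>) * variance S)"
    by (rule exp_ge_add_one_self)
  finally show "expectation (\<lambda>\<omega>. exp (- (t * S \<omega>))) \<le> exp (- (t * \<mu>) + t\<^sup>2 / 2 * exp (t * \<mu>) * variance S)"
    unfolding eq exp_add by (intro mult_left_mono) auto
qed

lemma gaussian_vec_abs_moments:
  assumes i: "i < n" and j: "j < n"
  shows "integrable (gaussian_vec n) (\<lambda>x. \<bar>x i\<bar>)"
    and "(LINT x|gaussian_vec n. \<bar>x i\<bar>) = sqrt (2 / pi)"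
    and "integrable (gaussian_vec n) (\<lambda>x. \<bar>x i\<bar> * \<bar>x j\<bar>)"
    and "(LINT x|gaussian_vec n. \<bar>x i\<bar> * \<bar>x j\<bar>) = 2 / pi + (1 - 2 / pi) * of_bool (i = j)"
proof -
  interpret product_prob_space "\<lambda>_ :: nat. std_normal_distribution" UNIV
    using product_prob_space_std_normal .
  have N: "prob_space std_normal_distribution" by (intro prob_space_normal_density) simp
  have one: "integrable std_normal_distribution (\<lambda>x. \<bar>x\<bar>)" "(LINT x|std_normal_distribution. \<bar>x\<bar>) = sqrt (2 / pi)"
    using integrable_norm[OF integrable_std_normal_distribution_moment[of 1]] std_normal_distribution_odd_moments_abs[of 0] by auto
  have two: "integrable std_normal_distribution (\<lambda>x. \<bar>x\<bar> * \<bar>x\<bar>)" "(LINT x|std_normal_distribution. \<bar>x\<bar> * \<bar>x\<bar>) = 1"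
    using integrable_std_normal_distribution_moment[of 2] std_normal_distribution_even_moments_abs[of 1]
    by (auto simp: power2_eq_square)
  have unit: "(LINT x|std_normal_distribution. 1) = (1::real)" "integrable std_normal_distribution (\<lambda>_. 1 :: real)"
    using prob_space.prob_space[OF N] prob_space.finite_measure[OF N] by (auto simp: finite_measure.integrable_const)
  \<comment> \<open>Both moments are written as products over all coordinates, with factor 1 off the
    chosen ones, so that the product measure factorises them. For i = j the two conditions coincide
    and give the square.\<close>
  define g where "g l x = (if l = i then \<bar>x\<bar> else 1) * (if l = j then \<bar>x\<bar> else 1)" for l :: nat and x :: real
  define h where "h l x = (if l = i then \<bar>x\<bar> else 1)" for l :: nat and x :: real
  have g: "(\<Prod>l<n. g l (x l)) = \<bar>x i\<bar> * \<bar>x j\<bar>" for x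
    using i j by (simp add: g_def prod.distrib)
  have h: "(\<Prod>l<n. h l (x l)) = \<bar>x i\<bar>" for x
    using i by (simp add: h_def)
  have gint: "integrable std_normal_distribution (g l)" and hint: "integrable std_normal_distribution (h l)" for l
    using one two unit by (cases "l = i"; cases "l = j"; simp add: g_def[abs_def] h_def[abs_def])+
  show "integrable (gaussian_vec n) (\<lambda>x. \<bar>x i\<bar>)"
    using product_integrable_prod[of "{..<n}" h] hint by (simp add: h)
  show "integrable (gaussian_vec n) (\<lambda>x. \<bar>x i\<bar> * \<bar>x j\<bar>)"
    using product_integrable_prod[of "{..<n}" g] gint by (simp add: g)
  have "(LINT x|gaussian_vec n. \<bar>x i\<bar>) = (\<Prod>l<n. integral\<^sup>L std_normal_distribution (h l))"
    using product_integral_prod[of "{..<n}" h] hint by (simp add: h)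
  also have "\<dots> = (\<Prod>l<n. if l = i then sqrt (2 / pi) else 1)"
    using one unit by (intro prod.cong refl) (auto simp: h_def[abs_def])
  finally show "(LINT x|gaussian_vec n. \<bar>x i\<bar>) = sqrt (2 / pi)" using i by simp
  have "(LINT x|gaussian_vec n. \<bar>x i\<bar> * \<bar>x j\<bar>) = (\<Prod>l<n. integral\<^sup>L std_normal_distribution (g l))"
    using product_integral_prod[of "{..<n}" g] gint by (simp add: g)
  also have "\<dots> = (\<Prod>l<n. if i = j then 1 else (if l = i then sqrt (2 / pi) else 1) * (if l = j then sqrt (2 / pi) else 1))"
    using one two unit by (intro prod.cong refl) (auto simp: g_def[abs_def])
  also have "\<dots> = 2 / pi + (1 - 2 / pi) * of_bool (i = j)"
    using i j by (auto simp: prod.distrib)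
  finally show "(LINT x|gaussian_vec n. \<bar>x i\<bar> * \<bar>x j\<bar>) = 2 / pi + (1 - 2 / pi) * of_bool (i = j)" .
qed

lemma (in pair_prob_space) expectation_mult_pair:
  fixes f :: "'a \<Rightarrow> real" and g :: "'b \<Rightarrow> real"
  assumes f: "integrable M1 f" and g: "integrable M2 g"
  shows "integrable (M1 \<Otimes>\<^sub>M M2) (\<lambda>p. f (fst p) * g (snd p))"
    and "(LINT p|(M1 \<Otimes>\<^sub>M M2). f (fst p) * g (snd p)) = (LINT x|M1. f x) * (LINT y|M2. g y)"
proof -
  have [measurable]: "f \<in> borel_measurable M1" "g \<in> borel_measurable M2" using f g by auto
  show int: "integrable (M1 \<Otimes>\<^sub>M M2) (\<lambda>p. f (fst p) * g (snd p))"
    by (rule Fubini_integrable) (use f g in \<open>auto simp: abs_mult\<close>)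
  show "(LINT p|(M1 \<Otimes>\<^sub>M M2). f (fst p) * g (snd p)) = (LINT x|M1. f x) * (LINT y|M2. g y)"
    unfolding integral_fst'[OF int, symmetric] by simp
qed

text \<open>Two summands share a factor only if they lie in the same row or the same column. With c
  = 2 / pi and d = 1 - c, the mixed moment of entries (j, k) and (j', k') carries one factor c + d
  [k = k'] and one factor c + d [j = j']; summing shows that the diagonal contributions are smaller
  by factors 1/b and 1/m.\<close>

lemma bilinear_abs_gaussian_moments:
  fixes q :: "nat \<Rightarrow> nat \<Rightarrow> real"
  assumes q01: "\<And>j k. j < m \<Longrightarrow> k < n \<Longrightarrow> q j k \<in> {0, 1}"
    and row: "\<And>j. j < m \<Longrightarrow> (\<Sum>k<n. q j k) = real b" and b: "b > 0" "b \<le> m"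
  defines "S \<equiv> \<lambda>p. (\<Sum>j<m. \<Sum>k<n. q j k * \<bar>snd p j\<bar> * \<bar>fst p k\<bar>) / (real m * real b)"
    and "P \<equiv> gaussian_vec n \<Otimes>\<^sub>M gaussian_vec m"
  shows "integrable P S" and "integrable P (\<lambda>p. (S p)\<^sup>2)"
    and "(LINT p|P. S p) = 2 / pi" and "(LINT p|P. (S p - 2 / pi)\<^sup>2) \<le> 1 / real b"
proof -
  interpret X: prob_space "gaussian_vec n" by (rule prob_space_gaussian_vec)
  interpret Y: prob_space "gaussian_vec m" by (rule prob_space_gaussian_vec)
  interpret XY: pair_prob_space "gaussian_vec n" "gaussian_vec m" ..
  interpret P: prob_space P unfolding P_def by (rule XY.P.prob_space_axioms)
  have m: "m > 0" using b by simp
  define c where "c = 2 / pi"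
  define d where "d = 1 - c"
  have c: "0 \<le> c" "0 \<le> d" using pi_ge_two by (auto simp: c_def d_def)
  have one: "integrable P (\<lambda>p. q j k * \<bar>snd p j\<bar> * \<bar>fst p k\<bar>)"
    "(LINT p|P. q j k * \<bar>snd p j\<bar> * \<bar>fst p k\<bar>) = q j k * c" if "j < m" "k < n" for j k
  proof -
    note i = gaussian_vec_abs_moments(1,2)[OF that(1) that(1)] gaussian_vec_abs_moments(1,2)[OF that(2) that(2)]
    have eq: "(\<lambda>p. q j k * \<bar>snd p j\<bar> * \<bar>fst p k\<bar>) = (\<lambda>p. q j k * (\<bar>fst p k\<bar> * \<bar>snd p j\<bar>))" by (auto simp: mult_ac)
    show "integrable P (\<lambda>p. q j k * \<bar>snd p j\<bar> * \<bar>fst p k\<bar>)"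
      unfolding eq P_def by (intro integrable_mult_right XY.expectation_mult_pair i)
    show "(LINT p|P. q j k * \<bar>snd p j\<bar> * \<bar>fst p k\<bar>) = q j k * c"
      unfolding eq P_def integral_mult_right_zero XY.expectation_mult_pair(2)[OF i(3,1)] i(2,4)
      by (simp add: c_def)
  qed
  define r where "r j k = (\<lambda>p :: (nat \<Rightarrow> real) \<times> (nat \<Rightarrow> real). q j k * \<bar>snd p j\<bar> * \<bar>fst p k\<bar>)" for j k
  have two: "integrable P (\<lambda>p. r j k p * r j' k' p)"
    "(LINT p|P. r j k p * r j' k' p) = q j k * q j' k' * ((c + d * of_bool (k = k')) * (c + d * of_bool (j = j')))"
    if "j < m" "k < n" "j' < m" "k' < n" for j k j' k'
  proof -
    note i = gaussian_vec_abs_moments(3,4)[OF that(1,3)] gaussian_vec_abs_moments(3,4)[OF that(2,4)]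
    have eq: "(\<lambda>p. r j k p * r j' k' p) = (\<lambda>p. q j k * q j' k' * ((\<bar>fst p k\<bar> * \<bar>fst p k'\<bar>) * (\<bar>snd p j\<bar> * \<bar>snd p j'\<bar>)))"
      by (auto simp: r_def mult_ac)
    show "integrable P (\<lambda>p. r j k p * r j' k' p)"
      unfolding eq P_def by (intro integrable_mult_right XY.expectation_mult_pair(1)[of "\<lambda>x. \<bar>x k\<bar> * \<bar>x k'\<bar>" "\<lambda>x. \<bar>x j\<bar> * \<bar>x j'\<bar>"] i)
    show "(LINT p|P. r j k p * r j' k' p) = q j k * q j' k' * ((c + d * of_bool (k = k')) * (c + d * of_bool (j = j')))"
      unfolding eq P_def integral_mult_right_zero XY.expectation_mult_pair(2)[OF i(3,1)] i(2,4) c_def d_def by simp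
  qed
  have S_alt: "S p = (\<Sum>j<m. \<Sum>k<n. r j k p) / (real m * real b)" for p by (simp add: S_def r_def)
  have r1: "integrable P (r j k)" "(LINT p|P. r j k p) = q j k * c" if "j < m" "k < n" for j k
    using one[OF that] by (simp_all add: r_def[abs_def])
  show intS: "integrable P S"
    unfolding S_alt[abs_def] by (intro integrable_divide_zero Bochner_Integration.integrable_sum) (auto intro: r1)
  have "(LINT p|P. (\<Sum>j<m. \<Sum>k<n. r j k p)) = (\<Sum>j<m. (LINT p|P. (\<Sum>k<n. r j k p)))"
    by (intro Bochner_Integration.integral_sum Bochner_Integration.integrable_sum) (auto intro: r1)
  also have "\<dots> = (\<Sum>j<m. \<Sum>k<n. (LINT p|P. r j k p))"
    by (intro sum.cong refl Bochner_Integration.integral_sum) (auto intro: r1)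
  also have "\<dots> = (\<Sum>j<m. \<Sum>k<n. q j k * c)"
    by (intro sum.cong refl r1(2)) auto
  finally have "(LINT p|P. S p) = (\<Sum>j<m. \<Sum>k<n. q j k * c) / (real m * real b)"
    unfolding S_alt by simp
  also have "\<dots> = 2 / pi"
  proof -
    have "(\<Sum>j<m. \<Sum>k<n. q j k * c) = real m * real b * c"
      by (simp add: sum_distrib_right[symmetric] row)
    then show ?thesis using m b by (simp add: c_def)
  qed
  finally show ES: "(LINT p|P. S p) = 2 / pi" .
  have sq: "(S p)\<^sup>2 = (\<Sum>j<m. \<Sum>j'<m. \<Sum>k<n. \<Sum>k'<n. r j k p * r j' k' p) / (real m * real b)\<^sup>2" for p
    unfolding S_alt power_divide by (simp only: power2_eq_square sum_product)
  have intS2: "integrable P (\<lambda>p. (S p)\<^sup>2)"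
    unfolding sq by (intro integrable_divide_zero Bochner_Integration.integrable_sum) (auto intro: two)
  then show "integrable P (\<lambda>p. (S p)\<^sup>2)" .
  have "(LINT p|P. (S p)\<^sup>2) = (\<Sum>j<m. \<Sum>j'<m. \<Sum>k<n. \<Sum>k'<n.
      q j k * q j' k' * ((c + d * of_bool (k = k')) * (c + d * of_bool (j = j')))) / (real m * real b)\<^sup>2"
  proof -
    have "(LINT p|P. (\<Sum>j<m. \<Sum>j'<m. \<Sum>k<n. \<Sum>k'<n. r j k p * r j' k' p)) =
        (\<Sum>j<m. (LINT p|P. (\<Sum>j'<m. \<Sum>k<n. \<Sum>k'<n. r j k p * r j' k' p)))"
      by (intro Bochner_Integration.integral_sum Bochner_Integration.integrable_sum) (auto intro: two)
    also have "\<dots> = (\<Sum>j<m. \<Sum>j'<m. (LINT p|P. (\<Sum>k<n. \<Sum>k'<n. r j k p * r j' k' p)))"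
      by (intro sum.cong refl Bochner_Integration.integral_sum Bochner_Integration.integrable_sum) (auto intro: two)
    also have "\<dots> = (\<Sum>j<m. \<Sum>j'<m. \<Sum>k<n. (LINT p|P. (\<Sum>k'<n. r j k p * r j' k' p)))"
      by (intro sum.cong refl Bochner_Integration.integral_sum Bochner_Integration.integrable_sum) (auto intro: two)
    also have "\<dots> = (\<Sum>j<m. \<Sum>j'<m. \<Sum>k<n. \<Sum>k'<n. (LINT p|P. r j k p * r j' k' p))"
      by (intro sum.cong refl Bochner_Integration.integral_sum) (auto intro: two)
    also have "\<dots> = (\<Sum>j<m. \<Sum>j'<m. \<Sum>k<n. \<Sum>k'<n.
        q j k * q j' k' * ((c + d * of_bool (k = k')) * (c + d * of_bool (j = j'))))"
      by (intro sum.cong refl two(2)) auto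
    finally show ?thesis unfolding sq by simp
  qed
  also have "\<dots> \<le> ((c * (real b)\<^sup>2 + d * real b) * (c * (real m)\<^sup>2 + d * real m)) / (real m * real b)\<^sup>2"
  proof (intro divide_right_mono)
    have inner: "(\<Sum>k<n. \<Sum>k'<n. q j k * q j' k' * ((c + d * of_bool (k = k')) * (c + d * of_bool (j = j')))) \<le>
        (c * (real b)\<^sup>2 + d * real b) * (c + d * of_bool (j = j'))" if "j < m" "j' < m" for j j'
    proof -
      have "(\<Sum>k<n. \<Sum>k'<n. q j k * q j' k' * (c + d * of_bool (k = k'))) =
          c * ((\<Sum>k<n. q j k) * (\<Sum>k'<n. q j' k')) + d * (\<Sum>k<n. \<Sum>k'<n. q j k * q j' k' * of_bool (k = k'))"
      proof -
        have e: "q j k * q j' k' * (c + d * of_bool (k = k')) =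
            c * (q j k * q j' k') + d * (q j k * q j' k' * of_bool (k = k'))" for k k'
          by (simp only: distrib_left mult_ac)
        show ?thesis
          by (simp only: e sum.distrib sum_distrib_left[symmetric] sum_product)
      qed
      also have "(\<Sum>k<n. \<Sum>k'<n. q j k * q j' k' * of_bool (k = k')) = (\<Sum>k<n. q j k * q j' k)"
        by (simp add: of_bool_def if_distrib cong: if_cong)
      \<comment> \<open>The overlap of two rows is at most the size b of one of them. This is the
        only information about the position of the ones that the estimate uses.\<close>
      also have "(\<Sum>k<n. q j k * q j' k) \<le> (\<Sum>k<n. q j k)"
        using q01[OF that(1)] q01[OF that(2)] by (intro sum_mono) fastforce
      finally have "(\<Sum>k<n. \<Sum>k'<n. q j k * q j' k' * (c + d * of_bool (k = k'))) \<le> c * (real b)\<^sup>2 + d * real b"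
        using c by (simp add: row that power2_eq_square mult_left_mono)
      then have "(\<Sum>k<n. \<Sum>k'<n. q j k * q j' k' * (c + d * of_bool (k = k'))) * (c + d * of_bool (j = j')) \<le>
          (c * (real b)\<^sup>2 + d * real b) * (c + d * of_bool (j = j'))"
        using c by (intro mult_right_mono) auto
      then show ?thesis by (simp add: sum_distrib_right mult.assoc)
    qed
    have "(\<Sum>j<m. \<Sum>j'<m. \<Sum>k<n. \<Sum>k'<n. q j k * q j' k' * ((c + d * of_bool (k = k')) * (c + d * of_bool (j = j')))) \<le>
        (\<Sum>j<m. \<Sum>j'<m. (c * (real b)\<^sup>2 + d * real b) * (c + d * of_bool (j = j')))"
      by (intro sum_mono inner) auto
    also have "\<dots> = (c * (real b)\<^sup>2 + d * real b) * (\<Sum>j<m. \<Sum>j'<m. c + d * of_bool (j = j'))"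
      by (simp only: sum_distrib_left)
    also have "(\<Sum>j<m. \<Sum>j'<m. c + d * of_bool (j = j')) = c * (real m)\<^sup>2 + d * real m"
    proof -
      have "(\<Sum>j'<m. c + d * of_bool (j = j')) = real m * c + d" if "j < m" for j
      proof -
        have "(\<Sum>j'<m. of_bool (j = j')) = (1 :: real)"
          using that by (simp add: of_bool_def)
        then show ?thesis by (simp only: sum.distrib sum_distrib_left[symmetric]) simp
      qed
      then have "(\<Sum>j<m. \<Sum>j'<m. c + d * of_bool (j = j')) = (\<Sum>j<m. real m * c + d)"
        by (intro sum.cong refl) auto
      then show ?thesis by (simp add: power2_eq_square algebra_simps)
    qed
    finally show "(\<Sum>j<m. \<Sum>j'<m. \<Sum>k<n. \<Sum>k'<n. q j k * q j' k' * ((c + d * of_bool (k = k')) * (c + d * of_bool (j = j')))) \<le>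
        (c * (real b)\<^sup>2 + d * real b) * (c * (real m)\<^sup>2 + d * real m)" .
  qed simp
  also have "\<dots> = (c + d / real b) * (c + d / real m)"
    using m b by (simp add: field_simps power2_eq_square)
  \<comment> \<open>Here b \<le> m: the fluctuation of the m row variables is dominated by that of
    the b column variables met in each row.\<close>
  also have "\<dots> \<le> (c + d / real b) * (c + d / real b)"
    using m b c by (intro mult_left_mono add_left_mono divide_left_mono) auto
  also have "\<dots> \<le> c\<^sup>2 + 1 / real b"
  proof -
    have "(d / real b)\<^sup>2 \<le> d\<^sup>2 / real b"
      using b mult_left_mono[of 1 "real b" "d\<^sup>2"] by (simp add: power_divide power2_eq_square field_simps)
    \<comment> \<open>Since c + d = 1, the terms beyond c^2 are at most (2 c d + d^2) / b, hence at
      most 1 / b.\<close>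
    moreover have "1 = c\<^sup>2 + 2 * c * d + d\<^sup>2"
      by (simp add: d_def power2_eq_square algebra_simps)
    then have "1 / real b = c\<^sup>2 / real b + 2 * c * d / real b + d\<^sup>2 / real b"
      by (simp add: add_divide_distrib[symmetric])
    moreover have "c\<^sup>2 / real b \<ge> 0" by simp
    moreover have "(c + d / real b) * (c + d / real b) = c\<^sup>2 + 2 * c * d / real b + (d / real b)\<^sup>2"
      by (simp add: power2_eq_square algebra_simps)
    ultimately show ?thesis by linarith
  qed
  finally have ES2: "(LINT p|P. (S p)\<^sup>2) \<le> c\<^sup>2 + 1 / real b" .
  have "(LINT p|P. (S p - c)\<^sup>2) = (LINT p|P. (S p)\<^sup>2 - 2 * c * S p + c\<^sup>2)"
    by (simp add: power2_diff algebra_simps)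
  also have "\<dots> = (LINT p|P. (S p)\<^sup>2) - 2 * c * c + c\<^sup>2"
    using intS intS2 ES by (simp add: c_def P.prob_space)
  also have "\<dots> \<le> 1 / real b" using ES2 by (simp add: power2_eq_square)
  finally show "(LINT p|P. (S p - 2 / pi)\<^sup>2) \<le> 1 / real b" by (simp add: c_def)
qed

section \<open>The Poisson process\<close>

lemma (in prob_space) poisson_power_expectation:
  fixes K :: "'a \<Rightarrow> nat" and w :: complex
  assumes K[measurable]: "random_variable (count_space UNIV) K"
    and poisson: "\<And>k. prob {\<omega>\<in>space M. K \<omega> = k} = \<Lambda> ^ k / fact k * exp (- \<Lambda>)"
    and \<Lambda>: "\<Lambda> \<ge> 0" and w: "norm w \<le> 1"
  shows "expectation (\<lambda>\<omega>. w ^ K \<omega>) = exp (of_real \<Lambda> * (w - 1))"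
proof -
  define p where "p k = \<Lambda> ^ k / fact k * exp (- \<Lambda>)" for k
  have p0: "p k \<ge> 0" for k using \<Lambda> by (simp add: p_def)
  have distr: "distr M (count_space UNIV) K = density (count_space UNIV) (\<lambda>k. ennreal (p k))"
  proof (rule measure_eqI_countable[of _ UNIV])
    fix k :: nat
    have "emeasure (distr M (count_space UNIV) K) {k} = emeasure M (K -` {k} \<inter> space M)"
      by (rule emeasure_distr) auto
    also have "K -` {k} \<inter> space M = {\<omega>\<in>space M. K \<omega> = k}" by auto
    also have "emeasure M \<dots> = ennreal (p k)"
      by (simp add: emeasure_eq_measure poisson p_def)
    also have "\<dots> = emeasure (density (count_space UNIV) (\<lambda>k. ennreal (p k))) {k}"
      by (subst emeasure_density) (auto simp: nn_integral_count_space_indicator[symmetric] nn_integral_count_space_finite)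
    finally show "emeasure (distr M (count_space UNIV) K) {k} =
        emeasure (density (count_space UNIV) (\<lambda>k. ennreal (p k))) {k}" .
  qed auto
  \<comment> \<open>The expectation is this exponential series; on the closed unit disc its terms
    are dominated by the Poisson weights themselves.\<close>
  have sums: "(\<lambda>k. p k *\<^sub>R w ^ k) sums (exp (- \<Lambda>) *\<^sub>R exp (of_real \<Lambda> * w))"
  proof -
    have "(\<lambda>k. exp (- \<Lambda>) *\<^sub>R ((of_real \<Lambda> * w) ^ k /\<^sub>R fact k)) sums (exp (- \<Lambda>) *\<^sub>R exp (of_real \<Lambda> * w))"
      by (intro sums_scaleR_right exp_converges)
    then show ?thesis
      by (simp add: p_def scaleR_conv_of_real power_mult_distrib field_simps)
  qed
  have norm_sum: "summable (\<lambda>k. norm (p k *\<^sub>R w ^ k))"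
  proof (rule summable_comparison_test[OF _ ])
    show "\<exists>N. \<forall>k\<ge>N. norm (norm (p k *\<^sub>R w ^ k)) \<le> p k"
      using w p0 by (auto simp: norm_power intro!: mult_left_le power_le_one)
    have "(\<lambda>k. exp (- \<Lambda>) * (\<Lambda> ^ k /\<^sub>R fact k)) sums (exp (- \<Lambda>) * exp \<Lambda>)"
      by (intro sums_mult exp_converges)
    then show "summable p" unfolding sums_iff p_def by (simp add: field_simps)
  qed
  have "expectation (\<lambda>\<omega>. w ^ K \<omega>) = (LINT k|distr M (count_space UNIV) K. w ^ k)"
    by (subst integral_distr) auto
  also have "\<dots> = (LINT k|count_space UNIV. p k *\<^sub>R w ^ k)"
    unfolding distr by (subst integral_density) (auto simp: p0)
  also have "\<dots> = exp (- \<Lambda>) *\<^sub>R exp (of_real \<Lambda> * w)"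
    using sums norm_sum
    by (subst integral_count_space_nat) (auto simp: integrable_count_space_nat_iff sums_iff)
  also have "\<dots> = exp (of_real \<Lambda> * (w - 1))"
    by (simp add: scaleR_conv_of_real exp_of_real[symmetric] exp_add[symmetric] algebra_simps)
  finally show ?thesis .
qed

text \<open>Independence over disjoint cells reduces the expectation to one generating function per
  cell. It is the exponential formula for a multiplicative functional whose factor is constant,
  equal to \<open>w j\<close>, on the cell \<open>I j\<close>.\<close>

lemma poisson_point_process_expectation_prod:
  fixes J :: "nat set" and w :: "nat \<Rightarrow> complex"
  assumes ppp: "poisson_point_process N \<rho> X"
    and J: "finite J" "disjoint_family_on I J"
    and I: "\<And>j. j \<in> J \<Longrightarrow> is_interval (I j) \<and> I j \<subseteq> {0<..} \<and> set_integrable lborel (I j) \<rho>"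
    and \<rho>: "\<And>x. x > 0 \<Longrightarrow> \<rho> x \<ge> 0" and w: "\<And>j. j \<in> J \<Longrightarrow> norm (w j) \<le> 1"
  shows "(\<lambda>\<omega>. \<Prod>j\<in>J. w j ^ card (X \<omega> \<inter> I j)) \<in> borel_measurable N"
    and "(LINT \<omega>|N. (\<Prod>j\<in>J. w j ^ card (X \<omega> \<inter> I j))) =
      exp (\<Sum>j\<in>J. of_real (LINT x:I j|lborel. \<rho> x) * (w j - 1))"
proof -
  interpret prob_space N using ppp by (simp add: poisson_point_process_def)
  have indep: "indep_vars (\<lambda>_. count_space UNIV) (\<lambda>j \<omega>. card (X \<omega> \<inter> I j)) J"
    and pois: "\<And>j k. j \<in> J \<Longrightarrow> prob {\<omega>\<in>space N. card (X \<omega> \<inter> I j) = k} =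
           (LINT x:I j|lborel. \<rho> x) ^ k / fact k * exp (- (LINT x:I j|lborel. \<rho> x))"
    using ppp J I unfolding poisson_point_process_def by blast+
  have rv: "random_variable (count_space UNIV) (\<lambda>\<omega>. card (X \<omega> \<inter> I j))" if "j \<in> J" for j
    using indep that by (auto simp: indep_vars_def)
  have rv': "random_variable borel (\<lambda>\<omega>. w j ^ card (X \<omega> \<inter> I j))" if "j \<in> J" for j
    by (rule measurable_compose[OF rv[OF that]]) simp
  then show "(\<lambda>\<omega>. \<Prod>j\<in>J. w j ^ card (X \<omega> \<inter> I j)) \<in> borel_measurable N"
    by (intro borel_measurable_prod) auto
  have "(LINT \<omega>|N. (\<Prod>j\<in>J. w j ^ card (X \<omega> \<inter> I j))) = (\<Prod>j\<in>J. LINT \<omega>|N. w j ^ card (X \<omega> \<inter> I j))"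
  proof (rule indep_vars_lebesgue_integral[OF J(1)])
    show "indep_vars (\<lambda>_. borel) (\<lambda>j \<omega>. w j ^ card (X \<omega> \<inter> I j)) J"
      by (rule indep_vars_compose2[OF indep]) simp
    show "integrable N (\<lambda>\<omega>. w j ^ card (X \<omega> \<inter> I j))" if "j \<in> J" for j
      by (rule integrable_const_bound[where B = 1]) (use rv'[OF that] w[OF that] in \<open>auto simp: norm_power power_le_one\<close>)
  qed
  also have "\<dots> = (\<Prod>j\<in>J. exp (of_real (LINT x:I j|lborel. \<rho> x) * (w j - 1)))"
  proof (intro prod.cong refl poisson_power_expectation rv pois w)
    show "0 \<le> (LINT x:I j|lborel. \<rho> x)" if "j \<in> J" for j
      using I[OF that] \<rho> unfolding set_lebesgue_integral_def
      by (intro integral_nonneg_AE AE_I2) (auto simp: indicator_def)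
  qed
  also have "\<dots> = exp (\<Sum>j\<in>J. of_real (LINT x:I j|lborel. \<rho> x) * (w j - 1))"
    by (simp add: exp_sum J(1))
  finally show "(LINT \<omega>|N. (\<Prod>j\<in>J. w j ^ card (X \<omega> \<inter> I j))) =
      exp (\<Sum>j\<in>J. of_real (LINT x:I j|lborel. \<rho> x) * (w j - 1))" .
qed

section \<open>Estimates for a single factor, and the exponent of the Poisson expectation\<close>

lemma inv_sqrt_one_plus:
  fixes z :: complex and x :: real
  assumes z: "Re z > 0" and x: "x \<ge> 0"
  defines "u \<equiv> csqrt (1 + z * of_real x)"
  shows "(1 + z * of_real x) powr (-1/2) = 1 / u" "u\<^sup>2 = 1 + z * of_real x"
    and "norm u \<ge> 1" "norm (1 + u) \<ge> 1" "Re u > 0" "u \<noteq> 0" "1 + u \<noteq> 0"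
proof -
  let ?a = "1 + z * of_real x"
  have re: "Re ?a \<ge> 1" using z x by simp
  have a: "?a \<noteq> 0"
  proof
    assume "?a = 0"
    then have "Re ?a = 0" by (simp only: zero_complex.sel)
    with re show False by linarith
  qed
  have "?a powr (-1/2) = 1 / ?a powr (1/2)"
    using powr_minus_divide[of ?a "1/2"] by simp
  then show "?a powr (-1/2) = 1 / u"
    using a by (simp add: u_def csqrt_conv_powr)
  show "u\<^sup>2 = ?a" by (simp add: u_def)
  have "norm ?a \<ge> 1" using re complex_Re_le_cmod[of ?a] by linarith
  then show n: "norm u \<ge> 1" by (simp add: u_def)
  \<comment> \<open>The real part of u^2 is at least 1, so Re u cannot vanish; the branch convention
    then makes it positive.\<close>
  have "(Re u)\<^sup>2 - (Im u)\<^sup>2 \<ge> 1"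
    using re \<open>u\<^sup>2 = ?a\<close> by (metis Re_power2)
  then have "(Re u)\<^sup>2 \<noteq> 0" by (smt (verit) zero_le_power2)
  moreover have "Re u \<ge> 0" by (simp only: u_def Re_csqrt)
  ultimately show "Re u > 0" by (simp add: order_less_le)
  then have "Re (1 + u) \<ge> 1" by simp
  then show "norm (1 + u) \<ge> 1" using complex_Re_le_cmod[of "1 + u"] by linarith
  then show "1 + u \<noteq> 0" by auto
  show "u \<noteq> 0" using n by auto
qed

text \<open>Three bounds for three purposes: boundedness of products, integrability of the exponent
  near x = 0, and divergence of the product to 0 when the points are not summable. With u the root
  of 1 + z x, the second comes from 1/u - 1 = - z x / (u (1 + u)), and the third from |u|^4 = |1 + z
  x|^2.\<close>

lemma norm_inv_sqrt_one_plus: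
  fixes z :: complex and x :: real
  assumes z: "Re z > 0" and x: "x \<ge> 0"
  shows "norm ((1 + z * of_real x) powr (-1/2)) \<le> 1"
    and "norm ((1 + z * of_real x) powr (-1/2) - 1) \<le> norm z * x"
    and "norm ((1 + z * of_real x) powr (-1/2)) ^ 4 \<le> 1 / (1 + 2 * Re z * x)"
proof -
  define u where "u = csqrt (1 + z * of_real x)"
  note u = inv_sqrt_one_plus[OF z x, folded u_def]
  show "norm ((1 + z * of_real x) powr (-1/2)) \<le> 1"
    using u by (simp add: norm_divide)
  have "1 / u - 1 = - (z * of_real x) / (u * (1 + u))"
  proof -
    have "1 / u - 1 = (1 - u) / u" using u(6) by (simp add: diff_divide_distrib)
    also have "\<dots> = (1 - u) * (1 + u) / (u * (1 + u))" using u(7) by simp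
    also have "(1 - u) * (1 + u) = 1 - u\<^sup>2" by (simp add: power2_eq_square algebra_simps)
    finally show ?thesis using u(2) by simp
  qed
  then have "norm (1 / u - 1) = norm z * x / (norm u * norm (1 + u))"
    using x by (simp add: norm_divide norm_mult)
  also have "\<dots> \<le> norm z * x / (1 * 1)"
    using u x by (intro divide_left_mono mult_mono mult_pos_pos) auto
  finally show "norm ((1 + z * of_real x) powr (-1/2) - 1) \<le> norm z * x" using u by simp
  have "1 + 2 * Re z * x \<le> (Re (1 + z * of_real x))\<^sup>2 + (Im (1 + z * of_real x))\<^sup>2"
    using zero_le_power2[of "Re z * x"] zero_le_power2[of "Im z * x"]
    by (simp add: power2_sum)
  also have "\<dots> = norm (1 + z * of_real x) ^ 2" by (simp only: cmod_power2)
  also have "\<dots> = norm u ^ 4"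
    unfolding u(2)[symmetric] by (simp add: norm_power flip: power_mult)
  finally have "1 + 2 * Re z * x \<le> norm u ^ 4" .
  moreover have "1 + 2 * Re z * x > 0" using z x by (simp add: add_pos_nonneg)
  ultimately have "1 / norm u ^ 4 \<le> 1 / (1 + 2 * Re z * x)"
    using u by (intro divide_left_mono mult_pos_pos) auto
  then show "norm ((1 + z * of_real x) powr (-1/2)) ^ 4 \<le> 1 / (1 + 2 * Re z * x)"
    using u by (simp add: norm_divide power_divide)
qed

abbreviation (input) stable_intensity :: "real \<Rightarrow> real" where
  "stable_intensity x \<equiv> 1 / (pi * x powr (3/2))"

text \<open>The modulus of factor minus 1 is at most the smaller of 2 and c x, which in turn is at
  most (2 + c) x / (1 + x). Multiplied by the intensity this gives a single formula, integrable both
  at 0 and at infinity.\<close>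

definition stable_bound :: "real \<Rightarrow> real \<Rightarrow> real" where
  "stable_bound c x = (2 + c) / (pi * (sqrt x * (1 + x)))"

lemma powr_three_halves: "x > 0 \<Longrightarrow> x powr (3/2) = x * sqrt (x::real)"
  using powr_add[of x 1 "1/2"] by (simp add: powr_half_sqrt)

text \<open>Up to a constant the function has the bounded primitive 2 arctan (sqrt x).\<close>

lemma integrable_stable_bound: "set_integrable lborel {0<..} (stable_bound c)"
proof -
  have "set_integrable lborel (einterval 0 \<infinity>) (\<lambda>x. 1 / (sqrt x * (1 + x)))"
  proof (rule interval_integral_FTC_nonneg(1))
    fix x :: real assume "0 < ereal x"
    then have x: "x > 0" by (simp add: zero_ereal_def)
    show "DERIV (\<lambda>x. 2 * arctan (sqrt x)) x :> 1 / (sqrt x * (1 + x))"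
    proof -
      have "DERIV (\<lambda>x. 2 * arctan (sqrt x)) x :> 2 * (inverse (1 + (sqrt x)\<^sup>2) * (inverse (sqrt x) / 2))"
        using x by (auto intro!: derivative_eq_intros)
      also have "2 * (inverse (1 + (sqrt x)\<^sup>2) * (inverse (sqrt x) / 2)) = 1 / (sqrt x * (1 + x))"
        using x by (simp add: inverse_eq_divide)
      finally show ?thesis .
    qed
    show "isCont (\<lambda>x. 1 / (sqrt x * (1 + x))) x"
      using x by (auto intro!: continuous_intros)
  next
    show "AE x in lborel. 0 < ereal x \<longrightarrow> ereal x < \<infinity> \<longrightarrow> 0 \<le> 1 / (sqrt x * (1 + x))"
      by (auto simp: zero_ereal_def)
    have "((\<lambda>x. 2 * arctan (sqrt x)) \<longlongrightarrow> 2 * arctan (sqrt 0)) (at_right 0)"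
      by (intro tendsto_mult tendsto_const tendsto_arctan tendsto_real_sqrt tendsto_ident_at)
    then show "(((\<lambda>x. 2 * arctan (sqrt x)) \<circ> real_of_ereal) \<longlongrightarrow> 0) (at_right 0)"
      by (simp add: zero_ereal_def ereal_tendsto_simps)
    have "((\<lambda>x. 2 * arctan (sqrt x)) \<longlongrightarrow> 2 * (pi / 2)) at_top"
      by (intro tendsto_mult tendsto_const filterlim_compose[OF tendsto_arctan_at_top sqrt_at_top])
    then show "(((\<lambda>x. 2 * arctan (sqrt x)) \<circ> real_of_ereal) \<longlongrightarrow> pi) (at_left \<infinity>)"
      by (simp add: ereal_tendsto_simps)
  qed simp
  then have "set_integrable lborel {0<..} (\<lambda>x. ((2 + c) / pi) * (1 / (sqrt x * (1 + x))))"
    by (intro set_integrable_mult_right) (simp add: zero_ereal_def einterval_eq)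
  moreover have "stable_bound c = (\<lambda>x. ((2 + c) / pi) * (1 / (sqrt x * (1 + x))))"
    by (simp add: stable_bound_def fun_eq_iff)
  ultimately show ?thesis by (simp only:)
qed

text \<open>The factor is evaluated at y and the intensity at x, so that the bound covers sampling
  at mesh points below x uniformly in the mesh; y = x is the limiting case.\<close>

lemma stable_integrand_bound:
  fixes z :: complex
  assumes z: "Re z > 0" and x: "x > 0" and y: "0 \<le> y" "y \<le> x"
  shows "norm (((1 + z * of_real y) powr (-1/2) - 1) * of_real (stable_intensity x)) \<le> stable_bound (norm z) x"
proof -
  define q where "q = norm ((1 + z * of_real y) powr (-1/2) - 1)"
  have "q \<le> norm ((1 + z * of_real y) powr (-1/2)) + norm (1 :: complex)"
    unfolding q_def by (rule norm_triangle_ineq4)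
  then have q2: "q \<le> 2" using norm_inv_sqrt_one_plus(1)[OF z y(1)] by simp
  have "q \<le> norm z * y" unfolding q_def by (rule norm_inv_sqrt_one_plus(2)[OF z y(1)])
  also have "\<dots> \<le> norm z * x" using y by (intro mult_left_mono) auto
  finally have "q + q * x \<le> norm z * x + 2 * x"
    using q2 x by (intro add_mono mult_right_mono) auto
  then have "q * (1 + x) \<le> (2 + norm z) * x" by (simp add: algebra_simps)
  then have "q / x \<le> (2 + norm z) / (1 + x)" using x by (simp add: field_simps)
  then have "q / x / (pi * sqrt x) \<le> (2 + norm z) / (1 + x) / (pi * sqrt x)"
    using x by (intro divide_right_mono) auto
  moreover have "norm (((1 + z * of_real y) powr (-1/2) - 1) * of_real (stable_intensity x)) = q / x / (pi * sqrt x)"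
    using x by (simp add: norm_mult q_def powr_three_halves mult_ac norm_divide)
  moreover have "(2 + norm z) / (1 + x) / (pi * sqrt x) = stable_bound (norm z) x"
    by (simp add: stable_bound_def mult_ac)
  ultimately show ?thesis by simp
qed

text \<open>The square root of w has positive real part, and so has its positive multiple, which is
  thus the principal root. It is used to find the limit at infinity of the primitive of the
  exponent.\<close>

lemma csqrt_scale_real:
  assumes "x > 0" "Re w > 0"
  shows "csqrt (of_real x * w) = of_real (sqrt x) * csqrt w"
proof (rule csqrt_unique)
  show "(of_real (sqrt x) * csqrt w)\<^sup>2 = of_real x * w"
    using assms by (simp add: power_mult_distrib flip: of_real_power)
  define v where "v = csqrt w"
  have "(Re v)\<^sup>2 - (Im v)\<^sup>2 > 0"
    using assms(2) by (metis Re_power2 power2_csqrt v_def)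
  then have "Re v \<noteq> 0" by auto
  moreover have "Re v \<ge> 0" by (simp only: v_def Re_csqrt)
  ultimately have "0 < Re (of_real (sqrt x) * v)" using assms by simp
  then show "0 < Re (of_real (sqrt x) * csqrt w) \<or> Re (of_real (sqrt x) * csqrt w) = 0 \<and> 0 \<le> Im (of_real (sqrt x) * csqrt w)"
    unfolding v_def ..
qed

lemma stable_exponent:
  fixes z :: complex
  assumes z: "Re z > 0"
  shows "(LINT x:{0<..}|lborel. ((1 + z * of_real x) powr (-1/2) - 1) * of_real (stable_intensity x)) =
    - (2 / of_real pi) * csqrt z"
proof -
  let ?f = "\<lambda>x. ((1 + z * of_real x) powr (-1/2) - 1) * complex_of_real (stable_intensity x)"
  define F where "F w = - (2 / of_real pi) * ((csqrt (1 + z * w) - 1) / csqrt w)" for w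
  have nonpos: "1 + z * of_real x \<notin> \<real>\<^sub>\<le>\<^sub>0" if "x \<ge> 0" for x
  proof -
    have "Re (1 + z * of_real x) > 0" using z that by (simp add: add_pos_nonneg)
    then show ?thesis by (auto simp: complex_nonpos_Reals_iff)
  qed
  have int: "set_integrable lborel {0<..} ?f"
  proof (rule set_integrable_bound[OF integrable_stable_bound[of "norm z"]])
    show "set_borel_measurable lborel {0<..} ?f"
      unfolding set_borel_measurable_def measurable_lborel2
    proof (intro borel_measurable_continuous_on_indicator)
      have "1 + z * of_real x \<noteq> 0" if "x > 0" for x using nonpos[of x] that by auto
      then show "continuous_on {0<..} ?f"
        using z by (intro continuous_intros) (auto intro: add_nonneg_nonneg mult_nonneg_nonneg)
    qed simp
    show "AE x in lborel. x \<in> {0<..} \<longrightarrow> norm (?f x) \<le> norm (stable_bound (norm z) x)"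
      using order.trans[OF stable_integrand_bound[OF z] abs_ge_self]
      by (intro AE_I2) (simp only: real_norm_def greaterThan_iff, blast intro: less_imp_le order.refl)
  qed
  have "(LBINT x=0..\<infinity>. ?f x) = - (2 / of_real pi) * csqrt z - 0"
  proof (rule interval_integral_FTC_integrable)
    fix x :: real assume "0 < ereal x"
    then have x: "x > 0" by (simp add: zero_ereal_def)
    define u where "u = csqrt (1 + z * of_real x)"
    define s where "s = complex_of_real (sqrt x)"
    note u = inv_sqrt_one_plus[OF z less_imp_le[OF x], folded u_def]
    have s: "s \<noteq> 0" "s\<^sup>2 = of_real x" "csqrt (of_real x) = s"
      using x by (simp_all add: s_def flip: of_real_power of_real_sqrt)
    have xn: "complex_of_real x \<notin> \<real>\<^sub>\<le>\<^sub>0" using x by (simp add: complex_nonpos_Reals_iff)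
    have "((\<lambda>w. (csqrt (1 + z * w) - 1) / csqrt w) has_field_derivative
        ((z / (2 * u)) * csqrt (of_real x) - (u - 1) * (1 / (2 * csqrt (of_real x)))) / (csqrt (of_real x) * csqrt (of_real x))) (at (of_real x))"
      using nonpos[of x] x xn u(6) s(1)[folded s(3)]
      by (auto intro!: derivative_eq_intros simp: u_def[symmetric] inverse_eq_divide simp del: csqrt_of_real_nonneg)
    then have "((\<lambda>w. (csqrt (1 + z * w) - 1) / csqrt w) has_field_derivative
        ((z / (2 * u)) * s - (u - 1) * (1 / (2 * s))) / (s * s)) (at (of_real x))"
      unfolding s(3) .
    then have "(F has_field_derivative - (2 / of_real pi) * (((z / (2 * u)) * s - (u - 1) * (1 / (2 * s))) / (s * s))) (at (of_real x))"
      unfolding F_def by (rule DERIV_cmult)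
    also have "- (2 / of_real pi) * (((z / (2 * u)) * s - (u - 1) * (1 / (2 * s))) / (s * s)) = ?f x"
    proof -
      \<comment> \<open>With z s^2 = u^2 - 1 the numerator collapses to u - 1, and s^3 is the power
        x^(3/2) in the intensity.\<close>
      have "((z / (2 * u)) * s - (u - 1) * (1 / (2 * s))) / (s * s) = (z * s\<^sup>2 - u\<^sup>2 + u) / (2 * u * s ^ 3)"
        using s u by (simp add: field_simps power2_eq_square power3_eq_cube)
      also have "z * s\<^sup>2 - u\<^sup>2 + u = u - 1" unfolding s u by simp
      also have "(u - 1) / (2 * u * s ^ 3) = - (1 / 2) * ((1 / u - 1) / s ^ 3)"
        using s u by (simp add: field_simps)
      finally have e: "((z / (2 * u)) * s - (u - 1) * (1 / (2 * s))) / (s * s) = - (1 / 2) * ((1 / u - 1) / s ^ 3)" .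
      have "- (2 / of_real pi) * (- (1 / 2) * (v / w)) = v / (of_real pi * w)" for v w :: complex
        by simp
      then have "- (2 / of_real pi) * (((z / (2 * u)) * s - (u - 1) * (1 / (2 * s))) / (s * s)) =
          (1 / u - 1) / (of_real pi * s ^ 3)"
        unfolding e .
      moreover have "s ^ 3 = of_real (x powr (3/2))"
        using x s by (simp add: power3_eq_cube powr_three_halves s_def flip: of_real_mult)
      ultimately show ?thesis using u(1) by simp
    qed
    finally show "((\<lambda>x. F (of_real x)) has_vector_derivative ?f x) (at x)"
      by (rule has_vector_derivative_real_field)
    show "isCont ?f x"
      using x nonpos[of x] by (intro continuous_intros) auto
  next
    show "set_integrable lborel (einterval 0 \<infinity>) ?f"
      using int by (simp add: zero_ereal_def einterval_eq)
    have "((\<lambda>x. F (of_real x)) \<longlongrightarrow> 0) (at_right 0)"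
    proof (rule Lim_null_comparison)
      show "\<forall>\<^sub>F x in at_right 0. norm (F (of_real x)) \<le> 2 / pi * (norm z * sqrt x)"
      proof (rule eventually_mono[OF eventually_at_right_less[of 0]])
        fix x :: real assume x: "0 < x"
        define u where "u = csqrt (1 + z * of_real x)"
        note u = inv_sqrt_one_plus[OF z less_imp_le[OF x], folded u_def]
        \<comment> \<open>Rationalising shows that u - 1 is of order x, so after division by sqrt x
          the primitive vanishes at 0.\<close>
        have "(u - 1) * (1 + u) = z * of_real x"
          using u(2) by (simp add: algebra_simps power2_eq_square)
        then have "u - 1 = z * of_real x / (1 + u)" using u(7) by (simp add: field_simps)
        then have "norm (u - 1) = norm z * x / norm (1 + u)" using x by (simp add: norm_divide norm_mult)
        also have "\<dots> \<le> norm z * x / 1" using u x by (intro divide_left_mono) auto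
        finally have "norm (u - 1) / sqrt x \<le> norm z * x / sqrt x" using x by (intro divide_right_mono) auto
        also have "\<dots> = norm z * sqrt x" using x real_div_sqrt[of x] by (simp only: times_divide_eq_right[symmetric] less_imp_le)
        finally have "2 / pi * (norm (u - 1) / sqrt x) \<le> 2 / pi * (norm z * sqrt x)"
          by (intro mult_left_mono) auto
        moreover have "norm (F (of_real x)) = 2 / pi * (norm (u - 1) / sqrt x)"
          unfolding F_def u_def[symmetric] norm_mult norm_divide norm_minus_cancel using x by simp
        ultimately show "norm (F (of_real x)) \<le> 2 / pi * (norm z * sqrt x)" by simp
      qed
      have "((\<lambda>x. 2 / pi * (norm z * sqrt x)) \<longlongrightarrow> 2 / pi * (norm z * sqrt 0)) (at_right 0)"
        by (intro tendsto_intros)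
      then show "((\<lambda>x. 2 / pi * (norm z * sqrt x)) \<longlongrightarrow> 0) (at_right 0)" by simp
    qed
    then show "(((\<lambda>x. F (of_real x)) \<circ> real_of_ereal) \<longlongrightarrow> 0) (at_right 0)"
      by (simp add: zero_ereal_def ereal_tendsto_simps)
    \<comment> \<open>Pulling sqrt x out of the root of 1 + z x rewrites \<open>F\<close> for x > 0
      in this form, whose limit at infinity follows from continuity of the root at z.\<close>
    have "((\<lambda>x. - (2 / of_real pi) * (csqrt (of_real (inverse x) + z) - of_real (inverse (sqrt x))))
        \<longlongrightarrow> - (2 / of_real pi) * (csqrt (of_real 0 + z) - of_real 0)) at_top"
    proof (intro tendsto_mult tendsto_const tendsto_diff tendsto_of_real)
      have "isCont csqrt z" using z by (intro continuous_at_csqrt) (auto simp: complex_nonpos_Reals_iff)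
      moreover have "((\<lambda>x. of_real (inverse x) + z) \<longlongrightarrow> of_real 0 + z) at_top"
        by (intro tendsto_intros tendsto_inverse_0_at_top filterlim_ident)
      ultimately show "((\<lambda>x. csqrt (of_real (inverse x) + z)) \<longlongrightarrow> csqrt (of_real 0 + z)) at_top"
        by (intro isCont_tendsto_compose[of _ csqrt]) auto
      show "((\<lambda>x. inverse (sqrt x)) \<longlongrightarrow> 0) at_top"
        by (intro tendsto_inverse_0_at_top sqrt_at_top)
    qed
    moreover have "\<forall>\<^sub>F x in at_top. - (2 / of_real pi) * (csqrt (of_real (inverse x) + z) - of_real (inverse (sqrt x))) = F (of_real x)"
    proof (rule eventually_mono[OF eventually_gt_at_top[of 0]])
      fix x :: real assume x: "x > 0"
      have "csqrt (1 + z * of_real x) = csqrt (of_real x * (of_real (inverse x) + z))"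
      proof -
        have "complex_of_real x * of_real (inverse x) = 1" using x by (simp flip: of_real_mult)
        then show ?thesis by (simp only: distrib_left mult.commute[of z])
      qed
      also have "\<dots> = of_real (sqrt x) * csqrt (of_real (inverse x) + z)"
        using x z by (intro csqrt_scale_real) (auto simp: add_pos_pos)
      finally have "(csqrt (1 + z * of_real x) - 1) / csqrt (of_real x) = csqrt (of_real (inverse x) + z) - of_real (inverse (sqrt x))"
        using x by (simp add: diff_divide_distrib inverse_eq_divide)
      then show "- (2 / of_real pi) * (csqrt (of_real (inverse x) + z) - of_real (inverse (sqrt x))) = F (of_real x)"
        by (simp only: F_def)
    qed
    ultimately have "((\<lambda>x. F (of_real x)) \<longlongrightarrow> - (2 / of_real pi) * csqrt z) at_top"
      using Lim_transform_eventually by force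
    then show "(((\<lambda>x. F (of_real x)) \<circ> real_of_ereal) \<longlongrightarrow> - (2 / of_real pi) * csqrt z) (at_left \<infinity>)"
      by (simp add: ereal_tendsto_simps)
  qed simp
  then show ?thesis
    by (simp add: zero_ereal_def interval_lebesgue_integral_def einterval_eq)
qed

section \<open>Mesh approximation of the product over a configuration\<close>

text \<open>Sampling points of a mesh of width \<open>1/k\<close> on \<open>[1/k, k)\<close>; every other point is sent to \<open>0\<close>, where
  the factors of the product are \<open>1\<close>.\<close>

definition mesh :: "nat \<Rightarrow> real \<Rightarrow> real" where
  "mesh k x = (if x < real k then of_int \<lfloor>real k * x\<rfloor> / real k else 0)"

text \<open>Only the indices from 1 to k^2 - 1 are used. Cell 0 reaches down to 0, where the
  intensity has infinite mass; stopping at k^2 ends the mesh at k and keeps the number of cells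
  finite.\<close>

abbreviation (input) mesh_cell :: "nat \<Rightarrow> nat \<Rightarrow> real set" where
  "mesh_cell k i \<equiv> {real i / real k..<real (Suc i) / real k}"

lemma mesh_nonneg: "x \<ge> 0 \<Longrightarrow> mesh k x \<ge> 0"
  by (simp add: mesh_def)

text \<open>Rounding down rather than to the nearest point means that every bound increasing in x
  survives sampling, with a majorant independent of the mesh.\<close>

lemma mesh_le: "x \<ge> 0 \<Longrightarrow> mesh k x \<le> x"
proof -
  assume x: "x \<ge> 0"
  have "of_int \<lfloor>real k * x\<rfloor> / real k \<le> x"
  \<comment> \<open>For k = 0 the quotient is 0 by the convention on division by zero.\<close>
  proof (cases "k = 0")
    case False
    have "of_int \<lfloor>real k * x\<rfloor> \<le> real k * x" by linarith
    then show ?thesis using False by (simp add: divide_le_eq mult.commute)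
  qed (use x in simp)
  then show ?thesis using x by (simp add: mesh_def)
qed

lemma mesh_tendsto:
  assumes x: "x \<ge> 0"
  shows "(\<lambda>k. mesh k x) \<longlonglongrightarrow> x"
proof (rule Lim_transform_eventually)
  show "(\<lambda>k. of_int \<lfloor>real k * x\<rfloor> / real k) \<longlonglongrightarrow> x"
  proof (rule tendsto_sandwich)
    show "\<forall>\<^sub>F k in sequentially. x - 1 / real k \<le> of_int \<lfloor>real k * x\<rfloor> / real k"
    proof (rule eventually_mono[OF eventually_gt_at_top[of 0]])
      fix k :: nat assume k: "k > 0"
      have "real k * x - 1 \<le> of_int \<lfloor>real k * x\<rfloor>" by linarith
      then have "(real k * x - 1) / real k \<le> of_int \<lfloor>real k * x\<rfloor> / real k"
        by (intro divide_right_mono) auto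
      then show "x - 1 / real k \<le> of_int \<lfloor>real k * x\<rfloor> / real k"
        using k by (simp add: diff_divide_distrib)
    qed
    show "\<forall>\<^sub>F k in sequentially. of_int \<lfloor>real k * x\<rfloor> / real k \<le> x"
    proof (rule eventually_mono[OF eventually_gt_at_top[of 0]])
      fix k :: nat assume k: "k > 0"
      have "of_int \<lfloor>real k * x\<rfloor> \<le> real k * x" by linarith
      then show "of_int \<lfloor>real k * x\<rfloor> / real k \<le> x"
        using k by (simp add: field_simps)
    qed
    show "(\<lambda>k. x - 1 / real k) \<longlonglongrightarrow> x" by real_asymp
  qed simp
  show "\<forall>\<^sub>F k in sequentially. of_int \<lfloor>real k * x\<rfloor> / real k = mesh k x"
  proof -
    obtain k0 where "x < real k0" using reals_Archimedean2 by blast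
    then show ?thesis
      by (intro eventually_sequentiallyI[of k0]) (auto simp: mesh_def)
  qed
qed

lemma mesh_cell_iff:
  assumes k: "k > 0" and x: "x > 0"
  shows "x \<in> mesh_cell k i \<longleftrightarrow> i = nat \<lfloor>real k * x\<rfloor>"
proof -
  have "x \<in> mesh_cell k i \<longleftrightarrow> real i \<le> real k * x \<and> real k * x < real i + 1"
    using k by (auto simp: field_simps)
  also have "\<dots> \<longleftrightarrow> \<lfloor>real k * x\<rfloor> = int i" by (auto simp: floor_eq_iff)
  also have "\<dots> \<longleftrightarrow> i = nat \<lfloor>real k * x\<rfloor>" using x by auto
  finally show ?thesis .
qed

lemma mesh_on_cell:
  assumes k: "k > 0" and i: "i \<in> {1..<k\<^sup>2}" and x: "x \<in> mesh_cell k i"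
  shows "mesh k x = real i / real k"
proof -
  have "0 < real i / real k" using i k by simp
  also have "\<dots> \<le> x" using x by simp
  finally have x0: "x > 0" .
  have "real (Suc i) \<le> real (k\<^sup>2)" using i by (simp only: of_nat_le_iff) auto
  then have "real (Suc i) / real k \<le> real (k\<^sup>2) / real k" by (intro divide_right_mono) auto
  also have "\<dots> = real k" using k by (simp add: power2_eq_square)
  finally have "x < real k" using x by auto
  moreover have "\<lfloor>real k * x\<rfloor> = int i"
    using mesh_cell_iff[OF k x0, of i] x x0 by auto
  ultimately show ?thesis by (simp add: mesh_def)
qed

lemma mesh_off_cells:
  assumes k: "k > 0" and x: "x > 0" and off: "\<And>i. i \<in> {1..<k\<^sup>2} \<Longrightarrow> x \<notin> mesh_cell k i"
  shows "mesh k x = 0"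
proof (cases "x < real k")
  case True
  let ?i = "nat \<lfloor>real k * x\<rfloor>"
  have "x \<in> mesh_cell k ?i" using mesh_cell_iff[OF k x] by simp
  then have "?i \<notin> {1..<k\<^sup>2}" using off by blast
  moreover have "?i < k\<^sup>2"
  proof -
    have "real k * x < real k * real k" using True k by simp
    then have "\<lfloor>real k * x\<rfloor> < int (k\<^sup>2)" by (simp add: floor_less_iff power2_eq_square)
    moreover have "0 \<le> \<lfloor>real k * x\<rfloor>" using x by simp
    ultimately show ?thesis by (subst nat_less_iff)
  qed
  ultimately have "?i = 0" unfolding atLeastLessThan_iff by linarith
  then have "\<lfloor>real k * x\<rfloor> = 0" using x by (simp add: order_antisym)
  then show ?thesis by (simp add: mesh_def)
qed (simp add: mesh_def)

lemma disjoint_mesh_cells: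
  assumes k: "k > 0"
  shows "disjoint_family_on (mesh_cell k) {1..<k\<^sup>2}"
unfolding disjoint_family_on_def
proof (intro ballI impI)
  fix i j assume ij: "i \<in> {1..<k\<^sup>2}" "j \<in> {1..<k\<^sup>2}" "i \<noteq> j"
  show "mesh_cell k i \<inter> mesh_cell k j = {}"
  proof (rule ccontr)
    assume "mesh_cell k i \<inter> mesh_cell k j \<noteq> {}"
    then obtain x where x: "x \<in> mesh_cell k i" "x \<in> mesh_cell k j" by blast
    have "0 < real i / real k" using ij k by simp
    also have "\<dots> \<le> x" using x by simp
    finally have "x > 0" .
    then show False using x mesh_cell_iff[OF k] ij(3) by metis
  qed
qed

text \<open>The left side, with counts as exponents, is what independence can evaluate. The right
  side, one factor per point, is what can be compared with the product over the
  configuration.\<close>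

lemma mesh_prod:
  fixes f :: "real \<Rightarrow> complex"
  assumes k: "k > 0" and A: "A \<subseteq> {0<..}" "\<And>u v. u > 0 \<Longrightarrow> finite (A \<inter> {u..v})"
  shows "(\<Prod>i\<in>{1..<k\<^sup>2}. f (real i / real k) ^ card (A \<inter> mesh_cell k i)) =
    (\<Prod>x\<in>(\<Union>i\<in>{1..<k\<^sup>2}. A \<inter> mesh_cell k i). f (mesh k x))"
    and "finite (\<Union>i\<in>{1..<k\<^sup>2}. A \<inter> mesh_cell k i)"
proof -
  have fin: "finite (A \<inter> mesh_cell k i)" if "i \<in> {1..<k\<^sup>2}" for i
    by (rule finite_subset[OF _ A(2)[of "real i / real k" "real (Suc i) / real k"]]) (use that k in auto)
  show "finite (\<Union>i\<in>{1..<k\<^sup>2}. A \<inter> mesh_cell k i)" by (intro finite_UN_I fin) simp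
  have "(\<Prod>x\<in>(\<Union>i\<in>{1..<k\<^sup>2}. A \<inter> mesh_cell k i). f (mesh k x)) =
      (\<Prod>i\<in>{1..<k\<^sup>2}. \<Prod>x\<in>A \<inter> mesh_cell k i. f (mesh k x))"
    using disjoint_mesh_cells[OF k] fin unfolding disjoint_family_on_def
    by (intro prod.UNION_disjoint) blast+
  also have "\<dots> = (\<Prod>i\<in>{1..<k\<^sup>2}. \<Prod>x\<in>A \<inter> mesh_cell k i. f (real i / real k))"
    by (intro prod.cong refl) (simp add: mesh_on_cell[OF k])
  finally show "(\<Prod>i\<in>{1..<k\<^sup>2}. f (real i / real k) ^ card (A \<inter> mesh_cell k i)) =
    (\<Prod>x\<in>(\<Union>i\<in>{1..<k\<^sup>2}. A \<inter> mesh_cell k i). f (mesh k x))" by simp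
qed

text \<open>The derivative 1 / (1 + w) has modulus at most 1 on the closed right half-plane, which
  is convex.\<close>

lemma norm_Ln_one_plus_le:
  assumes "Re w \<ge> 0"
  shows "norm (Ln (1 + w)) \<le> norm w"
proof -
  have "norm (Ln (1 + w) - Ln (1 + 0)) \<le> 1 * norm (w - 0)"
  proof (rule field_differentiable_bound[where S = "{w. Re w \<ge> 0}" and f = "\<lambda>w. Ln (1 + w)"])
    fix x :: complex assume x: "x \<in> {w. Re w \<ge> 0}"
    then have re: "Re (1 + x) \<ge> 1" by simp
    then have "1 + x \<notin> \<real>\<^sub>\<le>\<^sub>0" by (auto simp: complex_nonpos_Reals_iff)
    then show "((\<lambda>w. Ln (1 + w)) has_field_derivative 1 / (1 + x)) (at x within {w. Re w \<ge> 0})"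
      by (auto intro!: derivative_eq_intros simp: inverse_eq_divide)
    have "norm (1 + x) \<ge> 1" using re complex_Re_le_cmod[of "1 + x"] by linarith
    then show "norm (1 / (1 + x)) \<le> 1" by (simp add: norm_divide divide_le_eq)
  qed (use assms convex_halfspace_Re_ge in auto)
  then show ?thesis by simp
qed

text \<open>Unordered sums are integrals against the counting measure, so dominated convergence
  applies without choosing an enumeration.\<close>

lemma infsum_dominated_convergence:
  fixes h :: "nat \<Rightarrow> 'a \<Rightarrow> complex"
  assumes g: "g summable_on A" and bound: "\<And>k x. x \<in> A \<Longrightarrow> norm (h k x) \<le> g x"
    and lim: "\<And>x. x \<in> A \<Longrightarrow> (\<lambda>k. h k x) \<longlonglongrightarrow> f x"
  shows "(\<lambda>k. infsum (h k) A) \<longlonglongrightarrow> infsum f A"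
proof -
  have fbound: "norm (f x) \<le> g x" if "x \<in> A" for x
    using that by (intro tendsto_upperbound[OF tendsto_norm[OF lim]] always_eventually) (auto intro: bound)
  have g0: "g x \<ge> 0" if "x \<in> A" for x using bound[OF that] norm_ge_zero order.trans by blast
  have gn: "Infinite_Sum.abs_summable_on g A"
    using g g0 by (subst summable_on_cong[of A _ g]) auto
  then have gi: "integrable (count_space A) g"
    using abs_summable_equivalent abs_summable_on_def by blast
  have abs: "Infinite_Set_Sum.abs_summable_on h' A" if "\<And>x. x \<in> A \<Longrightarrow> norm (h' x) \<le> g x" for h' :: "'a \<Rightarrow> complex"
    using that gi unfolding abs_summable_on_def
    by (intro Bochner_Integration.integrable_bound[OF gi]) (auto simp: AE_count_space intro: order.trans[OF _ abs_ge_self])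
  have "(\<lambda>k. LINT x|count_space A. h k x) \<longlonglongrightarrow> (LINT x|count_space A. f x)"
    by (rule integral_dominated_convergence[OF _ _ gi]) (auto simp: AE_count_space lim bound)
  then show ?thesis
    using infsetsum_infsum[OF abs[OF bound]] infsetsum_infsum[OF abs[OF fbound]]
    by (simp add: infsetsum_def)
qed

text \<open>Each factor is exp (- h / 2) with h the principal logarithm, and |h x| \<le> |z| x.
  Unordered sums of h therefore converge absolutely, and |z| x also dominates the sampled
  logarithms. Both limits are the exponential of the same sum.\<close>

lemma net_of_products_summable:
  fixes z :: complex
  assumes z: "Re z > 0" and A: "A \<subseteq> {0<..}" "\<And>u v. u > 0 \<Longrightarrow> finite (A \<inter> {u..v})"
    and summable: "(\<lambda>x. x) summable_on A"
  defines "f \<equiv> \<lambda>x. (1 + z * complex_of_real x) powr (-1/2)"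
  shows "\<exists>L. ((\<lambda>F. \<Prod>x\<in>F. f x) \<longlongrightarrow> L) (finite_subsets_at_top A) \<and>
    (\<lambda>k. \<Prod>i\<in>{1..<k\<^sup>2}. f (real i / real k) ^ card (A \<inter> mesh_cell k i)) \<longlonglongrightarrow> L"
proof -
  define h where "h x = Ln (1 + z * complex_of_real x)" for x
  have h_le: "norm (h x) \<le> norm z * x" if "x \<ge> 0" for x
    using norm_Ln_one_plus_le[of "z * of_real x"] that z by (simp add: h_def norm_mult)
  have h0 [simp]: "h 0 = 0" by (simp add: h_def)
  have f_exp: "f x = exp (- (1/2) * h x)" if "x \<ge> 0" for x
  proof -
    have "Re (1 + z * complex_of_real x) > 0" using z that by (simp add: add_pos_nonneg)
    then have "1 + z * complex_of_real x \<noteq> 0" by (metis less_irrefl zero_complex.sel(1))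
    then show ?thesis by (simp add: f_def h_def powr_def)
  qed
  have zsum: "(\<lambda>x. norm z * x) summable_on A"
    using summable by (rule summable_on_cmult_right)
  define L where "L = exp (- (1/2) * infsum h A)"
  have nonneg: "x \<ge> 0" if "x \<in> A" for x
    using A(1) that by (auto intro: less_imp_le)
  have "(\<lambda>x. norm (h x)) summable_on A"
    by (rule Infinite_Sum.abs_summable_on_comparison_test'[OF zsum h_le[OF nonneg]])
  then have "(h has_sum infsum h A) A"
    by (rule has_sum_infsum[OF abs_summable_summable])
  then have "(sum h \<longlongrightarrow> infsum h A) (finite_subsets_at_top A)"
    by (simp only: has_sum_def)
  then have "((\<lambda>F. exp (- (1/2) * sum h F)) \<longlongrightarrow> L) (finite_subsets_at_top A)"
    unfolding L_def by (intro tendsto_exp tendsto_mult tendsto_const)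
  moreover have "\<forall>\<^sub>F F in finite_subsets_at_top A. exp (- (1/2) * sum h F) = (\<Prod>x\<in>F. f x)"
  proof (rule eventually_finite_subsets_at_top_weakI)
    fix F assume F: "finite F" "F \<subseteq> A"
    have "exp (- (1/2) * sum h F) = (\<Prod>x\<in>F. exp (- (1/2) * h x))"
      unfolding sum_distrib_left by (rule exp_sum[OF F(1)])
    also have "\<dots> = (\<Prod>x\<in>F. f x)"
      using F(2) nonneg by (intro prod.cong refl f_exp[symmetric]) blast
    finally show "exp (- (1/2) * sum h F) = (\<Prod>x\<in>F. f x)" .
  qed
  ultimately have net: "((\<lambda>F. \<Prod>x\<in>F. f x) \<longlongrightarrow> L) (finite_subsets_at_top A)"
    by (rule Lim_transform_eventually)
  have "(\<lambda>k. infsum (\<lambda>x. h (mesh k x)) A) \<longlonglongrightarrow> infsum h A"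
  proof (rule infsum_dominated_convergence[OF zsum])
    fix x assume "x \<in> A"
    then have x: "x \<ge> 0" by (rule nonneg)
    show "norm (h (mesh k x)) \<le> norm z * x" for k
      using h_le[OF mesh_nonneg[OF x], of k] mult_left_mono[OF mesh_le[OF x, of k], of "norm z"] by simp
    have "1 + z * complex_of_real x \<notin> \<real>\<^sub>\<le>\<^sub>0"
      using z x by (auto simp: complex_nonpos_Reals_iff not_le intro: add_pos_nonneg)
    then show "(\<lambda>k. h (mesh k x)) \<longlonglongrightarrow> h x"
      unfolding h_def by (intro tendsto_intros mesh_tendsto x) auto
  qed
  then have "(\<lambda>k. exp (- (1/2) * infsum (\<lambda>x. h (mesh k x)) A)) \<longlonglongrightarrow> L"
    unfolding L_def by (intro tendsto_intros)
  moreover have "\<forall>\<^sub>F k in sequentially. exp (- (1/2) * infsum (\<lambda>x. h (mesh k x)) A) =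
      (\<Prod>i\<in>{1..<k\<^sup>2}. f (real i / real k) ^ card (A \<inter> mesh_cell k i))"
  proof (rule eventually_mono[OF eventually_gt_at_top[of 0]])
    fix k :: nat assume k: "k > 0"
    let ?B = "\<Union>i\<in>{1..<k\<^sup>2}. A \<inter> mesh_cell k i"
    \<comment> \<open>Points outside the cells are sampled at 0, where the logarithm is 0; the sum
      is thus a finite one.\<close>
    have "infsum (\<lambda>x. h (mesh k x)) A = infsum (\<lambda>x. h (mesh k x)) ?B"
    proof (rule infsum_cong_neutral)
      fix x assume "x \<in> A - ?B"
      then have "mesh k x = 0" using A by (intro mesh_off_cells[OF k]) auto
      then show "h (mesh k x) = 0" by simp
    qed auto
    also have "\<dots> = (\<Sum>x\<in>?B. h (mesh k x))"
      by (rule infsum_finite[OF mesh_prod(2)[OF k A]])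
    finally have "exp (- (1/2) * infsum (\<lambda>x. h (mesh k x)) A) = exp (\<Sum>x\<in>?B. - (1/2) * h (mesh k x))"
      by (simp only: sum_distrib_left)
    also have "\<dots> = (\<Prod>x\<in>?B. exp (- (1/2) * h (mesh k x)))"
      by (rule exp_sum[OF mesh_prod(2)[OF k A]])
    also have "\<dots> = (\<Prod>x\<in>?B. f (mesh k x))"
    proof (intro prod.cong refl f_exp[symmetric] mesh_nonneg)
      fix x assume "x \<in> ?B"
      then have "x \<in> A" by blast
      then show "x \<ge> 0" using A by (auto intro: less_imp_le)
    qed
    also have "\<dots> = (\<Prod>i\<in>{1..<k\<^sup>2}. f (real i / real k) ^ card (A \<inter> mesh_cell k i))"
      by (rule mesh_prod(1)[OF k A, symmetric])
    finally show "exp (- (1/2) * infsum (\<lambda>x. h (mesh k x)) A) =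
      (\<Prod>i\<in>{1..<k\<^sup>2}. f (real i / real k) ^ card (A \<inter> mesh_cell k i))" .
  qed
  ultimately have "(\<lambda>k. \<Prod>i\<in>{1..<k\<^sup>2}. f (real i / real k) ^ card (A \<inter> mesh_cell k i)) \<longlonglongrightarrow> L"
    by (rule Lim_transform_eventually)
  with net show ?thesis by blast
qed

text \<open>If the points of the configuration have infinite sum, the product diverges to \<open>0\<close>, because
  every factor has modulus at most \<open>(1 + 2 Re z x) powr (-1/4)\<close>.\<close>

lemma net_of_products_not_summable:
  fixes z :: complex
  assumes z: "Re z > 0" and A: "A \<subseteq> {0<..}" "\<And>u v. u > 0 \<Longrightarrow> finite (A \<inter> {u..v})"
    and not_summable: "\<not> (\<lambda>x. x) summable_on A"
  defines "f \<equiv> \<lambda>x. (1 + z * complex_of_real x) powr (-1/2)"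
  shows "((\<lambda>F. \<Prod>x\<in>F. f x) \<longlongrightarrow> 0) (finite_subsets_at_top A)"
    and "(\<lambda>k. \<Prod>i\<in>{1..<k\<^sup>2}. f (real i / real k) ^ card (A \<inter> mesh_cell k i)) \<longlonglongrightarrow> 0"
proof -
  have f1: "norm (f x) \<le> 1" if "x \<ge> 0" for x
    unfolding f_def by (rule norm_inv_sqrt_one_plus(1)[OF z that])
  have small: "\<exists>F. finite F \<and> F \<subseteq> A \<and> norm (\<Prod>x\<in>F. f x) < e" if e: "e > 0" for e
  proof -
    define c where "c = 2 * Re z"
    have c: "c > 0" using z by (simp add: c_def)
    have "\<not> bdd_above (sum (\<lambda>x. x) ` {F. F \<subseteq> A \<and> finite F})"
      using not_summable A nonneg_bdd_above_summable_on[of A "\<lambda>x. x"] by (auto intro: less_imp_le)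
    \<comment> \<open>The threshold is chosen so that the product of the 1 + c x over F, being at
      least c times the sum of the points, exceeds 1 / e^4. The fourth power of the modulus of the
      product is at most the reciprocal of this.\<close>
    then obtain F where F: "F \<subseteq> A" "finite F" "1 / (c * e ^ 4) < sum (\<lambda>x. x) F"
      unfolding bdd_above_def by (auto simp: not_le)
    have pos: "x > 0" if "x \<in> F" for x using F A that by auto
    have "1 / e ^ 4 < c * sum (\<lambda>x. x) F"
      using F(3) c e by (simp add: field_simps)
    also have "\<dots> = (\<Sum>x\<in>F. c * x)" by (rule sum_distrib_left)
    also have "\<dots> \<le> (\<Prod>x\<in>F. 1 + c * x)"
      using c pos by (intro sum_le_prod) (auto intro: less_imp_le)
    finally have big: "1 / e ^ 4 < (\<Prod>x\<in>F. 1 + c * x)" .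
    have "norm (\<Prod>x\<in>F. f x) ^ 4 = (\<Prod>x\<in>F. norm (f x) ^ 4)"
      by (simp only: prod_norm[symmetric] prod_power_distrib)
    also have "\<dots> \<le> (\<Prod>x\<in>F. 1 / (1 + c * x))"
      using norm_inv_sqrt_one_plus(3)[OF z less_imp_le[OF pos]]
      by (intro prod_mono) (auto simp: f_def c_def)
    also have "\<dots> = 1 / (\<Prod>x\<in>F. 1 + c * x)" by (simp add: prod_dividef)
    also have "\<dots> < 1 / (1 / e ^ 4)"
    proof -
      have "0 < 1 / e ^ 4" using e by simp
      then show ?thesis
        by (intro divide_strict_left_mono mult_pos_pos big less_trans[OF _ big]) (assumption | simp)+
    qed
    finally have "norm (\<Prod>x\<in>F. f x) ^ 4 < e ^ 4" by simp
    then have "norm (\<Prod>x\<in>F. f x) < e"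
      by (rule power_less_imp_less_base) (use e in simp)
    then show ?thesis using F by blast
  qed
  \<comment> \<open>Additional factors have modulus at most 1, so one finite set with a small
    product controls every larger one. The map \<open>g\<close> allows the same argument for sampled
    points.\<close>
  have mono: "norm (\<Prod>x\<in>B. f (g x)) \<le> norm (\<Prod>x\<in>F. f (g x))"
    if "finite B" "F \<subseteq> B" "\<And>x. x \<in> B \<Longrightarrow> g x \<ge> 0" for B F and g :: "real \<Rightarrow> real"
  proof -
    have "(\<Prod>x\<in>B. f (g x)) = (\<Prod>x\<in>B - F. f (g x)) * (\<Prod>x\<in>F. f (g x))"
      using that by (intro prod.subset_diff) auto
    moreover have "norm (\<Prod>x\<in>B - F. f (g x)) \<le> 1"
      unfolding prod_norm[symmetric] using that f1 by (intro prod_le_1) auto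
    ultimately show ?thesis by (simp add: norm_mult mult_left_le_one_le)
  qed
  show "((\<lambda>F. \<Prod>x\<in>F. f x) \<longlongrightarrow> 0) (finite_subsets_at_top A)"
  proof (rule tendstoI)
    fix e :: real assume "e > 0"
    then obtain F where F: "finite F" "F \<subseteq> A" "norm (\<Prod>x\<in>F. f x) < e" using small by blast
    have "norm (\<Prod>x\<in>B. f x) < e" if "finite B" "F \<subseteq> B" "B \<subseteq> A" for B
      using mono[OF that(1,2), of "\<lambda>x. x"] F(3) that A by (force intro: less_imp_le)
    then show "\<forall>\<^sub>F B in finite_subsets_at_top A. dist (\<Prod>x\<in>B. f x) 0 < e"
      unfolding eventually_finite_subsets_at_top using F by (intro exI[of _ F]) auto
  qed
  show "(\<lambda>k. \<Prod>i\<in>{1..<k\<^sup>2}. f (real i / real k) ^ card (A \<inter> mesh_cell k i)) \<longlonglongrightarrow> 0"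
  proof (rule tendstoI)
    fix e :: real assume "e > 0"
    then obtain F where F: "finite F" "F \<subseteq> A" "norm (\<Prod>x\<in>F. f x) < e" using small by blast
    have pos: "x > 0" if "x \<in> F" for x using F A that by auto
    have "(\<lambda>k. norm (\<Prod>x\<in>F. f (mesh k x))) \<longlonglongrightarrow> norm (\<Prod>x\<in>F. f x)"
    proof (intro tendsto_norm tendsto_prod)
      fix x assume "x \<in> F"
      then have x: "x \<ge> 0" using pos less_imp_le by blast
      have "1 + z * complex_of_real x \<notin> \<real>\<^sub>\<le>\<^sub>0"
        using z x by (auto simp: complex_nonpos_Reals_iff not_le intro: add_pos_nonneg)
      then show "(\<lambda>k. f (mesh k x)) \<longlonglongrightarrow> f x"
        unfolding f_def by (intro tendsto_intros mesh_tendsto x) auto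
    qed
    then have ev1: "\<forall>\<^sub>F k in sequentially. norm (\<Prod>x\<in>F. f (mesh k x)) < e"
      using F(3) by (rule order_tendstoD(2))
    \<comment> \<open>A point with nonzero sample lies in one of the cells. Hence for large k all of
      F is among the points that the mesh sees.\<close>
    have ev2: "\<forall>\<^sub>F k in sequentially. \<forall>x\<in>F. mesh k x > 0"
      using F(1) by (intro eventually_ball_finite ballI order_tendstoD(1)[OF mesh_tendsto]) (auto intro: less_imp_le pos)
    show "\<forall>\<^sub>F k in sequentially. dist (\<Prod>i\<in>{1..<k\<^sup>2}. f (real i / real k) ^ card (A \<inter> mesh_cell k i)) 0 < e"
      using ev1 ev2 eventually_gt_at_top[of 0]
    proof eventually_elim
      case (elim k)
      let ?B = "\<Union>i\<in>{1..<k\<^sup>2}. A \<inter> mesh_cell k i"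
      have sub: "F \<subseteq> ?B"
      proof
        fix x assume x: "x \<in> F"
        then have "mesh k x \<noteq> 0" using elim(2) by force
        then show "x \<in> ?B" using mesh_off_cells[OF elim(3) pos[OF x]] x F(2) by blast
      qed
      have "norm (\<Prod>x\<in>?B. f (mesh k x)) \<le> norm (\<Prod>x\<in>F. f (mesh k x))"
      proof (rule mono[OF mesh_prod(2)[OF elim(3) A] sub mesh_nonneg])
        fix x assume "x \<in> ?B"
        then have "x \<in> A" by blast
        then show "x \<ge> 0" using A by (auto intro: less_imp_le)
      qed
      then show ?case
        using elim(1) mesh_prod(1)[OF elim(3) A, of f] by simp
    qed
  qed
qed

text \<open>The two cases are applied to each configuration separately, so the convergence holds at
  every sample point. In particular the unordered product over a random configuration inherits
  measurability from the mesh products.\<close>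

lemma mesh_products_tendsto_unordered_prod:
  fixes z :: complex
  assumes z: "Re z > 0" and A: "A \<subseteq> {0<..}" "\<And>u v. u > 0 \<Longrightarrow> finite (A \<inter> {u..v})"
  defines "f \<equiv> \<lambda>x. (1 + z * complex_of_real x) powr (-1/2)"
  shows "(\<lambda>k. \<Prod>i\<in>{1..<k\<^sup>2}. f (real i / real k) ^ card (A \<inter> mesh_cell k i)) \<longlonglongrightarrow> unordered_prod f A"
proof -
  have "\<exists>L. ((\<lambda>F. \<Prod>x\<in>F. f x) \<longlongrightarrow> L) (finite_subsets_at_top A) \<and>
    (\<lambda>k. \<Prod>i\<in>{1..<k\<^sup>2}. f (real i / real k) ^ card (A \<inter> mesh_cell k i)) \<longlonglongrightarrow> L"
  proof (cases "(\<lambda>x. x) summable_on A")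
    case True
    show ?thesis unfolding f_def by (rule net_of_products_summable[OF z A True])
  next
    case False
    show ?thesis unfolding f_def by (intro exI[of _ 0] conjI net_of_products_not_summable[OF z A False])
  qed
  then obtain L where L: "((\<lambda>F. \<Prod>x\<in>F. f x) \<longlongrightarrow> L) (finite_subsets_at_top A)"
    and lim: "(\<lambda>k. \<Prod>i\<in>{1..<k\<^sup>2}. f (real i / real k) ^ card (A \<inter> mesh_cell k i)) \<longlonglongrightarrow> L"
    by blast
  have "unordered_prod f A = L"
    unfolding unordered_prod_def by (rule tendsto_Lim[OF _ L]) simp
  then show ?thesis using lim by simp
qed

text \<open>The mesh products have modulus at most 1 and explicit expectations. Dominated
  convergence is used twice: over the configurations for the products, and over the half-line for
  the exponents.\<close>

lemma poisson_expectation_unordered_prod: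
  fixes z :: complex
  assumes ppp: "poisson_point_process N stable_intensity X" and z: "Re z > 0"
  shows "(LINT \<omega>|N. unordered_prod (\<lambda>x. (1 + z * of_real x) powr (-1/2)) (X \<omega>)) =
    exp (- (2 / of_real pi) * csqrt z)"
proof -
  define f where "f x = (1 + z * complex_of_real x) powr (-1/2)" for x
  have f1: "norm (f x) \<le> 1" if "x \<ge> 0" for x
    unfolding f_def by (rule norm_inv_sqrt_one_plus(1)[OF z that])
  have f0: "f 0 = 1" by (simp add: f_def)
  define P where "P k \<omega> = (\<Prod>i\<in>{1..<k\<^sup>2}. f (real i / real k) ^ card (X \<omega> \<inter> mesh_cell k i))" for k \<omega>
  interpret prob_space N using ppp by (simp add: poisson_point_process_def)
  have X: "X \<omega> \<subseteq> {0<..}" "\<And>u v. u > 0 \<Longrightarrow> finite (X \<omega> \<inter> {u..v})" if "\<omega> \<in> space N" for \<omega>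
    using ppp that by (auto simp: poisson_point_process_def)
  have lim: "(\<lambda>k. P k \<omega>) \<longlonglongrightarrow> unordered_prod f (X \<omega>)" if "\<omega> \<in> space N" for \<omega>
    using mesh_products_tendsto_unordered_prod[OF z X[OF that]] unfolding P_def f_def .
  have cell: "is_interval (mesh_cell k i) \<and> mesh_cell k i \<subseteq> {0<..} \<and> set_integrable lborel (mesh_cell k i) stable_intensity"
    if "k > 0" "i \<in> {1..<k\<^sup>2}" for k i
  proof (intro conjI)
    show "is_interval (mesh_cell k i)" by (rule is_interval_co)
    have p: "real i / real k > 0" using that by simp
    then show "mesh_cell k i \<subseteq> {0<..}" by auto
    have "set_integrable lborel {real i / real k..real (Suc i) / real k} stable_intensity"
      using p by (intro borel_integrable_atLeastAtMost' continuous_intros) auto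
    then show "set_integrable lborel (mesh_cell k i) stable_intensity"
      by (rule set_integrable_subset) auto
  qed
  note pp = poisson_point_process_expectation_prod[OF ppp _ disjoint_mesh_cells cell]
  have P_meas: "P k \<in> borel_measurable N" if "k > 0" for k
    unfolding P_def[abs_def] by (rule pp(1)) (use that f1 in auto)
  have P_exp: "(LINT \<omega>|N. P k \<omega>) = exp (\<Sum>i\<in>{1..<k\<^sup>2}. of_real (LINT x:mesh_cell k i|lborel. stable_intensity x) * (f (real i / real k) - 1))"
    if "k > 0" for k
    unfolding P_def by (rule pp(2)) (use that f1 in auto)
  \<comment> \<open>The sum over cells is the integral of a step function on the whole half-line:
    off the cells the sample is 0, and \<open>f 0 = 1\<close> makes the integrand vanish
    there.\<close>
  have P_int: "(\<Sum>i\<in>{1..<k\<^sup>2}. of_real (LINT x:mesh_cell k i|lborel. stable_intensity x) * (f (real i / real k) - 1)) =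
      (LINT x:{0<..}|lborel. (f (mesh k x) - 1) * of_real (stable_intensity x))" if k: "k > 0" for k
  proof -
    have "(\<Sum>i\<in>{1..<k\<^sup>2}. of_real (LINT x:mesh_cell k i|lborel. stable_intensity x) * (f (real i / real k) - 1)) =
        (\<Sum>i\<in>{1..<k\<^sup>2}. (LINT x|lborel. (f (real i / real k) - 1) * of_real (indicator (mesh_cell k i) x * stable_intensity x)))"
      unfolding set_lebesgue_integral_def integral_mult_right_zero integral_complex_of_real real_scaleR_def
      by (intro sum.cong refl mult.commute)
    also have "\<dots> = (LINT x|lborel. (\<Sum>i\<in>{1..<k\<^sup>2}. (f (real i / real k) - 1) * of_real (indicator (mesh_cell k i) x * stable_intensity x)))"
    proof (intro Bochner_Integration.integral_sum[symmetric] integrable_mult_right)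
      fix i assume "i \<in> {1..<k\<^sup>2}"
      then have "integrable lborel (\<lambda>x. indicator (mesh_cell k i) x * stable_intensity x)"
        using cell[OF k] by (simp add: set_integrable_def)
      then show "integrable lborel (\<lambda>x. complex_of_real (indicator (mesh_cell k i) x * stable_intensity x))"
        by (rule integrable_of_real)
    qed
    also have "\<dots> = (LINT x:{0<..}|lborel. (f (mesh k x) - 1) * of_real (stable_intensity x))"
      unfolding set_lebesgue_integral_def
    proof (intro Bochner_Integration.integral_cong refl)
      fix x :: real
      show "(\<Sum>i\<in>{1..<k\<^sup>2}. (f (real i / real k) - 1) * of_real (indicator (mesh_cell k i) x * stable_intensity x)) =
          indicator {0<..} x *\<^sub>R ((f (mesh k x) - 1) * of_real (stable_intensity x))"
      proof (cases "\<exists>i\<in>{1..<k\<^sup>2}. x \<in> mesh_cell k i")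
        case True
        then obtain i where i: "i \<in> {1..<k\<^sup>2}" "x \<in> mesh_cell k i" by blast
        then have x: "x > 0" using cell[OF k] by blast
        have "(\<Sum>i\<in>{1..<k\<^sup>2}. (f (real i / real k) - 1) * of_real (indicator (mesh_cell k i) x * stable_intensity x)) =
            (\<Sum>j\<in>{i}. (f (real j / real k) - 1) * of_real (indicator (mesh_cell k j) x * stable_intensity x))"
        proof (rule sum.mono_neutral_right)
          show "\<forall>j\<in>{1..<k\<^sup>2} - {i}. (f (real j / real k) - 1) * of_real (indicator (mesh_cell k j) x * stable_intensity x) = 0"
          proof
            fix j assume "j \<in> {1..<k\<^sup>2} - {i}"
            then have "x \<notin> mesh_cell k j" using i(2) unfolding mesh_cell_iff[OF k x] by simp
            then have "indicator (mesh_cell k j) x = (0 :: real)" by (rule indicator_simps(2))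
            then show "(f (real j / real k) - 1) * of_real (indicator (mesh_cell k j) x * stable_intensity x) = 0"
              by (simp only:) simp
          qed
        qed (use i in auto)
        also have "\<dots> = (f (mesh k x) - 1) * of_real (stable_intensity x)"
        proof -
          have "indicator (mesh_cell k i) x = (1 :: real)" using i(2) by (rule indicator_simps(1))
          then show ?thesis using mesh_on_cell[OF k i] by simp
        qed
        finally show ?thesis using x by simp
      next
        case False
        then have z: "indicator (mesh_cell k i) x = (0::real)" if "i \<in> {1..<k\<^sup>2}" for i
          using that by (intro indicator_simps(2)) blast
        have "(\<Sum>i\<in>{1..<k\<^sup>2}. (f (real i / real k) - 1) * of_real (indicator (mesh_cell k i) x * stable_intensity x)) = 0"
          by (intro sum.neutral ballI) (simp only: z, simp)
        moreover have "mesh k x = 0" if "x > 0"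
          using False by (intro mesh_off_cells[OF k that]) blast
        ultimately show ?thesis by (simp add: indicator_def f0)
      qed
    qed
    finally show ?thesis .
  qed
  have nonpos: "1 + z * complex_of_real x \<notin> \<real>\<^sub>\<le>\<^sub>0" if "x \<ge> 0" for x
    using z that by (auto simp: complex_nonpos_Reals_iff not_le intro: add_pos_nonneg)
  have "(\<lambda>k. LINT x:{0<..}|lborel. (f (mesh k x) - 1) * of_real (stable_intensity x)) \<longlonglongrightarrow>
      (LINT x:{0<..}|lborel. (f x - 1) * of_real (stable_intensity x))"
    unfolding set_lebesgue_integral_def
  proof (rule integral_dominated_convergence[OF _ _ integrable_stable_bound[of "norm z", unfolded set_integrable_def]])
    \<comment> \<open>For negative arguments 1 + z x may cross the branch cut. Measurability is
      therefore derived from continuity on [0, \<infinity>) with an indicator in front.\<close>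
    have f_cont: "continuous_on {0..} f"
    proof -
      have "continuous_on {0..} (\<lambda>x. (1 + z * complex_of_real x) powr (-1/2))"
      proof (rule continuous_on_powr_complex)
        show "{0..} \<subseteq> {x. 0 \<le> Re (1 + z * complex_of_real x) \<or> Im (1 + z * complex_of_real x) \<noteq> 0}"
          using z by (simp add: subset_iff)
        show "0 < Re (- 1 / 2 :: complex)" if "x \<in> {0..}" "1 + z * complex_of_real x = 0" for x
          using nonpos[of x] that by simp
      qed (intro continuous_intros)+
      then show ?thesis unfolding f_def .
    qed
    have f_meas: "(\<lambda>x. indicator {0..} x *\<^sub>R f x) \<in> borel_measurable borel"
      by (intro borel_measurable_continuous_on_indicator f_cont) simp
    show "(\<lambda>x. indicator {0<..} x *\<^sub>R ((f (mesh k x) - 1) * of_real (stable_intensity x))) \<in> borel_measurable lborel" for k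
    proof -
      have "(\<lambda>x. indicator {0<..} x *\<^sub>R (((indicator {0..} (mesh k x) *\<^sub>R f (mesh k x)) - 1) * of_real (stable_intensity x))) \<in> borel_measurable lborel"
      proof -
        have [measurable]: "mesh k \<in> borel_measurable borel" unfolding mesh_def[abs_def] by measurable
        note [measurable] = measurable_compose[OF _ f_meas]
        show ?thesis by measurable
      qed
      also have "(\<lambda>x. indicator {0<..} x *\<^sub>R (((indicator {0..} (mesh k x) *\<^sub>R f (mesh k x)) - 1) * of_real (stable_intensity x))) =
          (\<lambda>x. indicator {0<..} x *\<^sub>R ((f (mesh k x) - 1) * of_real (stable_intensity x)))"
        by (auto simp: fun_eq_iff indicator_def mesh_nonneg)
      finally show ?thesis .
    qed
    show "(\<lambda>x. indicator {0<..} x *\<^sub>R ((f x - 1) * of_real (stable_intensity x))) \<in> borel_measurable lborel"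
    proof -
      have "(\<lambda>x. indicator {0<..} x *\<^sub>R (((indicator {0..} x *\<^sub>R f x) - 1) * of_real (stable_intensity x))) \<in> borel_measurable lborel"
        using f_meas by measurable
      also have "(\<lambda>x. indicator {0<..} x *\<^sub>R (((indicator {0..} x *\<^sub>R f x) - 1) * of_real (stable_intensity x))) =
          (\<lambda>x. indicator {0<..} x *\<^sub>R ((f x - 1) * of_real (stable_intensity x)))"
        by (auto simp: fun_eq_iff indicator_def)
      finally show ?thesis .
    qed
    show "AE x in lborel. (\<lambda>k. indicator {0<..} x *\<^sub>R ((f (mesh k x) - 1) * of_real (stable_intensity x)))
        \<longlonglongrightarrow> indicator {0<..} x *\<^sub>R ((f x - 1) * of_real (stable_intensity x))"
    proof (intro AE_I2)
      fix x :: real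
      show "(\<lambda>k. indicator {0<..} x *\<^sub>R ((f (mesh k x) - 1) * of_real (stable_intensity x)))
        \<longlonglongrightarrow> indicator {0<..} x *\<^sub>R ((f x - 1) * of_real (stable_intensity x))"
      proof (cases "x > 0")
        case True
        then have "(\<lambda>k. f (mesh k x)) \<longlonglongrightarrow> f x"
          unfolding f_def using nonpos[of x] by (intro tendsto_intros mesh_tendsto) auto
        then show ?thesis by (intro tendsto_intros)
      qed simp
    qed
    show "AE x in lborel. norm (indicator {0<..} x *\<^sub>R ((f (mesh k x) - 1) * of_real (stable_intensity x)))
        \<le> indicator {0<..} x *\<^sub>R stable_bound (norm z) x" for k
    proof (intro AE_I2)
      fix x :: real
      show "norm (indicator {0<..} x *\<^sub>R ((f (mesh k x) - 1) * of_real (stable_intensity x)))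
        \<le> indicator {0<..} x *\<^sub>R stable_bound (norm z) x"
      proof (cases "x > 0")
        case True
        then show ?thesis
          using stable_integrand_bound[OF z True mesh_nonneg mesh_le, of k] unfolding f_def by simp
      qed simp
    qed
  qed
  then have "(\<lambda>k. exp (LINT x:{0<..}|lborel. (f (mesh k x) - 1) * of_real (stable_intensity x))) \<longlonglongrightarrow>
      exp (- (2 / of_real pi) * csqrt z)"
    unfolding f_def stable_exponent[OF z] by (rule tendsto_exp)
  \<comment> \<open>The formula for the expectation is available for k > 0 only, hence the shifted
    index.\<close>
  then have "(\<lambda>k. exp (LINT x:{0<..}|lborel. (f (mesh (Suc k) x) - 1) * of_real (stable_intensity x))) \<longlonglongrightarrow>
      exp (- (2 / of_real pi) * csqrt z)"
    by (rule LIMSEQ_Suc)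
  then have lim1: "(\<lambda>k. LINT \<omega>|N. P (Suc k) \<omega>) \<longlonglongrightarrow> exp (- (2 / of_real pi) * csqrt z)"
    by (simp only: P_exp[OF zero_less_Suc] P_int[OF zero_less_Suc])
  have lim2: "(\<lambda>k. LINT \<omega>|N. P (Suc k) \<omega>) \<longlonglongrightarrow> (LINT \<omega>|N. unordered_prod f (X \<omega>))"
  proof (rule integral_dominated_convergence[where w = "\<lambda>_. 1"])
    show "AE \<omega> in N. (\<lambda>k. P (Suc k) \<omega>) \<longlonglongrightarrow> unordered_prod f (X \<omega>)"
      using LIMSEQ_Suc[OF lim] by (intro AE_I2)
    show "(\<lambda>\<omega>. unordered_prod f (X \<omega>)) \<in> borel_measurable N"
      using LIMSEQ_Suc[OF lim] P_meas by (rule borel_measurable_LIMSEQ_metric[rotated]) auto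
    show "P (Suc k) \<in> borel_measurable N" for k by (rule P_meas) simp
    show "AE \<omega> in N. norm (P (Suc k) \<omega>) \<le> 1" for k
      unfolding P_def prod_norm[symmetric] norm_power
      by (intro AE_I2 prod_le_1) (auto intro!: power_le_one f1)
  qed simp
  show ?thesis
    using LIMSEQ_unique[OF lim2 lim1] unfolding f_def .
qed

section \<open>Convergence and its rate\<close>

text \<open>One matrix at a time: the estimates here hold for each fixed size, with explicit
  dependence on b, and limits are taken only afterwards.\<close>

locale sparse_cauchy_matrix = prob_space M for M :: "'a measure" +
  fixes m n b :: nat and Q :: "real mat" and a :: "nat \<Rightarrow> nat \<Rightarrow> 'a \<Rightarrow> real"
  assumes n_pos: "n \<ge> 1" and n_le: "n \<le> m" and b_pos: "b > 0"
    and Q_carrier: "Q \<in> carrier_mat m n"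
    and Q_01: "\<And>j k. j < m \<Longrightarrow> k < n \<Longrightarrow> Q $$ (j, k) \<in> {0, 1}"
    and Q_row_sum: "\<And>j. j < m \<Longrightarrow> (\<Sum>k<n. Q $$ (j, k)) = real b"
    and indep: "indep_vars (\<lambda>_. borel) (\<lambda>(j, k). a j k) ({..<m} \<times> {..<n})"
    and cauchy: "\<And>j k. j < m \<Longrightarrow> k < n \<Longrightarrow>
      distributed M lborel (a j k) (\<lambda>x. ennreal (1 / (pi * (1 + x\<^sup>2))))"
begin

definition G :: "'a \<Rightarrow> real mat" where
  "G \<omega> = sparse_mat Q (\<lambda>j k. a j k \<omega>)"

definition scaled_ev :: "nat \<Rightarrow> 'a \<Rightarrow> real" where
  "scaled_ev i \<omega> = eigenvalues_desc (gram_mat (G \<omega>)) ! i / (real m ^ 2 * real b ^ 2)"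

definition real_transform :: "real \<Rightarrow> real" where
  "real_transform t = (LINT \<omega>|M. (\<Prod>i<n. (1 + t\<^sup>2 * scaled_ev i \<omega>) powr (-1/2)))"

definition complex_transform :: "complex \<Rightarrow> complex" where
  "complex_transform z = (LINT \<omega>|M. (\<Prod>i<n. (1 + z * of_real (scaled_ev i \<omega>)) powr (-1/2)))"

lemma m_pos: "m > 0"
  using n_pos n_le by simp

lemma b_le: "b \<le> m"
proof -
  have "real b = (\<Sum>k<n. Q $$ (0, k))" using Q_row_sum m_pos by simp
  also have "\<dots> \<le> (\<Sum>k<n. 1)" using Q_01[OF m_pos] by (intro sum_mono) fastforce
  finally show ?thesis using n_le by simp
qed

lemma G_carrier: "G \<omega> \<in> carrier_mat m n"
  using Q_carrier by (simp add: G_def sparse_mat_def)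

lemma scaled_ev_nonneg: "i < n \<Longrightarrow> scaled_ev i \<omega> \<ge> 0"
  using eigenvalues_gram_nonneg[OF G_carrier] by (simp add: scaled_ev_def)

lemma det_inv_sqrt_eq_prod:
  "det_inv_sqrt (1\<^sub>m n + (z / (of_nat m ^ 2 * of_nat b ^ 2)) \<cdot>\<^sub>m map_mat complex_of_real (gram_mat (G \<omega>))) =
    (\<Prod>i<n. (1 + z * of_real (scaled_ev i \<omega>)) powr (-1/2))"
  unfolding det_inv_sqrt_gram[OF G_carrier] by (simp add: scaled_ev_def)

lemma det_powr_eq_prod:
  "Determinant.det (1\<^sub>m n + (t\<^sup>2 / (real m ^ 2 * real b ^ 2)) \<cdot>\<^sub>m gram_mat (G \<omega>)) powr (-1/2) =
    (\<Prod>i<n. (1 + t\<^sup>2 * scaled_ev i \<omega>) powr (-1/2))"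
proof -
  have "Determinant.det (1\<^sub>m n + (t\<^sup>2 / (real m ^ 2 * real b ^ 2)) \<cdot>\<^sub>m gram_mat (G \<omega>)) =
      (\<Prod>i<n. 1 + t\<^sup>2 * scaled_ev i \<omega>)"
    unfolding det_one_plus_smult_gram[OF G_carrier] by (simp add: scaled_ev_def)
  then show ?thesis
    using scaled_ev_nonneg by (simp only:) (subst prod_powr_distrib, auto simp: add_nonneg_nonneg)
qed

lemma real_transform_bounds:
  assumes t: "t \<ge> 0"
  shows "exp (- (t * (2 / pi))) \<le> real_transform t"
    and "real_transform t \<le> exp (- (t * (2 / pi)) + t\<^sup>2 / 2 * exp (t * (2 / pi)) * (1 / real b))"
proof -
  define P where "P = gaussian_vec n \<Otimes>\<^sub>M gaussian_vec m"
  define S where "S p = (\<Sum>j<m. \<Sum>k<n. Q $$ (j, k) * \<bar>snd p j\<bar> * \<bar>fst p k\<bar>) / (real m * real b)"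
    for p :: "(nat \<Rightarrow> real) \<times> (nat \<Rightarrow> real)"
  interpret X: prob_space "gaussian_vec n" by (rule prob_space_gaussian_vec)
  interpret Y: prob_space "gaussian_vec m" by (rule prob_space_gaussian_vec)
  interpret XY: pair_prob_space "gaussian_vec n" "gaussian_vec m" ..
  interpret P: prob_space P unfolding P_def by (rule XY.P.prob_space_axioms)
  have Q0: "Q $$ (j, k) \<ge> 0" if "j < m" "k < n" for j k using Q_01[OF that] by auto
  note moments = bilinear_abs_gaussian_moments[of m n "\<lambda>j k. Q $$ (j, k)" b, OF _ _ b_pos b_le]
  have int: "integrable P S" "integrable P (\<lambda>p. (S p)\<^sup>2)"
    unfolding P_def S_def[abs_def]
    by - (rule moments(1), fact Q_01, fact Q_row_sum, rule moments(2), fact Q_01, fact Q_row_sum)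
  have mean: "(LINT p|P. S p) = 2 / pi"
    unfolding P_def S_def by (rule moments(3), fact Q_01, fact Q_row_sum)
  have var: "(LINT p|P. (S p - 2 / pi)\<^sup>2) \<le> 1 / real b"
    unfolding P_def S_def by (rule moments(4), fact Q_01, fact Q_row_sum)
  \<comment> \<open>The eigenvalue scale m^2 b^2 becomes m b after the square root, which is the
    number of summands in the bilinear form. The form is thus normalised to an average.\<close>
  define s where "s = t / (real m * real b)"
  have s: "s \<ge> 0" "t\<^sup>2 / (real m ^ 2 * real b ^ 2) = s\<^sup>2"
    using t by (simp_all add: s_def power_divide power_mult_distrib)
  have "real_transform t = (LINT \<omega>|M. Determinant.det (1\<^sub>m n + s\<^sup>2 \<cdot>\<^sub>m gram_mat (G \<omega>)) powr (-1/2))"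
    unfolding real_transform_def det_powr_eq_prod[symmetric] s(2) ..
  also have "\<dots> = (LINT (x, y)|P. exp (- (s * (\<Sum>j<m. \<Sum>k<n. Q $$ (j, k) * \<bar>y j\<bar> * \<bar>x k\<bar>))))"
    unfolding G_def P_def by (rule expectation_det_eq_gaussian[OF indep cauchy Q_carrier Q0 s(1)])
  also have "\<dots> = (LINT p|P. exp (- (t * S p)))"
    by (simp add: S_def s_def case_prod_unfold)
  finally have eq: "real_transform t = (LINT p|P. exp (- (t * S p)))" .
  have S0: "S p \<ge> 0" for p
    unfolding S_def using Q0 by (intro divide_nonneg_nonneg sum_nonneg mult_nonneg_nonneg) auto
  note lt = P.laplace_transform_bounds[OF int S0 t, unfolded mean]
  show "exp (- (t * (2 / pi))) \<le> real_transform t" unfolding eq by (rule lt(1))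
  have "t\<^sup>2 / 2 * exp (t * (2 / pi)) * (LINT p|P. (S p - 2 / pi)\<^sup>2) \<le> t\<^sup>2 / 2 * exp (t * (2 / pi)) * (1 / real b)"
    by (intro mult_left_mono var) auto
  then show "real_transform t \<le> exp (- (t * (2 / pi)) + t\<^sup>2 / 2 * exp (t * (2 / pi)) * (1 / real b))"
    unfolding eq by (intro order.trans[OF lt(2)]) simp
qed

text \<open>Averaging the representation of a fixed matrix over the matrix makes the expectation one
  Laplace transform over a product space. Measurability is checked for the Gram form, which is a
  polynomial in the entries and the Gaussian coordinates.\<close>

lemma complex_transform_eq_laplace:
  assumes z: "Re z > 0"
  shows "complex_transform z = (LINT p|(M \<Otimes>\<^sub>M gaussian_vec n).
    exp (- (z * of_real (gram_form (G (fst p)) (snd p) / (real m ^ 2 * real b ^ 2)))))"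
    and "(\<lambda>p. gram_form (G (fst p)) (snd p) / (real m ^ 2 * real b ^ 2)) \<in> borel_measurable (M \<Otimes>\<^sub>M gaussian_vec n)"
proof -
  define \<kappa> where "\<kappa> = real m ^ 2 * real b ^ 2"
  have \<kappa>: "\<kappa> > 0" using m_pos b_pos by (simp add: \<kappa>_def)
  define W where "W p = gram_form (G (fst p)) (snd p) / \<kappa>" for p
  interpret X: prob_space "gaussian_vec n" by (rule prob_space_gaussian_vec)
  interpret MX: pair_prob_space M "gaussian_vec n" ..
  have a_meas: "random_variable borel (a j k)" if "j < m" "k < n" for j k
    using distributed_measurable[OF cauchy[OF that]] by simp
  have form: "gram_form (G \<omega>) x = (\<Sum>j<m. (\<Sum>k<n. Q $$ (j, k) * a j k \<omega> * x k)\<^sup>2) / 2" for \<omega> x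
    using Q_carrier by (simp add: gram_form_def G_def sparse_mat_def)
  have W_meas: "W \<in> borel_measurable (M \<Otimes>\<^sub>M gaussian_vec n)"
    unfolding W_def[abs_def] form
    by (intro borel_measurable_divide borel_measurable_sum
        borel_measurable_power borel_measurable_times borel_measurable_const
        measurable_compose[OF measurable_fst a_meas] measurable_compose[OF measurable_snd gaussian_vec_component]) auto
  then show "(\<lambda>p. gram_form (G (fst p)) (snd p) / (real m ^ 2 * real b ^ 2)) \<in> borel_measurable (M \<Otimes>\<^sub>M gaussian_vec n)"
    by (simp add: W_def[abs_def] \<kappa>_def)
  have int: "integrable (M \<Otimes>\<^sub>M gaussian_vec n) (\<lambda>p. exp (- (z * of_real (W p))))"
  proof (rule MX.P.integrable_const_bound[where B = 1])
    show "(\<lambda>p. exp (- (z * of_real (W p)))) \<in> borel_measurable (M \<Otimes>\<^sub>M gaussian_vec n)"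
      using W_meas by measurable
    show "AE p in M \<Otimes>\<^sub>M gaussian_vec n. norm (exp (- (z * of_real (W p)))) \<le> 1"
      using z \<kappa> by (intro AE_I2) (simp add: W_def)
  qed
  have "complex_transform z = (LINT \<omega>|M. (LINT x|gaussian_vec n. exp (- (z * of_real (W (\<omega>, x))))))"
    unfolding complex_transform_def
  proof (intro Bochner_Integration.integral_cong refl)
    fix \<omega>
    have "(\<Prod>i<n. (1 + z * of_real (scaled_ev i \<omega>)) powr (-1/2)) =
        (\<Prod>i<n. (1 + z / of_real \<kappa> * of_real (eigenvalues_desc (gram_mat (G \<omega>)) ! i)) powr (-1/2))"
      by (simp add: scaled_ev_def \<kappa>_def)
    also have "\<dots> = (LINT x|gaussian_vec n. exp (- (z / of_real \<kappa> * of_real (gram_form (G \<omega>) x))))"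
      using z \<kappa> by (intro prod_eigenvalues_eq_laplace[OF G_carrier]) simp
    also have "\<dots> = (LINT x|gaussian_vec n. exp (- (z * of_real (W (\<omega>, x)))))"
      by (simp add: W_def)
    finally show "(\<Prod>i<n. (1 + z * of_real (scaled_ev i \<omega>)) powr (-1/2)) =
      (LINT x|gaussian_vec n. exp (- (z * of_real (W (\<omega>, x)))))" .
  qed
  also have "\<dots> = (LINT p|(M \<Otimes>\<^sub>M gaussian_vec n). exp (- (z * of_real (W p))))"
    by (rule MX.integral_fst'[OF int])
  finally show "complex_transform z = (LINT p|(M \<Otimes>\<^sub>M gaussian_vec n).
      exp (- (z * of_real (gram_form (G (fst p)) (snd p) / (real m ^ 2 * real b ^ 2)))))"
    by (simp only: W_def \<kappa>_def)
qed

lemma complex_transform_holomorphic: "complex_transform holomorphic_on {z. Re z > 0}"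
proof -
  interpret X: prob_space "gaussian_vec n" by (rule prob_space_gaussian_vec)
  interpret MX: pair_prob_space M "gaussian_vec n" ..
  have "(\<lambda>z. LINT p|(M \<Otimes>\<^sub>M gaussian_vec n).
      exp (- (z * of_real (gram_form (G (fst p)) (snd p) / (real m ^ 2 * real b ^ 2))))) holomorphic_on {z. Re z > 0}"
    by (rule holomorphic_on_laplace_transform[OF _ complex_transform_eq_laplace(2)[of 1]])
      (auto intro: MX.P.finite_measure_axioms)
  then show ?thesis
    by (rule holomorphic_transform) (simp add: complex_transform_eq_laplace(1))
qed

lemma norm_complex_transform_le:
  assumes z: "Re z > 0"
  shows "norm (complex_transform z) \<le> 1"
proof -
  have "norm (complex_transform z) \<le> (LINT \<omega>|M. norm (\<Prod>i<n. (1 + z * of_real (scaled_ev i \<omega>)) powr (-1/2)))"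
    unfolding complex_transform_def by (rule integral_norm_bound)
  also have "\<dots> \<le> (LINT \<omega>|M. 1)"
  proof (rule integral_mono')
    show "norm (\<Prod>i<n. (1 + z * of_real (scaled_ev i \<omega>)) powr (-1/2)) \<le> 1" for \<omega>
      unfolding prod_norm[symmetric]
      by (intro prod_le_1 conjI norm_ge_zero norm_inv_sqrt_one_plus(1)[OF z] scaled_ev_nonneg) simp
  qed auto
  also have "\<dots> = 1" by (simp add: prob_space)
  finally show ?thesis .
qed

lemma complex_transform_of_real: "complex_transform (of_real (t\<^sup>2)) = of_real (real_transform t)"
  unfolding complex_transform_def real_transform_def integral_complex_of_real[symmetric]
proof (intro Bochner_Integration.integral_cong refl)
  fix \<omega>
  have "(1 + of_real (t\<^sup>2) * of_real (scaled_ev i \<omega>)) powr (-1/2) = complex_of_real ((1 + t\<^sup>2 * scaled_ev i \<omega>) powr (-1/2))"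
    if "i < n" for i
    using scaled_ev_nonneg[OF that, of \<omega>]
    by (subst powr_of_real[symmetric]) (auto simp: add_nonneg_nonneg)
  then show "(\<Prod>i<n. (1 + of_real (t\<^sup>2) * of_real (scaled_ev i \<omega>)) powr (-1/2)) =
      complex_of_real (\<Prod>i<n. (1 + t\<^sup>2 * scaled_ev i \<omega>) powr (-1/2))"
    unfolding of_real_prod by (intro prod.cong refl) auto
qed

text \<open>The relative error obtained by solving exp (- (2 / pi) t (1 + \<delta>)) for \<delta>.
  At t = 0 the exponent vanishes whatever \<delta> is, and the value 0 keeps the uniform bound valid
  there.\<close>

definition rate_error :: "real \<Rightarrow> real" where
  "rate_error t = (if t = 0 then 0 else - (pi / (2 * t)) * ln (real_transform t) - 1)"

lemma real_transform_eq_exp: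
  assumes "t \<ge> 0"
  shows "real_transform t = exp (- (2 / pi) * t * (1 + rate_error t))"
proof (cases "t = 0")
  case True
  then show ?thesis by (simp add: real_transform_def prob_space)
next
  case False
  have "real_transform t > 0"
    using real_transform_bounds(1)[OF assms] exp_gt_zero less_le_trans by blast
  moreover have "- (2 / pi) * t * (1 + rate_error t) = ln (real_transform t)"
    using False by (simp add: rate_error_def)
  ultimately show ?thesis by simp
qed

text \<open>The logarithm deviates from - 2 t / pi by at most a multiple of t^2 / b. Dividing by 2 t
  / pi leaves a multiple of t / b, which stays bounded down to t = 0; pi / 4 is the product of pi /
  2 and the Taylor factor 1 / 2.\<close>

lemma rate_error_bound:
  assumes t: "0 \<le> t" "t \<le> T"
  shows "\<bar>rate_error t\<bar> \<le> pi / 4 * (T * exp (T * (2 / pi))) / real b"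
proof (cases "t = 0")
  case True
  then show ?thesis using assms by (simp add: rate_error_def)
next
  case False
  then have t0: "t > 0" using t by simp
  define l where "l = ln (real_transform t)"
  have pos: "real_transform t > 0"
    using real_transform_bounds(1)[OF t(1)] exp_gt_zero less_le_trans by blast
  have lower: "- (t * (2 / pi)) \<le> l"
    using real_transform_bounds(1)[OF t(1)] pos unfolding l_def by (subst ln_ge_iff)
  have upper: "l \<le> - (t * (2 / pi)) + t\<^sup>2 / 2 * exp (t * (2 / pi)) * (1 / real b)"
    using real_transform_bounds(2)[OF t(1)] pos unfolding l_def by (metis ln_exp ln_mono)
  define d where "d = l + t * (2 / pi)"
  have d: "0 \<le> d" "d \<le> t\<^sup>2 / 2 * exp (t * (2 / pi)) * (1 / real b)" using lower upper by (simp_all add: d_def)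
  have "rate_error t = - (pi / (2 * t)) * d"
    using t0 by (simp add: rate_error_def l_def[symmetric] d_def field_simps)
  then have "\<bar>rate_error t\<bar> = pi / (2 * t) * d"
    using t0 d(1) by (simp add: abs_mult)
  also have "\<dots> \<le> pi / (2 * t) * (t\<^sup>2 / 2 * exp (t * (2 / pi)) * (1 / real b))"
    using t0 d(2) by (intro mult_left_mono) auto
  also have "\<dots> = pi / 4 * (t * exp (t * (2 / pi))) / real b"
    using t0 by (simp add: power2_eq_square field_simps)
  also have "\<dots> \<le> pi / 4 * (T * exp (T * (2 / pi))) / real b"
    using t by (intro divide_right_mono mult_left_mono mult_mono) (auto intro!: divide_right_mono)
  finally show ?thesis .
qed

end

theorem theorem1p2:
  fixes m b :: "nat \<Rightarrow> nat" and \<alpha> :: real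
    and Q :: "nat \<Rightarrow> real mat"
    and M :: "nat \<Rightarrow> 'a measure"
    and a :: "nat \<Rightarrow> nat \<Rightarrow> nat \<Rightarrow> 'a \<Rightarrow> real"
    and \<Gamma> :: "nat \<Rightarrow> 'a \<Rightarrow> real mat"
    and \<Lambda> :: "nat \<Rightarrow> nat \<Rightarrow> 'a \<Rightarrow> real"
    and N :: "'b measure" and X :: "'b \<Rightarrow> real set"
  assumes \<alpha>: "0 < \<alpha>" "\<alpha> \<le> 1"
    and m_ge: "\<And>n. n \<ge> 1 \<Longrightarrow> m n \<ge> n"
    and b_pos: "\<And>n. n \<ge> 1 \<Longrightarrow> b n > 0"
    and b_ge: "\<And>n. n \<ge> 1 \<Longrightarrow> real (b n) \<ge> real n powr \<alpha>"
    and ln_m: "\<And>\<delta>. \<delta> > 0 \<Longrightarrow> (\<lambda>n. ln (real (m n))) \<in> o(\<lambda>n. real n powr \<delta>)"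
    and Q_carrier: "\<And>n. n \<ge> 1 \<Longrightarrow> Q n \<in> carrier_mat (m n) n"
    and Q_01: "\<And>n j k. n \<ge> 1 \<Longrightarrow> j < m n \<Longrightarrow> k < n \<Longrightarrow> Q n $$ (j, k) \<in> {0, 1}"
    and Q_row_sum: "\<And>n j. n \<ge> 1 \<Longrightarrow> j < m n \<Longrightarrow> (\<Sum>k<n. Q n $$ (j, k)) = real (b n)"
    and prob: "\<And>n. n \<ge> 1 \<Longrightarrow> prob_space (M n)"
    and indep: "\<And>n. n \<ge> 1 \<Longrightarrow>
      prob_space.indep_vars (M n) (\<lambda>_. borel) (\<lambda>(j, k). a n j k) ({..<m n} \<times> {..<n})"
    and cauchy: "\<And>n j k. n \<ge> 1 \<Longrightarrow> j < m n \<Longrightarrow> k < n \<Longrightarrow>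
      distributed (M n) lborel (a n j k) (\<lambda>x. ennreal (1 / (pi * (1 + x\<^sup>2))))"
  defines "\<Gamma> \<equiv> \<lambda>n \<omega>. sparse_mat (Q n) (\<lambda>j k. a n j k \<omega>)"
    and "\<Lambda> \<equiv> \<lambda>n i \<omega>. (eigenvalues_desc (gram_mat (\<Gamma> n \<omega>)) ! i) / (real (m n) ^ 2 * real (b n) ^ 2)"
  shows
    "\<comment> \<open>(i)\<close>
     (\<forall>z. Re z > 0 \<longrightarrow>
        (\<lambda>n. LINT \<omega>|M n. det_inv_sqrt (1\<^sub>m n + (z / (of_nat (m n) ^ 2 * of_nat (b n) ^ 2)) \<cdot>\<^sub>m
               map_mat complex_of_real (gram_mat (\<Gamma> n \<omega>))))
          \<longlonglongrightarrow> exp (- (2 / of_real pi) * csqrt z) \<and>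
        (\<lambda>n. LINT \<omega>|M n. (\<Prod>i<n. (1 + z * of_real (\<Lambda> n i \<omega>)) powr (-1/2)))
          \<longlonglongrightarrow> exp (- (2 / of_real pi) * csqrt z) \<and>
        (poisson_point_process N (\<lambda>x. 1 / (pi * x powr (3/2))) X \<longrightarrow>
          exp (- (2 / of_real pi) * csqrt z) =
            (LINT \<omega>|N. unordered_prod (\<lambda>x. (1 + z * of_real x) powr (-1/2)) (X \<omega>)))) \<and>
     (\<forall>K. compact K \<longrightarrow> K \<subseteq> {z. Re z > 0} \<longrightarrow>
        uniform_limit K
          (\<lambda>n z. LINT \<omega>|M n. det_inv_sqrt (1\<^sub>m n + (z / (of_nat (m n) ^ 2 * of_nat (b n) ^ 2)) \<cdot>\<^sub>m
               map_mat complex_of_real (gram_mat (\<Gamma> n \<omega>))))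
          (\<lambda>z. exp (- (2 / of_real pi) * csqrt z)) sequentially \<and>
        uniform_limit K
          (\<lambda>n z. LINT \<omega>|M n. (\<Prod>i<n. (1 + z * of_real (\<Lambda> n i \<omega>)) powr (-1/2)))
          (\<lambda>z. exp (- (2 / of_real pi) * csqrt z)) sequentially) \<and>
     \<comment> \<open>(ii)\<close>
     (\<forall>\<epsilon>>0. \<exists>\<delta> :: nat \<Rightarrow> real \<Rightarrow> real.
        (\<forall>n\<ge>1. \<forall>t\<ge>0.
           (LINT \<omega>|M n. Determinant.det (1\<^sub>m n + (t\<^sup>2 / (real (m n) ^ 2 * real (b n) ^ 2)) \<cdot>\<^sub>m
              gram_mat (\<Gamma> n \<omega>)) powr (-1/2))
             = (LINT \<omega>|M n. (\<Prod>i<n. (1 + t\<^sup>2 * \<Lambda> n i \<omega>) powr (-1/2))) \<and>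
           (LINT \<omega>|M n. (\<Prod>i<n. (1 + t\<^sup>2 * \<Lambda> n i \<omega>) powr (-1/2)))
             = exp (- (2 / pi) * t * (1 + \<delta> n t))) \<and>
        (\<forall>K. compact K \<longrightarrow> K \<subseteq> {0..} \<longrightarrow>
           (\<forall>c>0. \<forall>\<^sub>F n in sequentially. \<forall>t\<in>K. \<bar>\<delta> n t\<bar> \<le> c * real (b n) powr (-1/2 + \<epsilon>))))"
proof -
  define F where "F n z = (LINT \<omega>|M n. (\<Prod>i<n. (1 + z * of_real (\<Lambda> n i \<omega>)) powr (-1/2)))" for n and z :: complex
  define R where "R n t = (LINT \<omega>|M n. (\<Prod>i<n. (1 + t\<^sup>2 * \<Lambda> n i \<omega>) powr (-1/2)))" for n and t :: real
  define \<delta> where "\<delta> n t = (if t = 0 then 0 else - (pi / (2 * t)) * ln (R n t) - 1)" for n t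
  define l where "l z = exp (- (2 / of_real pi) * csqrt z)" for z
  have sparse: "sparse_cauchy_matrix (M n) (m n) n (b n) (Q n) (a n)" if n: "n \<ge> 1" for n
    using n m_ge[OF n] b_pos[OF n] Q_carrier[OF n] Q_01[OF n] Q_row_sum[OF n] indep[OF n] cauchy[OF n]
    by (intro sparse_cauchy_matrix.intro[OF prob[OF n]] sparse_cauchy_matrix_axioms.intro)
  have det_F: "(LINT \<omega>|M n. det_inv_sqrt (1\<^sub>m n + (z / (of_nat (m n) ^ 2 * of_nat (b n) ^ 2)) \<cdot>\<^sub>m
      map_mat complex_of_real (gram_mat (\<Gamma> n \<omega>)))) = F n z"
    and F_hol: "F n holomorphic_on {z. Re z > 0}"
    and F_bound: "Re z > 0 \<Longrightarrow> norm (F n z) \<le> 1"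
    and F_R: "F n (of_real (t\<^sup>2)) = of_real (R n t)"
    and det_R: "(LINT \<omega>|M n. Determinant.det (1\<^sub>m n + (t\<^sup>2 / (real (m n) ^ 2 * real (b n) ^ 2)) \<cdot>\<^sub>m
      gram_mat (\<Gamma> n \<omega>)) powr (-1/2)) = R n t"
    and R_bounds: "t \<ge> 0 \<Longrightarrow> exp (- (t * (2 / pi))) \<le> R n t"
      "t \<ge> 0 \<Longrightarrow> R n t \<le> exp (- (t * (2 / pi)) + t\<^sup>2 / 2 * exp (t * (2 / pi)) * (1 / real (b n)))"
    and R_\<delta>: "t \<ge> 0 \<Longrightarrow> R n t = exp (- (2 / pi) * t * (1 + \<delta> n t))"
    and \<delta>_bound: "0 \<le> t \<Longrightarrow> t \<le> T \<Longrightarrow> \<bar>\<delta> n t\<bar> \<le> pi / 4 * (T * exp (T * (2 / pi))) / real (b n)"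
    if n: "n \<ge> 1" for n z t T
  proof -
    interpret S: sparse_cauchy_matrix "M n" "m n" n "b n" "Q n" "a n" by (rule sparse[OF n])
    have G: "S.G = \<Gamma> n" by (simp add: fun_eq_iff S.G_def \<Gamma>_def)
    have ev: "S.scaled_ev = \<Lambda> n" by (simp add: fun_eq_iff S.scaled_ev_def \<Lambda>_def G)
    have F: "S.complex_transform = F n" by (simp add: fun_eq_iff S.complex_transform_def F_def ev)
    have R: "S.real_transform = R n" by (simp add: fun_eq_iff S.real_transform_def R_def ev)
    have \<delta>: "S.rate_error = \<delta> n" by (simp add: fun_eq_iff S.rate_error_def \<delta>_def R)
    show "(LINT \<omega>|M n. det_inv_sqrt (1\<^sub>m n + (z / (of_nat (m n) ^ 2 * of_nat (b n) ^ 2)) \<cdot>\<^sub>m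
      map_mat complex_of_real (gram_mat (\<Gamma> n \<omega>)))) = F n z"
      unfolding F_def S.det_inv_sqrt_eq_prod[unfolded G ev] ..
    show "F n holomorphic_on {z. Re z > 0}" using S.complex_transform_holomorphic unfolding F .
    show "Re z > 0 \<Longrightarrow> norm (F n z) \<le> 1" using S.norm_complex_transform_le unfolding F .
    show "F n (of_real (t\<^sup>2)) = of_real (R n t)" using S.complex_transform_of_real unfolding F R .
    show "(LINT \<omega>|M n. Determinant.det (1\<^sub>m n + (t\<^sup>2 / (real (m n) ^ 2 * real (b n) ^ 2)) \<cdot>\<^sub>m
      gram_mat (\<Gamma> n \<omega>)) powr (-1/2)) = R n t"
      unfolding R_def S.det_powr_eq_prod[unfolded G ev] ..
    show "t \<ge> 0 \<Longrightarrow> exp (- (t * (2 / pi))) \<le> R n t"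
      using S.real_transform_bounds(1) unfolding R .
    show "t \<ge> 0 \<Longrightarrow> R n t \<le> exp (- (t * (2 / pi)) + t\<^sup>2 / 2 * exp (t * (2 / pi)) * (1 / real (b n)))"
      using S.real_transform_bounds(2) unfolding R .
    show "t \<ge> 0 \<Longrightarrow> R n t = exp (- (2 / pi) * t * (1 + \<delta> n t))"
      using S.real_transform_eq_exp unfolding R \<delta> .
    show "0 \<le> t \<Longrightarrow> t \<le> T \<Longrightarrow> \<bar>\<delta> n t\<bar> \<le> pi / 4 * (T * exp (T * (2 / pi))) / real (b n)"
      using S.rate_error_bound unfolding \<delta> .
  qed
  have b_top: "filterlim (\<lambda>n. real (b n)) at_top sequentially"
  proof (rule filterlim_at_top_mono)
    show "filterlim (\<lambda>n. real n powr \<alpha>) at_top sequentially"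
      using \<alpha> by real_asymp
    show "\<forall>\<^sub>F n in sequentially. real n powr \<alpha> \<le> real (b n)"
      using eventually_ge_at_top[of 1] by eventually_elim (rule b_ge)
  qed
  have R_lim: "(\<lambda>n. R n t) \<longlonglongrightarrow> exp (- (t * (2 / pi)))" if t: "t \<ge> 0" for t
  proof (rule tendsto_sandwich)
    show "\<forall>\<^sub>F n in sequentially. exp (- (t * (2 / pi))) \<le> R n t"
      using eventually_ge_at_top[of 1] by eventually_elim (rule R_bounds(1)[OF _ t])
    show "\<forall>\<^sub>F n in sequentially. R n t \<le> exp (- (t * (2 / pi)) + t\<^sup>2 / 2 * exp (t * (2 / pi)) * (1 / real (b n)))"
      using eventually_ge_at_top[of 1] by eventually_elim (rule R_bounds(2)[OF _ t])
    have "(\<lambda>n. 1 / real (b n)) \<longlonglongrightarrow> 0"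
      using tendsto_inverse_0_at_top[OF b_top] by (simp add: inverse_eq_divide)
    then have "(\<lambda>n. exp (- (t * (2 / pi)) + t\<^sup>2 / 2 * exp (t * (2 / pi)) * (1 / real (b n)))) \<longlonglongrightarrow>
        exp (- (t * (2 / pi)) + t\<^sup>2 / 2 * exp (t * (2 / pi)) * 0)"
      by (intro tendsto_intros)
    then show "(\<lambda>n. exp (- (t * (2 / pi)) + t\<^sup>2 / 2 * exp (t * (2 / pi)) * (1 / real (b n)))) \<longlonglongrightarrow>
        exp (- (t * (2 / pi)))" by simp
  qed simp
  have F_lim: "(\<lambda>n. F n z) \<longlonglongrightarrow> l z" if z: "z \<in> complex_of_real ` {0<..}" for z
  proof -
    obtain s where s: "s > 0" "z = of_real s" using z by (auto elim!: imageE)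
    define t where "t = sqrt s"
    have t: "t > 0" "z = of_real (t\<^sup>2)" "csqrt z = of_real t" using s by (simp_all add: t_def)
    have "(\<lambda>n. complex_of_real (R n t)) \<longlonglongrightarrow> of_real (exp (- (t * (2 / pi))))"
      using t by (intro tendsto_of_real R_lim) simp
    also have "of_real (exp (- (t * (2 / pi)))) = l z"
      unfolding l_def t(3) by (simp add: exp_of_real[symmetric] mult.commute)
    finally have "(\<lambda>n. complex_of_real (R n t)) \<longlonglongrightarrow> l z" .
    moreover have "\<forall>\<^sub>F n in sequentially. complex_of_real (R n t) = F n z"
      using eventually_ge_at_top[of 1] by eventually_elim (simp only: t(2) F_R)
    ultimately show ?thesis by (rule Lim_transform_eventually)
  qed
  have l_hol: "l holomorphic_on {z. Re z > 0}"
    unfolding l_def[abs_def]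
    by (intro holomorphic_intros) (auto simp: complex_nonpos_Reals_iff)
  have F_unif: "uniform_limit K F l sequentially" if K: "compact K" "K \<subseteq> {z. Re z > 0}" for K
  proof -
    \<comment> \<open>The matrix model is assumed for n \<ge> 1 only, whereas the convergence
      theorem wants holomorphy and the bound for every index.\<close>
    have "uniform_limit K (\<lambda>n. F (Suc n)) l sequentially"
    proof (rule vitali_bounded_convergence[OF open_right_halfplane connected_right_halfplane _ _ l_hol _ _ islimpt_positive_reals _ K])
      show "F (Suc n) holomorphic_on {z. Re z > 0}" for n by (rule F_hol) simp
      show "norm (F (Suc n) z) \<le> 1" if "z \<in> {z. Re z > 0}" for n z using that by (intro F_bound) auto
      show "(\<lambda>n. F (Suc n) z) \<longlonglongrightarrow> l z" if "z \<in> complex_of_real ` {0<..}" for z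
        by (rule LIMSEQ_Suc[OF F_lim[OF that]])
    qed auto
    then show ?thesis by (subst (asm) filterlim_sequentially_Suc)
  qed
  have det_unif: "uniform_limit K
      (\<lambda>n z. LINT \<omega>|M n. det_inv_sqrt (1\<^sub>m n + (z / (of_nat (m n) ^ 2 * of_nat (b n) ^ 2)) \<cdot>\<^sub>m
        map_mat complex_of_real (gram_mat (\<Gamma> n \<omega>)))) l sequentially"
    if K: "compact K" "K \<subseteq> {z. Re z > 0}" for K
  proof (rule uniform_limit_cong[THEN iffD1, OF _ _ F_unif[OF K]])
    show "\<forall>\<^sub>F n in sequentially. \<forall>z\<in>K. F n z = (LINT \<omega>|M n. det_inv_sqrt (1\<^sub>m n + (z / (of_nat (m n) ^ 2 * of_nat (b n) ^ 2)) \<cdot>\<^sub>m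
        map_mat complex_of_real (gram_mat (\<Gamma> n \<omega>))))"
      using eventually_ge_at_top[of 1] by eventually_elim (simp only: det_F, simp)
  qed simp
  have part1: "(\<lambda>n. LINT \<omega>|M n. det_inv_sqrt (1\<^sub>m n + (z / (of_nat (m n) ^ 2 * of_nat (b n) ^ 2)) \<cdot>\<^sub>m
        map_mat complex_of_real (gram_mat (\<Gamma> n \<omega>)))) \<longlonglongrightarrow> l z"
    "(\<lambda>n. F n z) \<longlonglongrightarrow> l z" if "Re z > 0" for z
    using tendsto_uniform_limitI[OF det_unif[of "{z}"], of z] tendsto_uniform_limitI[OF F_unif[of "{z}"], of z] that
    by simp_all
  have rate: "\<forall>\<^sub>F n in sequentially. \<forall>t\<in>K. \<bar>\<delta> n t\<bar> \<le> c * real (b n) powr (-1/2 + \<epsilon>)"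
    if \<epsilon>: "\<epsilon> > 0" and K: "compact K" "K \<subseteq> {0..}" and c: "c > 0" for \<epsilon> c :: real and K
  proof -
    obtain T where T: "\<And>t. t \<in> K \<Longrightarrow> t \<le> T"
      using compact_imp_bounded[OF K(1)] by (auto simp: bounded_real abs_le_iff)
    define C where "C = pi / 4 * (T * exp (T * (2 / pi)))"
    \<comment> \<open>Multiplying the wanted inequality C / b \<le> c b^(-1/2 + \<epsilon>) by b
      leaves the positive exponent 1/2 + \<epsilon>, so it holds as soon as b is large.\<close>
    have "filterlim (\<lambda>x. c * x powr (1/2 + \<epsilon>)) at_top at_top"
      using c \<epsilon> by real_asymp
    then have "filterlim (\<lambda>n. c * real (b n) powr (1/2 + \<epsilon>)) at_top sequentially"
      by (rule filterlim_compose[OF _ b_top])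
    then have "\<forall>\<^sub>F n in sequentially. C \<le> c * real (b n) powr (1/2 + \<epsilon>)"
      by (simp add: filterlim_at_top)
    then show ?thesis
      using eventually_ge_at_top[of 1]
    proof eventually_elim
      case (elim n)
      have bn: "real (b n) > 0" using b_pos[OF elim(2)] by simp
      have "C / real (b n) \<le> c * real (b n) powr (1/2 + \<epsilon>) / real (b n)"
        using elim(1) bn by (intro divide_right_mono) auto
      also have "\<dots> = c * real (b n) powr (-1/2 + \<epsilon>)"
        using bn powr_diff[of "real (b n)" "1/2 + \<epsilon>" 1] by simp
      finally have C: "C / real (b n) \<le> c * real (b n) powr (-1/2 + \<epsilon>)" .
      show ?case
      proof
        fix t assume t: "t \<in> K"
        then have "\<bar>\<delta> n t\<bar> \<le> C / real (b n)"
          unfolding C_def using K(2) T[OF t] by (intro \<delta>_bound[OF elim(2)]) auto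
        with C show "\<bar>\<delta> n t\<bar> \<le> c * real (b n) powr (-1/2 + \<epsilon>)" by simp
      qed
    qed
  qed
  show ?thesis
    unfolding F_def[symmetric] R_def[symmetric] l_def[symmetric]
  proof (intro conjI allI impI)
    fix z :: complex assume z: "Re z > 0"
    show "(\<lambda>n. LINT \<omega>|M n. det_inv_sqrt (1\<^sub>m n + (z / (of_nat (m n) ^ 2 * of_nat (b n) ^ 2)) \<cdot>\<^sub>m
        map_mat complex_of_real (gram_mat (\<Gamma> n \<omega>)))) \<longlonglongrightarrow> l z"
      by (rule part1(1)[OF z])
    show "(\<lambda>n. F n z) \<longlonglongrightarrow> l z" by (rule part1(2)[OF z])
    show "l z = (LINT \<omega>|N. unordered_prod (\<lambda>x. (1 + z * of_real x) powr (-1/2)) (X \<omega>))"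
      if "poisson_point_process N stable_intensity X"
      unfolding l_def by (rule poisson_expectation_unordered_prod[OF that z, symmetric])
  next
    fix K :: "complex set" assume K: "compact K" "K \<subseteq> {z. Re z > 0}"
    show "uniform_limit K
      (\<lambda>n z. LINT \<omega>|M n. det_inv_sqrt (1\<^sub>m n + (z / (of_nat (m n) ^ 2 * of_nat (b n) ^ 2)) \<cdot>\<^sub>m
        map_mat complex_of_real (gram_mat (\<Gamma> n \<omega>)))) l sequentially"
      by (rule det_unif[OF K])
    show "uniform_limit K F l sequentially" by (rule F_unif[OF K])
  next
    fix \<epsilon> :: real assume \<epsilon>: "\<epsilon> > 0"
    show "\<exists>\<delta>. (\<forall>n\<ge>1. \<forall>t\<ge>0. (LINT \<omega>|M n. Determinant.det (1\<^sub>m n + (t\<^sup>2 / (real (m n) ^ 2 * real (b n) ^ 2)) \<cdot>\<^sub>m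
        gram_mat (\<Gamma> n \<omega>)) powr (-1/2)) = R n t \<and> R n t = exp (- (2 / pi) * t * (1 + \<delta> n t))) \<and>
      (\<forall>K. compact K \<longrightarrow> K \<subseteq> {0..} \<longrightarrow>
        (\<forall>c>0. \<forall>\<^sub>F n in sequentially. \<forall>t\<in>K. \<bar>\<delta> n t\<bar> \<le> c * real (b n) powr (-1/2 + \<epsilon>)))"
      by (intro exI[of _ \<delta>] conjI allI impI det_R R_\<delta> rate \<epsilon>)
  qed
qed

end
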